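(* Let $V$ be an $n$-dimensional vector space over a finite field $\mathbb{F}=\mathbb{F}_q$ of odd characteristic. Let $G\leq\mathrm{GL}(V)$ be a finite group which fixes a hyperplane $H\leq V$ pointwise, let $e_H$ be the maximal order of a diagonalizable reflection in $G$ ($e_H=1$ if there is none), and let $l_H\in V^*$ be a linear form defining $H$. Then there exist basic invariants $f_1,\dots,f_n$ of $G$ (so $\mathbb{F}[V]^G=\mathbb{F}[f_1,\dots,f_n]$ with the $f_i$ algebraically independent) and nonnegative integers $a_1,\dots,a_{n-1}$ such that $(l_H^{e_H})^{a_i}$ divides $df_i$ for $i<n$ and $$\frac{df_1}{(l_H^{e_H})^{a_1}},\ \dots,\ \frac{df_{n-1}}{(l_H^{e_H})^{a_{n-1}}},\ df_n$$ generate $(\Omega^1)^G$ as an $\mathbb{F}[V]^G$-module.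
   Context: $\mathbb{F}[V]=S(V^* )$; $\Omega^1=\mathbb{F}[V]\otimes V^*$ with basis $dz_1,\dots,dz_n$ for a basis $z_i$ of $V^*$; $G$ acts on $V^*$ by $(gf)(v)=f(g^{-1}v)$ and diagonally on $\Omega^1$; $df=\sum_i\frac{\partial f}{\partial z_i}dz_i$. A reflection is a finite-order element of $\mathrm{GL}(V)$ whose fixed space is a hyperplane; it is diagonalizable or else a transvection. *)

theory Defs
  imports "HOL-Analysis.Analysis" "HOL-Library.Poly_Mapping"
begin

(* Polynomials in variables indexed by 'n with coefficients in 'a:
  finitely supported maps from monomials (exponent vectors 'n \<Rightarrow>\<^sub>0 nat) to coefficients.
  V = 'a^'n, and the variable z_i is the i-th coordinate function on V. *)
type_synonym ('a, 'n) mpoly = "('n \<Rightarrow>\<^sub>0 nat) \<Rightarrow>\<^sub>0 'a"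

definition mconst :: "'a::zero \<Rightarrow> ('a, 'n) mpoly" where
  "mconst c = Poly_Mapping.single 0 c"

definition mvar :: "'n \<Rightarrow> ('a::{zero,one}, 'n) mpoly" where
  "mvar i = Poly_Mapping.single (Poly_Mapping.single i 1) 1"

definition msubst :: "('n \<Rightarrow> ('a::comm_ring_1, 'm) mpoly) \<Rightarrow> ('a, 'n) mpoly \<Rightarrow> ('a, 'm) mpoly" where
  "msubst P p = (\<Sum>m\<in>Poly_Mapping.keys p.
      mconst (Poly_Mapping.lookup p m) * (\<Prod>i\<in>Poly_Mapping.keys m. P i ^ Poly_Mapping.lookup m i))"

definition mpderiv :: "'n \<Rightarrow> ('a::comm_ring_1, 'n) mpoly \<Rightarrow> ('a, 'n) mpoly" where
  "mpderiv i p = (\<Sum>m\<in>Poly_Mapping.keys p.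
      Poly_Mapping.single (m - Poly_Mapping.single i 1)
        (of_nat (Poly_Mapping.lookup m i) * Poly_Mapping.lookup p m))"

definition linform :: "'a::comm_ring_1 ^ 'n \<Rightarrow> ('a, 'n::finite) mpoly" where
  "linform c = (\<Sum>j\<in>UNIV. mconst (c $ j) * mvar j)"

(* Action of g on F[V]: (g f)(v) = f(g^{-1} v), i.e. z_i \<mapsto> \<Sum>_j (g^{-1})_{ij} z_j. *)
definition gact :: "'a::field ^ 'n ^ 'n \<Rightarrow> ('a, 'n::finite) mpoly \<Rightarrow> ('a, 'n) mpoly" where
  "gact g f = msubst (\<lambda>i. linform (matrix_inv g $ i)) f"

(* Omega^1 = F[V] \<otimes> V^*: a 1-form \<Sum>_i h_i dz_i is represented by its coefficient
  function h :: 'n \<Rightarrow> F[V].  Diagonal action: g(h_i dz_i) = (g h_i)(g dz_i),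
  with g dz_i = \<Sum>_j (g^{-1})_{ij} dz_j. *)
type_synonym ('a, 'n) oneform = "'n \<Rightarrow> ('a, 'n) mpoly"

definition gact1 :: "'a::field ^ 'n ^ 'n \<Rightarrow> ('a, 'n::finite) oneform \<Rightarrow> ('a, 'n) oneform" where
  "gact1 g h = (\<lambda>j. \<Sum>i\<in>UNIV. gact g (h i) * mconst (matrix_inv g $ i $ j))"

definition dform :: "('a::comm_ring_1, 'n) mpoly \<Rightarrow> ('a, 'n) oneform" where
  "dform f = (\<lambda>i. mpderiv i f)"

definition invariants :: "('a::field ^ 'n ^ 'n) set \<Rightarrow> ('a, 'n::finite) mpoly set" where
  "invariants G = {f. \<forall>g\<in>G. gact g f = f}"

definition invariant_forms :: "('a::field ^ 'n ^ 'n) set \<Rightarrow> ('a, 'n::finite) oneform set" where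
  "invariant_forms G = {h. \<forall>g\<in>G. gact1 g h = h}"

definition inv_module_span ::
  "('a::field ^ 'n ^ 'n) set \<Rightarrow> ('n \<Rightarrow> ('a, 'n::finite) oneform) \<Rightarrow> ('a, 'n) oneform set" where
  "inv_module_span G w =
     {(\<lambda>j. \<Sum>k\<in>UNIV. c k * w k j) | c. \<forall>k. c k \<in> invariants G}"

definition basic_invariants :: "('a::field ^ 'n ^ 'n) set \<Rightarrow> ('n \<Rightarrow> ('a, 'n::finite) mpoly) \<Rightarrow> bool" where
  "basic_invariants G f \<longleftrightarrow>
     invariants G = range (\<lambda>P :: ('a, 'n) mpoly. msubst f P) \<and>
     (\<forall>P :: ('a, 'n) mpoly. msubst f P = 0 \<longrightarrow> P = 0)"

definition is_hyperplane :: "('a::field ^ 'n::finite) set \<Rightarrow> bool" where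
  "is_hyperplane W \<longleftrightarrow> (\<exists>c. c \<noteq> 0 \<and> W = {v. (\<Sum>j\<in>UNIV. c $ j * v $ j) = 0})"

definition defines_hyperplane :: "'a::field ^ 'n::finite \<Rightarrow> ('a ^ 'n) set \<Rightarrow> bool" where
  "defines_hyperplane c H \<longleftrightarrow> c \<noteq> 0 \<and> H = {v. (\<Sum>j\<in>UNIV. c $ j * v $ j) = 0}"

definition matpow :: "'a::semiring_1 ^ 'n ^ 'n \<Rightarrow> nat \<Rightarrow> 'a ^ 'n ^ 'n" where
  "matpow g k = ((\<lambda>A. g ** A) ^^ k) (mat 1)"

definition mat_order :: "'a::semiring_1 ^ 'n ^ 'n \<Rightarrow> nat" where
  "mat_order g = (LEAST k. 0 < k \<and> matpow g k = mat 1)"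

definition is_reflection :: "'a::field ^ 'n::finite ^ 'n \<Rightarrow> bool" where
  "is_reflection g \<longleftrightarrow> invertible g \<and> (\<exists>k>0. matpow g k = mat 1) \<and>
     is_hyperplane {v. g *v v = v}"

definition mat_diagonalizable :: "'a::field ^ 'n::finite ^ 'n \<Rightarrow> bool" where
  "mat_diagonalizable g \<longleftrightarrow> (\<exists>(P :: 'a ^ 'n ^ 'n) (D :: 'a ^ 'n ^ 'n). invertible P \<and> (\<forall>i j. i \<noteq> j \<longrightarrow> D $ i $ j = 0) \<and>
     g = P ** D ** matrix_inv P)"

definition eH :: "('a::field ^ 'n::finite ^ 'n) set \<Rightarrow> nat" where
  "eH G = (if \<exists>g\<in>G. is_reflection g \<and> mat_diagonalizable g
           then Max {mat_order g | g. g \<in> G \<and> is_reflection g \<and> mat_diagonalizable g}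
           else 1)"

definition is_matrix_group :: "('a::field ^ 'n::finite ^ 'n) set \<Rightarrow> bool" where
  "is_matrix_group G \<longleftrightarrow> mat 1 \<in> G \<and> (\<forall>g\<in>G. invertible g \<and> matrix_inv g \<in> G) \<and>
     (\<forall>g\<in>G. \<forall>h\<in>G. g ** h \<in> G)"

end

theory Submission
  imports Defs "HOL-Algebra.Multiplicative_Group"
begin

text \<open>
  In suitable coordinates \<open>G\<close> is generated by shears \<open>z\<^sub>i \<mapsto> z\<^sub>i + w\<^sub>i l\<close>, with \<open>w\<close> ranging over an
  additive group \<open>W\<close>, and one scaling \<open>l \<mapsto> \<zeta> l\<close> of order \<open>e\<close>.  The multipliers of \<open>W\<close> form a subfield
  with \<open>Q\<close> elements that contains \<open>\<zeta>\<close>.  Factoring out one line of \<open>W\<close> over this subfield at a time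
  replaces a variable \<open>f\<close> with \<open>w f = f + \<gamma> l^d\<close> by \<open>f^Q - \<gamma>^(Q - 1) l^(d(Q - 1)) f\<close>, and finally
  yields basic invariants \<open>f\<^sub>i\<close> of the shears which are homogenised additive polynomials of degree
  \<open>Q^m\<close> and fixed by the scaling.  Only the linear part \<open>\<lambda>\<close> of \<open>f\<^sub>i\<close> contributes to its differential:
  \<open>df\<^sub>i = \<lambda>(dz)\<close> if \<open>m = 0\<close>, and otherwise \<open>df\<^sub>i = l^(Q^m - 2) (l \<lambda>(dz) - \<lambda>(z) dl)\<close>, where \<open>e\<close> divides
  \<open>Q^m - 1\<close>.  A shear-invariant form has its coefficients along the \<open>\<lambda>(dz)\<close> with \<open>m > 0\<close> divisible by
  \<open>l\<close>, so it is a combination of the forms in parentheses, the \<open>\<lambda>(dz)\<close> with \<open>m = 0\<close>, and \<open>dl\<close>;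
  invariance under the scaling puts a factor \<open>l^(e - 1)\<close> into the coefficients of all but the
  \<open>\<lambda>(dz)\<close>.
\<close>

section \<open>Evaluation of polynomials\<close>

text \<open>Splitting \<open>W\<close> into lines over the prime field would also give invariants of
  the shears, but the scaling by \<open>\<zeta>\<close> need not preserve such a line, and
  \<open>e\<close> need not divide \<open>p^m - 1\<close>. Over the whole multiplier field every
  line is stable under \<open>\<zeta>\<close>, and each power of \<open>l\<close> introduced with a
  new invariant has an exponent divisible by \<open>Q - 1\<close>, so the scaling fixes it. The
  exponents \<open>a\<close> come from \<open>Q^m - 2 = e a + (e - 1)\<close>: the remaining
  \<open>l^(e - 1)\<close> has to stay in the generator to balance the weight of \<open>dl\<close>.
  Generation is shown by expanding an arbitrary invariant form. The delicate point is the
  divisibility by \<open>l\<close> of the coefficients along the \<open>\<lambda>(dz)\<close> with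
  \<open>m > 0\<close>. Modulo \<open>l\<close>, invariance under shears is a linear relation
  between these coefficients whose scalars are the values \<open>\<lambda>(w)\<close>. The
  \<open>\<lambda>\<close> with \<open>m > 0\<close> are independent as functionals on
  \<open>W\<close>, since a dependency would be an invariant linear form that is not accounted for
  by the linear basic invariants.\<close>

locale comm_ring_hom =
  fixes h :: "'a::comm_ring_1 \<Rightarrow> 'b::comm_ring_1"
  assumes hom_one [simp]: "h 1 = 1"
    and hom_add [simp]: "h (x + y) = h x + h y"
    and hom_mult [simp]: "h (x * y) = h x * h y"
begin

lemma hom_zero [simp]: "h 0 = 0"
  using hom_add[of 0 0] by simp

lemma hom_uminus [simp]: "h (- x) = - h x"
  using hom_add[of x "- x"] by (simp add: eq_neg_iff_add_eq_0 add.commute del: hom_add)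

lemma hom_diff [simp]: "h (x - y) = h x - h y"
  using hom_add[of x "- y"] by simp

lemma hom_power [simp]: "h (x ^ n) = h x ^ n"
  by (induction n) auto

lemma hom_sum [simp]: "h (sum f A) = (\<Sum>x\<in>A. h (f x))"
  by (induction A rule: infinite_finite_induct) auto

lemma hom_prod [simp]: "h (prod f A) = (\<Prod>x\<in>A. h (f x))"
  by (induction A rule: infinite_finite_induct) auto

lemma hom_of_nat [simp]: "h (of_nat n) = of_nat n"
  by (induction n) auto

end

lemma mconst_comm_ring_hom: "comm_ring_hom mconst"
  by standard (auto simp: mconst_def single_add mult_single)

interpretation mconst: comm_ring_hom mconst
  by (rule mconst_comm_ring_hom)

lemma lookup_mconst_mult [simp]:
  "Poly_Mapping.lookup (mconst a * p) m = a * Poly_Mapping.lookup p m"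
  unfolding mconst_def
  by (simp add: Poly_Mapping.map.rep_eq when_def flip: mult_map_scale_conv_mult)

lemma mconst_eq_iff [simp]: "mconst a = mconst b \<longleftrightarrow> a = b"
  by (metis lookup_single_eq mconst_def)

lemma mconst_eq_0_iff [simp]: "mconst a = 0 \<longleftrightarrow> a = 0" for a :: "'a::comm_ring_1"
  using mconst_eq_iff[of a 0] by (simp del: mconst_eq_iff)

lemma keys_add_monomial: "Poly_Mapping.keys (m + n) = Poly_Mapping.keys m \<union> Poly_Mapping.keys n"
  for m n :: "'n \<Rightarrow>\<^sub>0 nat"
  by (auto simp: in_keys_iff lookup_add)

lemma mconst_mult_single: "mconst a * Poly_Mapping.single m b = Poly_Mapping.single m (a * b)"
  by (simp add: mconst_def mult_single)

lemma mvar_power: "mvar i ^ n = Poly_Mapping.single (Poly_Mapping.single i n) (1 :: 'a::comm_ring_1)"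
proof (induction n)
  case (Suc n)
  then show ?case
    by (simp add: mvar_def mult_single flip: single_add)
qed simp

lemma poly_mapping_sum_singles: "p = (\<Sum>m\<in>Poly_Mapping.keys p. Poly_Mapping.single m (Poly_Mapping.lookup p m))"
  by (rule poly_mapping_eqI) (auto simp: lookup_sum lookup_single when_def in_keys_iff)

lemma mpoly_single_induct [case_names zero single add]:
  fixes p :: "('a::comm_ring_1, 'n) mpoly"
  assumes "Q 0" "\<And>m a. Q (Poly_Mapping.single m a)" "\<And>p q. Q p \<Longrightarrow> Q q \<Longrightarrow> Q (p + q)"
  shows "Q p"
proof -
  have "Q (\<Sum>m\<in>A. Poly_Mapping.single m (Poly_Mapping.lookup p m))" if "finite A" for A
    using that by induction (auto intro: assms)
  then show ?thesis
    using poly_mapping_sum_singles[of p] by (metis finite_keys)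
qed

lemma single_eq_mconst_mvar:
  "Poly_Mapping.single m a =
    mconst a * (\<Prod>i\<in>Poly_Mapping.keys m. mvar i ^ Poly_Mapping.lookup m i)"
  for a :: "'a::comm_ring_1"
proof -
  have "(\<Prod>i\<in>A. mvar i ^ Poly_Mapping.lookup m i) =
    (Poly_Mapping.single (\<Sum>i\<in>A. Poly_Mapping.single i (Poly_Mapping.lookup m i)) 1 :: ('a, _) mpoly)"
    if "finite A" for A
    using that by induction (auto simp: mvar_power mult_single)
  then have "(\<Prod>i\<in>Poly_Mapping.keys m. mvar i ^ Poly_Mapping.lookup m i) =
    (Poly_Mapping.single m 1 :: ('a, _) mpoly)"
    by (simp flip: poly_mapping_sum_singles)
  then show ?thesis
    by (simp add: mconst_mult_single)
qed

lemma mpoly_induct [case_names const var add mult]: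
  fixes p :: "('a::comm_ring_1, 'n) mpoly"
  assumes const: "\<And>a. Q (mconst a)" and var: "\<And>i. Q (mvar i)"
    and add: "\<And>p q. Q p \<Longrightarrow> Q q \<Longrightarrow> Q (p + q)" and mult: "\<And>p q. Q p \<Longrightarrow> Q q \<Longrightarrow> Q (p * q)"
  shows "Q p"
proof (induction p rule: mpoly_single_induct)
  case zero
  then show ?case using const[of 0] by simp
next
  case (single m a)
  have one: "Q 1"
    using const[of 1] by simp
  have pow: "Q (mvar i ^ n)" for i n
    by (induction n) (auto intro: one var mult)
  have "Q (\<Prod>i\<in>A. mvar i ^ Poly_Mapping.lookup m i)" if "finite A" for A
    using that by induction (auto intro: one pow mult)
  then show ?case
    by (simp add: single_eq_mconst_mvar const mult)
qed (rule add)

text \<open>The case \<open>\<phi> = mconst\<close> is \<open>msubst\<close>; other coefficient maps \<open>\<phi>\<close> allow targets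
  with more structure, such as univariate polynomials over an integral domain.\<close>

definition meval :: "('a::comm_ring_1 \<Rightarrow> 'b::comm_ring_1) \<Rightarrow> ('n \<Rightarrow> 'b) \<Rightarrow> ('a, 'n) mpoly \<Rightarrow> 'b" where
  "meval \<phi> P p = (\<Sum>m\<in>Poly_Mapping.keys p.
      \<phi> (Poly_Mapping.lookup p m) * (\<Prod>i\<in>Poly_Mapping.keys m. P i ^ Poly_Mapping.lookup m i))"

lemma msubst_eq_meval: "msubst P = meval mconst P"
  by (simp add: fun_eq_iff msubst_def meval_def)

context comm_ring_hom
begin

lemma meval_single:
  "meval h P (Poly_Mapping.single m a) =
    h a * (\<Prod>i\<in>Poly_Mapping.keys m. P i ^ Poly_Mapping.lookup m i)"
  by (cases "a = 0") (auto simp: meval_def)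

lemma meval_mconst [simp]: "meval h P (mconst a) = h a"
  by (simp add: mconst_def meval_single)

lemma meval_mvar [simp]: "meval h P (mvar i) = P i"
  by (simp add: mvar_def meval_single)

lemma meval_add: "meval h P (p + q) = meval h P p + meval h P q"
  unfolding meval_def
  by (rule setsum_keys_plus_distrib[where f = "\<lambda>m a. h a * (\<Prod>i\<in>Poly_Mapping.keys m. P i ^ Poly_Mapping.lookup m i)"])
     (simp_all add: distrib_right)

lemma meval_mult: "meval h P (p * q) = meval h P p * meval h P q"
proof (induction p rule: mpoly_single_induct)
  case (single m a)
  show ?case
  proof (induction q rule: mpoly_single_induct)
    case (single n b)
    let ?A = "Poly_Mapping.keys m \<union> Poly_Mapping.keys n"
    have *: "(\<Prod>i\<in>Poly_Mapping.keys k. P i ^ Poly_Mapping.lookup k i) =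
      (\<Prod>i\<in>?A. P i ^ Poly_Mapping.lookup k i)" if "Poly_Mapping.keys k \<subseteq> ?A" for k
      using that by (intro prod.mono_neutral_left) (auto simp: in_keys_iff)
    show ?case
      by (simp add: mult_single meval_single keys_add_monomial lookup_add power_add prod.distrib
        * mult_ac)
  qed (simp_all add: distrib_left meval_add, simp add: meval_def)
qed (simp_all add: distrib_right meval_add, simp add: meval_def)

lemma comm_ring_hom_meval: "comm_ring_hom (meval h P)"
proof
  show "meval h P 1 = 1"
    using meval_mconst[of P 1] by (simp del: meval_mconst)
qed (rule meval_add meval_mult)+

end

interpretation msubst: comm_ring_hom "msubst P" for P
  unfolding msubst_eq_meval by (rule mconst.comm_ring_hom_meval)

lemma msubst_mconst [simp]: "msubst P (mconst a) = mconst a"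
  by (simp add: msubst_eq_meval)

lemma msubst_mvar [simp]: "msubst P (mvar i) = P i"
  by (simp add: msubst_eq_meval)

lemma comm_ring_hom_comp: "comm_ring_hom f \<Longrightarrow> comm_ring_hom g \<Longrightarrow> comm_ring_hom (\<lambda>x. f (g x))"
  by (auto simp: comm_ring_hom_def)

text \<open>This is the universal property by which compositions of substitutions and evaluations
  are computed below.\<close>

lemma mpoly_hom_eqI:
  assumes "comm_ring_hom f" "comm_ring_hom g"
    and "\<And>a. f (mconst a) = g (mconst a)" "\<And>i. f (mvar i) = g (mvar i)"
  shows "f p = g p"
proof -
  interpret f: comm_ring_hom f by fact
  interpret g: comm_ring_hom g by fact
  show ?thesis
    by (induction p rule: mpoly_induct) (simp_all add: assms(3,4))
qed

lemma msubst_msubst: "msubst P (msubst Q p) = msubst (\<lambda>i. msubst P (Q i)) p"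
  by (rule mpoly_hom_eqI[where f = "\<lambda>p. msubst P (msubst Q p)"])
     (auto intro: comm_ring_hom_comp msubst.comm_ring_hom_axioms)

lemma msubst_id: "(\<And>i. P i = mvar i) \<Longrightarrow> msubst P p = p"
  by (rule mpoly_hom_eqI[where g = "\<lambda>p. p"])
     (auto intro: msubst.comm_ring_hom_axioms comm_ring_hom.intro)

lemma hom_msubst:
  assumes "comm_ring_hom f" "\<And>a. f (mconst a) = mconst a"
  shows "f (msubst P p) = msubst (\<lambda>i. f (P i)) p"
  by (rule mpoly_hom_eqI[where f = "\<lambda>p. f (msubst P p)"])
     (auto intro: comm_ring_hom_comp msubst.comm_ring_hom_axioms assms)

subsection \<open>Partial derivatives\<close>

lemma mpderiv_single: "mpderiv i (Poly_Mapping.single m a) =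
  Poly_Mapping.single (m - Poly_Mapping.single i 1) (of_nat (Poly_Mapping.lookup m i) * a)"
  by (cases "a = 0") (auto simp: mpderiv_def)

lemma mpderiv_add [simp]: "mpderiv i (p + q) = mpderiv i p + mpderiv i q"
  unfolding mpderiv_def
  by (rule setsum_keys_plus_distrib[where f = "\<lambda>m a. Poly_Mapping.single (m - Poly_Mapping.single i 1)
        (of_nat (Poly_Mapping.lookup m i) * a)"]) (simp_all add: distrib_left single_add)

lemma mpderiv_0 [simp]: "mpderiv i 0 = 0"
  by (simp add: mpderiv_def)

lemma mpderiv_mconst [simp]: "mpderiv i (mconst a) = 0"
  by (simp add: mconst_def mpderiv_single)

lemma mpderiv_1 [simp]: "mpderiv i 1 = 0"
  using mpderiv_mconst[of i 1] by (simp del: mpderiv_mconst)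

lemma mpderiv_mvar: "mpderiv i (mvar j) = (if i = j then 1 else 0)"
  by (auto simp: mvar_def mpderiv_single lookup_single)

lemma minus_single_add:
  fixes m n :: "'n \<Rightarrow>\<^sub>0 nat"
  assumes "Poly_Mapping.lookup m i \<noteq> 0"
  shows "m - Poly_Mapping.single i 1 + n = m + n - Poly_Mapping.single i 1"
  using assms by (intro poly_mapping_eqI) (auto simp: lookup_add lookup_minus lookup_single when_def)

lemma mpderiv_mult: "mpderiv i (p * q) = mpderiv i p * q + p * mpderiv i q"
proof (induction p rule: mpoly_single_induct)
  case (single m a)
  show ?case
  proof (induction q rule: mpoly_single_induct)
    case (single n b)
    \<comment> \<open>Subtraction of exponents is truncated, so \<open>minus_single_add\<close>
      needs a nonzero exponent; at exponent 0 the coefficient \<open>of_nat 0\<close> makes both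
      sides vanish.\<close>
    have 1: "Poly_Mapping.single (m - Poly_Mapping.single i 1 + n) (of_nat (Poly_Mapping.lookup m i) * a * b)
      = Poly_Mapping.single (m + n - Poly_Mapping.single i 1) (of_nat (Poly_Mapping.lookup m i) * a * b)"
      using minus_single_add[of m i n] by (cases "Poly_Mapping.lookup m i = 0") auto
    have 2: "Poly_Mapping.single (m + (n - Poly_Mapping.single i 1)) (a * (of_nat (Poly_Mapping.lookup n i) * b))
      = Poly_Mapping.single (m + n - Poly_Mapping.single i 1) (a * (of_nat (Poly_Mapping.lookup n i) * b))"
      using minus_single_add[of n i m] by (cases "Poly_Mapping.lookup n i = 0") (auto simp: add.commute)
    show ?case
      unfolding mpderiv_single mult_single 1 2
      by (simp add: lookup_add algebra_simps flip: single_add)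
  qed (simp_all add: algebra_simps)
qed (simp_all add: algebra_simps)

lemma mpderiv_mconst_mult [simp]: "mpderiv i (mconst a * p) = mconst a * mpderiv i p"
  by (simp add: mpderiv_mult)

lemma mpderiv_uminus [simp]: "mpderiv i (- p) = - mpderiv i p"
  using mpderiv_add[of i p "- p"] by (simp add: eq_neg_iff_add_eq_0 add.commute del: mpderiv_add)

lemma mpderiv_diff [simp]: "mpderiv i (p - q) = mpderiv i p - mpderiv i q"
  using mpderiv_add[of i p "- q"] by (simp del: mpderiv_add)

lemma mpderiv_sum [simp]: "mpderiv i (sum f A) = (\<Sum>x\<in>A. mpderiv i (f x))"
  by (induction A rule: infinite_finite_induct) auto

lemma mpderiv_power: "mpderiv i (p ^ n) = of_nat n * p ^ (n - 1) * mpderiv i p"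
proof (induction n)
  case (Suc n)
  then show ?case
    by (cases n) (auto simp: mpderiv_mult algebra_simps)
qed simp

text \<open>Chain rule: as functions of \<open>p\<close> both sides are additive, obey the same
  product rule and vanish on constants, so the variables decide.\<close>

lemma mpderiv_msubst:
  fixes P :: "'n::finite \<Rightarrow> ('a::comm_ring_1, 'm) mpoly"
  shows "mpderiv i (msubst P p) = (\<Sum>j\<in>UNIV. msubst P (mpderiv j p) * mpderiv i (P j))"
proof (induction p rule: mpoly_induct)
  case (var j)
  have "(\<Sum>l\<in>UNIV. msubst P (mpderiv l (mvar j)) * mpderiv i (P l)) =
    (\<Sum>l\<in>UNIV. if l = j then mpderiv i (P l) else 0)"
    by (intro sum.cong) (auto simp: mpderiv_mvar)
  then show ?case by simp
next
  case (mult p q)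
  then show ?case
    by (simp add: mpderiv_mult algebra_simps sum.distrib sum_distrib_left sum_distrib_right)
qed (simp_all add: sum.distrib algebra_simps)

subsection \<open>Cancellation\<close>

text \<open>The library only knows that polynomials over a linearly ordered set of variables form a domain;
  enumerating the finitely many variables by natural numbers reduces the general case to it.\<close>

definition var_index :: "'n::finite \<Rightarrow> nat" where
  "var_index = (SOME f. inj f)"

lemma inj_var_index: "inj (var_index :: 'n::finite \<Rightarrow> nat)"
  unfolding var_index_def using finite_imp_inj_to_nat_seg[OF finite[of "UNIV :: 'n set"]] by (metis someI_ex)

definition enum_vars :: "('a::comm_ring_1, 'n::finite) mpoly \<Rightarrow> ('a, nat) mpoly" where
  "enum_vars = msubst (\<lambda>i. mvar (var_index i))"

interpretation enum_vars: comm_ring_hom enum_vars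
  unfolding enum_vars_def by (rule msubst.comm_ring_hom_axioms)

lemma inj_enum_vars: "inj enum_vars"
proof (rule inj_on_inverseI)
  fix p :: "('b, 'a) mpoly"
  show "msubst (\<lambda>k. mvar (inv_into UNIV var_index k)) (enum_vars p) = p"
    unfolding enum_vars_def msubst_msubst
    by (rule msubst_id) (simp add: inv_f_f[OF inj_var_index])
qed

lemma enum_vars_eq_0_iff [simp]: "enum_vars p = 0 \<longleftrightarrow> p = 0"
  using inj_eq[OF inj_enum_vars, of p 0] by simp

lemma mpoly_mult_eq_0_iff:
  fixes p q :: "('a::idom, 'n::finite) mpoly"
  shows "p * q = 0 \<longleftrightarrow> p = 0 \<or> q = 0"
proof -
  have "p * q = 0 \<longleftrightarrow> enum_vars (p * q) = 0"
    by (rule enum_vars_eq_0_iff[symmetric])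
  also have "\<dots> \<longleftrightarrow> enum_vars p = 0 \<or> enum_vars q = 0"
    unfolding enum_vars.hom_mult by (rule mult_eq_0_iff)
  finally show ?thesis
    by simp
qed

lemma mpoly_mult_left_cancel:
  fixes p q r :: "('a::idom, 'n::finite) mpoly"
  assumes "p \<noteq> 0"
  shows "p * q = p * r \<longleftrightarrow> q = r"
  using mpoly_mult_eq_0_iff[of p "q - r"] assms by (simp add: algebra_simps)

lemma mvar_neq_0 [simp]: "mvar i \<noteq> (0 :: ('a::zero_neq_one, 'n) mpoly)"
  by (metis lookup_single_eq lookup_zero mvar_def zero_neq_one)

lemma mvar_power_neq_0 [simp]: "mvar i ^ n \<noteq> (0 :: ('a::comm_ring_1, 'n) mpoly)"
  by (metis lookup_single_eq lookup_zero mvar_power zero_neq_one)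

section \<open>Subfields and multiplicative subgroups of a finite field\<close>

lemma prime_CHAR_finite_field: "prime CHAR('a::{field,finite})"
  using prime_CHAR_semidom[where ?'a = 'a] finite_imp_CHAR_pos[where ?'a = 'a] by auto

text \<open>The Frobenius identity is applied to polynomials themselves, so the characteristic of
  their ring has to be known.\<close>

lemma CHAR_mpoly: "CHAR(('a::comm_ring_1, 'n) mpoly) = CHAR('a)"
proof (rule CHAR_eqI)
  have "of_nat CHAR('a) = (mconst (of_nat CHAR('a) :: 'a) :: ('a, 'n) mpoly)"
    by (rule mconst.hom_of_nat[symmetric])
  also have "\<dots> = 0"
    unfolding of_nat_CHAR by simp
  finally show "of_nat CHAR('a) = (0 :: ('a, 'n) mpoly)" .
next
  fix n :: nat
  assume "of_nat n = (0 :: ('a, 'n) mpoly)"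
  then have "mconst (of_nat n :: 'a) = (0 :: ('a, 'n) mpoly)"
    by simp
  then show "CHAR('a) dvd n"
    unfolding mconst_eq_0_iff of_nat_eq_0_iff_char_dvd .
qed

text \<open>Multiplication by \<open>x\<close> permutes the finite set \<open>X\<close>, so the
  product of all its elements absorbs the factor \<open>x ^ card X\<close>; that product is nonzero
  and cancels.\<close>

lemma power_card_eq_1:
  fixes X :: "'a::field set"
  assumes "finite X" "0 \<notin> X" "\<And>x y. x \<in> X \<Longrightarrow> y \<in> X \<Longrightarrow> x * y \<in> X" "x \<in> X"
  shows "x ^ card X = 1"
proof -
  have inj: "inj_on ((*) x) X"
    using assms by (auto intro!: inj_onI)
  moreover have "(*) x ` X = X"
    by (rule endo_inj_surj) (use assms inj in auto)
  ultimately have "(\<Prod>y\<in>X. y) = (\<Prod>y\<in>X. x * y)"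
    by (metis prod.reindex_cong)
  also have "\<dots> = x ^ card X * (\<Prod>y\<in>X. y)"
    by (simp add: prod.distrib)
  finally have "x ^ card X * (\<Prod>y\<in>X. y) = 1 * (\<Prod>y\<in>X. y)"
    by simp
  moreover have "(\<Prod>y\<in>X. y) \<noteq> 0"
    using assms by (metis prod_zero_iff)
  ultimately show ?thesis
    by simp
qed

lemma finite_field_power_eq_1:
  fixes x :: "'a::{field,finite}"
  assumes "x \<noteq> 0"
  shows "\<exists>n>0. x ^ n = 1"
proof (intro exI conjI)
  show "card (- {0 :: 'a}) > 0"
    using assms by (subst card_gt_0_iff) auto
  show "x ^ card (- {0 :: 'a}) = 1"
    by (rule power_card_eq_1) (use assms in auto)
qed

text \<open>Starting from \<open>{0}\<close>, elements \<open>a\<close> of \<open>A\<close> are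
  adjoined one at a time. Each \<open>B'\<close>, spanned by \<open>a\<close> and \<open>B\<close>
  over the prime field, has \<open>?p\<close> times as many elements as \<open>B\<close>. Negatives
  come for free, as \<open>- x\<close> is a natural multiple of \<open>x\<close>.\<close>

lemma card_additive_subgroup:
  fixes A :: "'a::{field,finite} set"
  assumes A0: "0 \<in> A" and Aadd: "\<And>x y. x \<in> A \<Longrightarrow> y \<in> A \<Longrightarrow> x + y \<in> A"
  shows "\<exists>r. card A = CHAR('a) ^ r"
proof -
  let ?p = "CHAR('a)"
  have p: "prime ?p" by (rule prime_CHAR_finite_field)
  have scale: "of_nat n * x \<in> B" if "0 \<in> B" "\<And>x y. x \<in> B \<Longrightarrow> y \<in> B \<Longrightarrow> x + y \<in> B" "x \<in> B"
    for B :: "'a set" and n x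
    by (induction n) (auto simp: that algebra_simps)
  have uminus: "- x = of_nat (?p - 1) * x" for x :: 'a
    using prime_gt_0_nat[OF p] by (simp add: of_nat_diff)
  have "\<exists>r. card A = ?p ^ r"
    if "B \<subseteq> A" "0 \<in> B" "\<And>x y. x \<in> B \<Longrightarrow> y \<in> B \<Longrightarrow> x + y \<in> B" "\<exists>r. card B = ?p ^ r" for B
    using that
  proof (induction "card (A - B)" arbitrary: B rule: less_induct)
    case less
    have scaleB: "of_nat n * x \<in> B" if "x \<in> B" for n x
      using scale[of B] less.prems(2,3) that by blast
    show ?case
    proof (cases "A \<subseteq> B")
      case True
      then show ?thesis
        using less.prems by (metis subset_antisym)
    next
      case False
      then obtain a where a: "a \<in> A" "a \<notin> B" by auto
      define B' where "B' = {of_nat i * a + b | i b. b \<in> B}"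
      have sub: "B' \<subseteq> A"
        using less.prems(1) scale[of A] A0 Aadd a(1) by (auto simp: B'_def)
      have BB': "B \<subseteq> B'"
        unfolding B'_def by (force intro: exI[of _ 0])
      have "a \<in> B'"
        unfolding B'_def using less.prems(2) by (force intro: exI[of _ 1])
      then have lt: "card (A - B') < card (A - B)"
        using a BB' by (intro psubset_card_mono) auto
      have B'0: "0 \<in> B'"
        using BB' less.prems(2) by auto
      have B'add: "x + y \<in> B'" if xy: "x \<in> B'" "y \<in> B'" for x y
      proof -
        obtain i b j b' where "x = of_nat i * a + b" "y = of_nat j * a + b'" "b \<in> B" "b' \<in> B"
          using xy unfolding B'_def by blast
        then have "x + y = of_nat (i + j) * a + (b + b')" "b + b' \<in> B"
          using less.prems(3) by (auto simp: algebra_simps)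
        then show ?thesis
          unfolding B'_def by blast
      qed
      have B'_eq: "B' = (\<lambda>(i, b). of_nat i * a + b) ` ({..<?p} \<times> B)"
      proof
        show "B' \<subseteq> (\<lambda>(i, b). of_nat i * a + b) ` ({..<?p} \<times> B)"
        proof
          fix x assume "x \<in> B'"
          then obtain i b where x: "x = of_nat i * a + b" "b \<in> B"
            by (auto simp: B'_def)
          have "of_nat i = (of_nat (i mod ?p + ?p * (i div ?p)) :: 'a)"
            by simp
          also have "\<dots> = of_nat (i mod ?p)"
            unfolding of_nat_add of_nat_mult by simp
          finally have "of_nat i = (of_nat (i mod ?p) :: 'a)" .
          then show "x \<in> (\<lambda>(i, b). of_nat i * a + b) ` ({..<?p} \<times> B)"
            using x prime_gt_0_nat[OF p] by (auto intro!: image_eqI[of _ _ "(i mod ?p, b)"])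
        qed
      qed (auto simp: B'_def)
      have diff: "i = j" if "i \<le> j" "j < ?p" "b \<in> B" "b' \<in> B" "of_nat i * a + b = of_nat j * a + b'"
        for i j b b'
      proof (rule ccontr)
        assume "i \<noteq> j"
        define x where "x = (of_nat (j - i) :: 'a)"
        have "\<not> ?p dvd j - i"
          using that \<open>i \<noteq> j\<close> by (auto dest: dvd_imp_le)
        then have "x \<noteq> 0"
          by (simp add: x_def of_nat_eq_0_iff_char_dvd)
        then obtain n where x1: "x ^ n = 1" and "n > 0"
          using finite_field_power_eq_1 by blast
        have "x * a = b + - b'"
          using that unfolding x_def by (simp add: of_nat_diff algebra_simps)
        then have "x * a \<in> B"
          using less.prems(3) scaleB that uminus by metis
        \<comment> \<open>The inverse of \<open>x\<close> is its power \<open>x ^ (n - 1)\<close>,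
          again the image of a natural number, so multiplication by it stays inside \<open>B\<close>
          and recovers \<open>a\<close>.\<close>
        then have "of_nat ((j - i) ^ (n - 1)) * (x * a) \<in> B"
          by (rule scaleB)
        moreover have "of_nat ((j - i) ^ (n - 1)) * (x * a) = x ^ Suc (n - 1) * a"
          by (simp add: x_def mult_ac)
        moreover have "x ^ Suc (n - 1) = 1"
          using x1 \<open>n > 0\<close> by simp
        ultimately show False
          using a by (metis mult_1)
      qed
      have "inj_on (\<lambda>(i, b). of_nat i * a + b) ({..<?p} \<times> B)"
      proof (rule inj_onI; clarify)
        fix i b j b'
        assume *: "i < ?p" "b \<in> B" "j < ?p" "b' \<in> B" "of_nat i * a + b = of_nat j * a + b'"
        have "i = j"
          using diff[of i j b b'] diff[of j i b' b] * by (cases "i \<le> j") auto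
        then show "i = j \<and> b = b'"
          using * by simp
      qed
      then have "card B' = ?p * card B"
        unfolding B'_eq by (simp add: card_image card_cartesian_product)
      then have "\<exists>r. card B' = ?p ^ r"
        using less.prems(4) by (metis power_Suc)
      with less.hyps[OF lt sub B'0 B'add] show ?thesis
        by blast
    qed
  qed
  moreover have "\<exists>r. card {0 :: 'a} = ?p ^ r"
    by (rule exI[of _ 0]) simp
  ultimately show ?thesis
    using A0 by (metis add_0 empty_subsetI insert_subset singletonD singletonI)
qed

lemma power_eq_1_iff_dvd_Least:
  fixes x :: "'a::field"
  assumes "n > 0" "x ^ n = 1"
  defines "d \<equiv> LEAST k. 0 < k \<and> x ^ k = 1"
  shows "d > 0" "x ^ m = 1 \<longleftrightarrow> d dvd m"
proof -
  have d: "0 < d \<and> x ^ d = 1"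
    unfolding d_def by (rule LeastI) (use assms in auto)
  then show "d > 0" ..
  have "x ^ m = x ^ (d * (m div d) + m mod d)"
    by simp
  also have "\<dots> = x ^ (m mod d)"
    unfolding power_add power_mult using d by simp
  finally have m: "x ^ m = x ^ (m mod d)" .
  show "x ^ m = 1 \<longleftrightarrow> d dvd m"
  proof
    assume "x ^ m = 1"
    moreover have "m mod d < d"
      using d by simp
    ultimately have "m mod d = 0"
      using m not_less_Least[of "m mod d" "\<lambda>k. 0 < k \<and> x ^ k = 1"] by (auto simp: d_def)
    then show "d dvd m" by auto
  qed (use d m in auto)
qed

text \<open>Cyclicity of the unit group is a theorem about explicit ring structures; the field type
  is packaged as the structure \<open>R\<close> to apply it.\<close>

lemma finite_field_primitive_element:
  "\<exists>a::'a::{field,finite}. a \<noteq> 0 \<and> (\<forall>x. x \<noteq> 0 \<longrightarrow> (\<exists>i::nat. x = a ^ i))"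
proof -
  define R :: "'a ring" where "R = \<lparr>carrier = UNIV, mult = (*), one = 1, zero = 0, add = (+)\<rparr>"
  have [simp]: "carrier R = UNIV" "mult R = (*)" "one R = 1" "zero R = 0" "add R = (+)"
    by (simp_all add: R_def)
  have "abelian_group R"
  proof (rule abelian_groupI)
    fix x assume "x \<in> carrier R"
    show "\<exists>y\<in>carrier R. y \<oplus>\<^bsub>R\<^esub> x = \<zero>\<^bsub>R\<^esub>"
      by (auto intro!: exI[of _ "- x"])
  qed (auto simp: algebra_simps)
  moreover have "Group.comm_monoid R"
    by (rule comm_monoidI) (auto simp: algebra_simps)
  ultimately have cr: "cring R"
    by (rule cringI) (auto simp: algebra_simps)
  have "Units R = carrier R - {\<zero>\<^bsub>R\<^esub>}"
  proof -
    have "\<exists>y. y * x = 1 \<and> x * y = 1" if "x \<noteq> 0" for x :: 'a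
      using that by (intro exI[of _ "inverse x"]) auto
    then show ?thesis
      by (auto simp: Units_def)
  qed
  then have "field R"
    by (rule cring.cring_fieldI[OF cr])
  then obtain a where a: "a \<in> carrier (mult_of R)"
    "carrier (mult_of R) = {a [^]\<^bsub>R\<^esub> i | i::nat. i \<in> UNIV}"
    using field.finite_field_mult_group_has_gen[of R] by auto
  have pow: "a [^]\<^bsub>R\<^esub> i = a ^ i" for i :: nat
    by (induction i) (auto simp: nat_pow_def mult.commute)
  show ?thesis
    using a unfolding pow by (intro exI[of _ a]) auto
qed

text \<open>For a primitive element \<open>a\<close>, the least positive \<open>d\<close> with
  \<open>a ^ d \<in> X\<close> gives the generator: the remainder of any other exponent modulo
  \<open>d\<close> must be 0.\<close>

lemma mult_subgroup_cyclic:
  fixes X :: "'a::{field,finite} set"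
  assumes "0 \<notin> X" "1 \<in> X" and mult: "\<And>x y. x \<in> X \<Longrightarrow> y \<in> X \<Longrightarrow> x * y \<in> X"
  obtains z where "z \<in> X" "X = range (\<lambda>m::nat. z ^ m)"
proof -
  obtain a :: 'a where a: "a \<noteq> 0" "\<And>x. x \<noteq> 0 \<Longrightarrow> \<exists>i::nat. x = a ^ i"
    using finite_field_primitive_element by blast
  have pow: "x ^ n \<in> X" if "x \<in> X" for x n
    using that by (induction n) (auto intro: assms)
  obtain n where "a ^ n = 1" "n > 0"
    using finite_field_power_eq_1[OF a(1)] by blast
  define d where "d = (LEAST d. 0 < d \<and> a ^ d \<in> X)"
  have d: "0 < d \<and> a ^ d \<in> X"
    unfolding d_def by (rule LeastI[of _ n]) (use \<open>a ^ n = 1\<close> \<open>n > 0\<close> assms in auto)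
  have "\<exists>m. x = (a ^ d) ^ m" if "x \<in> X" for x
  proof -
    have "x \<noteq> 0"
      using that assms by auto
    then obtain i where i: "x = a ^ i"
      using a(2) by blast
    define y where "y = (a ^ d) ^ (i div d)"
    have "y \<in> X"
      unfolding y_def using d by (rule pow[OF conjunct2])
    \<comment> \<open>The inverse of \<open>y\<close> is the power \<open>y ^ (card X - 1)\<close>
      and therefore lies in \<open>X\<close>.\<close>
    have "card X > 0"
      using assms by (auto simp: card_gt_0_iff)
    then have "y * y ^ (card X - 1) = 1"
      using power_card_eq_1[of X y] \<open>y \<in> X\<close> assms by (simp flip: power_Suc)
    have "x = a ^ (d * (i div d) + i mod d)"
      by (simp add: i)
    then have "x = y * a ^ (i mod d)"
      unfolding power_add power_mult y_def .
    then have "a ^ (i mod d) = x * y ^ (card X - 1)"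
      using \<open>y * y ^ (card X - 1) = 1\<close> by (simp add: mult_ac)
    then have "a ^ (i mod d) \<in> X"
      using that \<open>y \<in> X\<close> by (simp add: mult pow)
    moreover have "i mod d < d"
      using d by simp
    ultimately have "i mod d = 0"
      using not_less_Least[of "i mod d" "\<lambda>d. 0 < d \<and> a ^ d \<in> X"] by (auto simp: d_def)
    then show ?thesis
      using \<open>x = y * a ^ (i mod d)\<close> by (auto simp: y_def)
  qed
  then show ?thesis
    using d pow by (intro that[of "a ^ d"]) auto
qed

section \<open>Elementary extension steps\<close>

text \<open>Reading a polynomial as univariate in variable \<open>i\<close> makes degrees and root
  counting available. Coefficients are taken in variables indexed by \<open>nat\<close>, where they
  are known to form a domain.\<close>

definition as_upoly :: "'n \<Rightarrow> ('a::comm_ring_1, 'n::finite) mpoly \<Rightarrow> ('a, nat) mpoly poly" where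
  "as_upoly i = meval (\<lambda>c. [:mconst c:]) (\<lambda>j. if j = i then [:0, 1:] else [:enum_vars (mvar j):])"

lemma const_upoly_hom: "comm_ring_hom (\<lambda>c. [:mconst c:] :: ('a::comm_ring_1, nat) mpoly poly)"
  by standard (auto simp: one_pCons)

interpretation const_upoly: comm_ring_hom "\<lambda>c. [:mconst c:] :: ('a::comm_ring_1, nat) mpoly poly"
  by (rule const_upoly_hom)

interpretation as_upoly: comm_ring_hom "as_upoly i"
  unfolding as_upoly_def by (rule const_upoly.comm_ring_hom_meval)

lemma as_upoly_mconst [simp]: "as_upoly i (mconst c) = [:mconst c:]"
  by (simp add: as_upoly_def)

lemma as_upoly_mvar: "as_upoly i (mvar j) = (if j = i then [:0, 1:] else [:enum_vars (mvar j):])"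
  by (simp add: as_upoly_def)

lemma poly_hom: "comm_ring_hom (\<lambda>p. poly p x)"
  by standard auto

lemma pcompose_hom: "comm_ring_hom (\<lambda>p. pcompose p r)"
  by standard (auto simp: pcompose_add pcompose_mult pcompose_1)

lemma enum_vars_mconst [simp]: "enum_vars (mconst c) = mconst c"
  by (simp add: enum_vars_def)

lemma poly_as_upoly: "poly (as_upoly i p) (enum_vars (mvar i)) = enum_vars p"
  by (rule mpoly_hom_eqI[where f = "\<lambda>p. poly (as_upoly i p) (enum_vars (mvar i))"])
     (auto intro!: comm_ring_hom_comp[OF poly_hom] as_upoly.comm_ring_hom_axioms
       enum_vars.comm_ring_hom_axioms simp: as_upoly_mvar)

text \<open>Replacing variable \<open>i\<close> by \<open>N\<close> is composition of univariate
  polynomials, and composition with a nonconstant polynomial over a domain is injective.\<close>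

lemma msubst_upd_eq_0:
  fixes p :: "('a::idom, 'n::finite) mpoly"
  assumes "Polynomial.degree (as_upoly i N) > 0" "msubst (mvar(i := N)) p = 0"
  shows "p = 0"
proof -
  have "as_upoly i (msubst (mvar(i := N)) p) = pcompose (as_upoly i p) (as_upoly i N)"
    by (rule mpoly_hom_eqI[where f = "\<lambda>p. as_upoly i (msubst (mvar(i := N)) p)"])
       (auto intro!: comm_ring_hom_comp[OF pcompose_hom] comm_ring_hom_comp[OF as_upoly.comm_ring_hom_axioms]
         as_upoly.comm_ring_hom_axioms msubst.comm_ring_hom_axioms simp: as_upoly_mvar pcompose_pCons)
  then have "as_upoly i p = 0"
    using assms pcompose_eq_0 by fastforce
  then have "enum_vars p = 0"
    using poly_as_upoly[of i p] by simp
  then show ?thesis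
    by simp
qed

text \<open>For \<open>b = \<gamma> ^ (Q - 1)\<close> and \<open>n = d * (Q - 1)\<close>, the entry
  at \<open>i\<close> is the product of the translates
  \<open>mvar i + t \<gamma> (mvar k) ^ d\<close> over all \<open>t\<close> in a field with
  \<open>Q\<close> elements. Each other entry is corrected by a power of \<open>mvar i\<close> so
  that the same translations can fix it.\<close>

definition step_polys ::
  "'n \<Rightarrow> 'n \<Rightarrow> nat \<Rightarrow> 'a \<Rightarrow> nat \<Rightarrow> ('n \<Rightarrow> 'a) \<Rightarrow> ('n \<Rightarrow> nat) \<Rightarrow> 'n \<Rightarrow> ('a::comm_ring_1, 'n) mpoly" where
  "step_polys k i Q b n \<beta> a j =
    (if j = k then mvar k
     else if j = i then mvar i ^ Q - mconst b * mvar k ^ n * mvar i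
     else mvar j - mconst (\<beta> j) * mvar i ^ a j)"

text \<open>The substitution is a composition of two injective ones: \<open>mvar i\<close> is
  replaced by \<open>N\<close>, of positive degree in \<open>mvar i\<close>, and then the triangular
  automorphism \<open>\<theta> (- 1)\<close>, with inverse \<open>\<theta> 1\<close>, is
  applied.\<close>

lemma step_polys_inj:
  fixes p :: "('a::idom, 'n::finite) mpoly"
  assumes "i \<noteq> k" "Q \<ge> 2" "msubst (step_polys k i Q b n \<beta> a) p = 0"
  shows "p = 0"
proof -
  define N :: "('a, 'n) mpoly" where "N = mvar i ^ Q - mconst b * mvar k ^ n * mvar i"
  define \<theta> where "\<theta> s j = (if j = k \<or> j = i then mvar j else mvar j + mconst (s * \<beta> j) * mvar i ^ a j)"
    for s j
  have "msubst (\<theta> (- 1)) (msubst (mvar(i := N)) p) = msubst (step_polys k i Q b n \<beta> a) p"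
    unfolding msubst_msubst
    by (rule arg_cong[where f = "\<lambda>P. msubst P p"])
       (use assms in \<open>auto simp: \<theta>_def N_def step_polys_def fun_eq_iff\<close>)
  then have "msubst (\<theta> 1) (msubst (\<theta> (- 1)) (msubst (mvar(i := N)) p)) = 0"
    using assms by simp
  moreover have "msubst (\<theta> 1) (msubst (\<theta> (- 1)) q) = q" for q
    unfolding msubst_msubst by (rule msubst_id) (auto simp: \<theta>_def)
  ultimately have "msubst (mvar(i := N)) p = 0"
    by simp
  moreover have "Polynomial.degree (as_upoly i N) > 0"
  proof -
    obtain v where v: "as_upoly i N = Polynomial.monom 1 Q - [:0, v:]"
    proof
      show "as_upoly i N = Polynomial.monom 1 Q - [:0, mconst b * enum_vars (mvar k) ^ n:]"
        using assms(1) by (simp add: N_def as_upoly_mvar monom_altdef poly_const_pow)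
    qed
    have "Polynomial.coeff (as_upoly i N) Q = 1"
      using assms(2) unfolding v by (auto simp: coeff_pCons split: nat.splits)
    then have "Polynomial.degree (as_upoly i N) \<ge> Q"
      by (intro le_degree) auto
    then show ?thesis
      using assms(2) by simp
  qed
  ultimately show ?thesis
    by (rule msubst_upd_eq_0[rotated])
qed

text \<open>The entry at \<open>i\<close> provides a monic equation of degree \<open>Q\<close> for
  \<open>mvar i\<close> over the subalgebra of the \<open>g j\<close>. Powers of
  \<open>mvar i\<close> thus reduce to exponents below \<open>Q\<close>, which makes the span
  \<open>S\<close> closed under products; it contains all variables.\<close>

lemma step_polys_module:
  fixes p :: "('a::comm_ring_1, 'n::finite) mpoly"
    and b :: 'a and n :: nat and \<beta> :: "'n \<Rightarrow> 'a" and a :: "'n \<Rightarrow> nat"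
  assumes "i \<noteq> k" "Q \<ge> 2"
  defines "g \<equiv> step_polys k i Q b n \<beta> a"
  shows "\<exists>q. p = (\<Sum>a<Q. msubst g (q a) * mvar i ^ a)"
proof -
  define S where "S = range (\<lambda>q. \<Sum>a<Q. msubst g (q a) * mvar i ^ a)"
  have SI: "(\<Sum>a<Q. msubst g (q a) * mvar i ^ a) \<in> S" for q
    by (simp add: S_def)
  have S_add: "p + q \<in> S" if "p \<in> S" "q \<in> S" for p q
  proof -
    obtain p' q' where "p = (\<Sum>a<Q. msubst g (p' a) * mvar i ^ a)"
      "q = (\<Sum>a<Q. msubst g (q' a) * mvar i ^ a)"
      using \<open>p \<in> S\<close> \<open>q \<in> S\<close> by (auto simp: S_def)
    then have "p + q = (\<Sum>a<Q. msubst g (p' a + q' a) * mvar i ^ a)"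
      by (simp add: sum.distrib distrib_right)
    then show ?thesis
      using SI[of "\<lambda>a. p' a + q' a"] by simp
  qed
  have S_smult: "msubst g r * p \<in> S" if "p \<in> S" for p r
  proof -
    obtain p' where "p = (\<Sum>a<Q. msubst g (p' a) * mvar i ^ a)"
      using \<open>p \<in> S\<close> by (auto simp: S_def)
    then have "msubst g r * p = (\<Sum>a<Q. msubst g (r * p' a) * mvar i ^ a)"
      by (simp add: sum_distrib_left mult.assoc)
    then show ?thesis
      using SI[of "\<lambda>a. r * p' a"] by simp
  qed
  have S_zero: "0 \<in> S"
    unfolding S_def by (rule image_eqI[of _ _ "\<lambda>_. 0"]) auto
  have S_sum: "sum f A \<in> S" if "\<And>x. x \<in> A \<Longrightarrow> f x \<in> S" for f and A :: "nat set"
    using that by (induction A rule: infinite_finite_induct) (auto simp: S_zero S_add)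
  have S_pow: "mvar i ^ m \<in> S" for m
  proof (induction m rule: less_induct)
    case (less m)
    show ?case
    proof (cases "m < Q")
      case True
      have "mvar i ^ m = (\<Sum>a<Q. if a = m then mvar i ^ a else 0)"
        using True by simp
      also have "\<dots> = (\<Sum>a<Q. msubst g (if a = m then 1 else 0) * mvar i ^ a)"
        by (intro sum.cong) auto
      finally have eq: "mvar i ^ m = (\<Sum>a<Q. msubst g (if a = m then 1 else 0) * mvar i ^ a)" .
      show ?thesis
        by (subst eq) (rule SI)
    next
      case False
      then obtain d where d: "m = Q + d"
        by (metis le_add_diff_inverse linorder_not_less)
      have "mvar i ^ Q = msubst g (mvar i) + msubst g (mconst b * mvar k ^ n) * mvar i"
        using assms by (simp add: g_def step_polys_def)
      then have "mvar i ^ m = msubst g (mvar i) * mvar i ^ d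
          + msubst g (mconst b * mvar k ^ n) * mvar i ^ Suc d"
        unfolding d power_add power_Suc by (simp add: algebra_simps)
      moreover have "d < m" "Suc d < m"
        using d assms by auto
      ultimately show ?thesis
        by (metis less S_add S_smult)
    qed
  qed
  have S_mult: "p * q \<in> S" if "p \<in> S" "q \<in> S" for p q
  proof -
    obtain p' q' where pq: "p = (\<Sum>a<Q. msubst g (p' a) * mvar i ^ a)"
      "q = (\<Sum>a<Q. msubst g (q' a) * mvar i ^ a)"
      using \<open>p \<in> S\<close> \<open>q \<in> S\<close> by (auto simp: S_def)
    have "p * q = (\<Sum>a<Q. \<Sum>b<Q. msubst g (p' a * q' b) * mvar i ^ (a + b))"
      unfolding pq sum_product by (simp add: power_add mult_ac)
    then show ?thesis
      by (auto intro!: S_sum S_smult S_pow simp del: msubst.hom_mult)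
  qed
  have "p \<in> S"
  proof (induction p rule: mpoly_induct)
    case (const c)
    then show ?case
      using S_smult[OF S_pow[of 0], of "mconst c"] by simp
  next
    case (var j)
    show ?case
    proof (cases "j = i")
      case True
      then show ?thesis using S_pow[of 1] by simp
    next
      case False
      then have "mvar j = msubst g (mvar j) * mvar i ^ 0 +
        msubst g (if j = k then 0 else mconst (\<beta> j)) * mvar i ^ a j"
        using assms by (auto simp: g_def step_polys_def)
      then show ?thesis
        by (metis S_add S_smult S_pow)
    qed
  qed (auto intro: S_add S_mult)
  then show ?thesis
    by (auto simp: S_def)
qed

text \<open>Over the subalgebra generated by the \<open>step_polys\<close>, an element of the full polynomial ring is a
  polynomial of degree less than \<open>Q\<close> in \<open>mvar i\<close>.  If it takes the same value at \<open>Q\<close> translates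
  of \<open>mvar i\<close>, it is constant.\<close>

lemma step_polys_invariants:
  fixes p :: "('a::field, 'n::finite) mpoly"
    and b :: 'a and n :: nat and \<beta> :: "'n \<Rightarrow> 'a" and a :: "'n \<Rightarrow> nat"
  assumes "i \<noteq> k" "Q \<ge> 2" "finite K" "card K = Q" "c \<noteq> 0"
  defines "g \<equiv> step_polys k i Q b n \<beta> a"
  assumes hom: "\<And>t. t \<in> K \<Longrightarrow> comm_ring_hom (T t)"
    and const: "\<And>t r. t \<in> K \<Longrightarrow> T t (mconst r) = mconst r"
    and fix_g: "\<And>t j. t \<in> K \<Longrightarrow> T t (g j) = g j"
    and shift: "\<And>t. t \<in> K \<Longrightarrow> T t (mvar i) = mvar i + mconst (t * c) * mvar k ^ d"
    and inv: "\<And>t. t \<in> K \<Longrightarrow> T t p = p"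
  shows "p \<in> range (msubst g)"
proof -
  obtain q where q: "p = (\<Sum>a<Q. msubst g (q a) * mvar i ^ a)"
    using step_polys_module[OF assms(1,2)] unfolding g_def by blast
  define F where "F = (\<Sum>a<Q. Polynomial.monom (enum_vars (msubst g (q a))) a) - [:enum_vars p:]"
  define x where "x t = enum_vars (mvar i + mconst (t * c) * mvar k ^ d)" for t
  have "poly F (x t) = 0" if "t \<in> K" for t
  proof -
    interpret T: comm_ring_hom "T t" by (rule hom) fact
    have "T t (msubst g r) = msubst g r" for r
      using hom_msubst[OF hom const, of t g r] fix_g that by simp
    then have "p = (\<Sum>a<Q. msubst g (q a) * (mvar i + mconst (t * c) * mvar k ^ d) ^ a)"
      using arg_cong[OF q, of "T t"] inv[OF that] shift[OF that] by simp
    then show ?thesis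
      using arg_cong[of _ _ enum_vars]
      by (simp add: F_def x_def poly_sum poly_monom)
  qed
  then have "x ` K \<subseteq> {y. poly F y = 0}"
    by auto
  moreover have "inj_on x K"
  proof (rule inj_onI)
    fix t u
    assume "x t = x u"
    then have "mconst (t * c) * mvar k ^ d = (mconst (u * c) * mvar k ^ d :: ('a, 'n) mpoly)"
      unfolding x_def inj_eq[OF inj_enum_vars] by simp
    then have "mconst (t * c) = (mconst (u * c) :: ('a, 'n) mpoly)"
      by (metis mpoly_mult_left_cancel mult.commute mvar_power_neq_0)
    then show "t = u"
      using \<open>c \<noteq> 0\<close> unfolding mconst_eq_iff by simp
  qed
  ultimately have card: "Q \<le> card {y. poly F y = 0}" if "F \<noteq> 0"
    unfolding assms(4)[symmetric] using card_inj_on_le poly_roots_finite[OF that] by blast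
  have "Polynomial.degree F < Q"
  proof -
    have "Polynomial.degree F \<le> Q - 1"
      unfolding F_def
    proof (intro degree_diff_le degree_sum_le)
      fix a assume "a \<in> {..<Q}"
      then show "Polynomial.degree (Polynomial.monom (enum_vars (msubst g (q a))) a) \<le> Q - 1"
        by (intro order_trans[OF degree_monom_le]) auto
    qed auto
    then show ?thesis
      using assms(2) by simp
  qed
  have "F = 0"
  proof (rule ccontr)
    assume "F \<noteq> 0"
    note card[OF this] also note card_poly_roots_bound[OF \<open>F \<noteq> 0\<close>] also note \<open>Polynomial.degree F < Q\<close>
    finally show False by simp
  qed
  then have "Polynomial.coeff F 0 = 0"
    by simp
  moreover have "Polynomial.coeff F 0 = (\<Sum>a<Q. if a = 0 then enum_vars (msubst g (q a)) else 0) - enum_vars p"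
    by (simp add: F_def coeff_sum)
  moreover have "(\<Sum>a<Q. if a = 0 then enum_vars (msubst g (q a)) else 0) = enum_vars (msubst g (q 0))"
    using assms(2) by (subst sum.delta) auto
  ultimately have "enum_vars (msubst g (q 0)) = enum_vars p"
    by simp
  then have "msubst g (q 0) = p"
    by (simp add: inj_eq[OF inj_enum_vars])
  then show ?thesis
    by blast
qed

section \<open>Invariants of a group of shears\<close>

definition shear :: "'n \<Rightarrow> ('n \<Rightarrow> 'a) \<Rightarrow> 'a \<Rightarrow> ('a::comm_ring_1, 'n) mpoly \<Rightarrow> ('a, 'n) mpoly" where
  "shear k w x = msubst (\<lambda>i. if i = k then mconst x * mvar k else mvar i + mconst (w i) * mvar k)"

interpretation shear: comm_ring_hom "shear k w x"
  unfolding shear_def by (rule msubst.comm_ring_hom_axioms)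

lemma shear_mconst [simp]: "shear k w x (mconst a) = mconst a"
  by (simp add: shear_def)

lemma shear_mvar: "shear k w x (mvar i) = (if i = k then mconst x * mvar k else mvar i + mconst (w i) * mvar k)"
  by (simp add: shear_def)

lemma shear_mvar_same [simp]: "shear k w x (mvar k) = mconst x * mvar k"
  by (simp add: shear_def)

lemma shear_msubst: "shear k w x (msubst f p) = msubst (\<lambda>i. shear k w x (f i)) p"
  by (rule hom_msubst[OF shear.comm_ring_hom_axioms]) simp

locale additive_shears =
  fixes k :: "'n::finite" and W :: "('n \<Rightarrow> 'a::{field,finite}) set"
  assumes W_zero: "(\<lambda>_. 0) \<in> W"
    and W_add: "w \<in> W \<Longrightarrow> w' \<in> W \<Longrightarrow> (\<lambda>j. w j + w' j) \<in> W"
begin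

text \<open>The largest subfield over which \<open>W\<close> is a vector space; by finiteness,
  closure under sums and products makes it a field.\<close>

definition K :: "'a set" where
  "K = {t. \<forall>w\<in>W. (\<lambda>j. t * w j) \<in> W}"

definition Q :: nat where
  "Q = card K"

lemma scale_W: "t \<in> K \<Longrightarrow> w \<in> W \<Longrightarrow> (\<lambda>j. t * w j) \<in> W"
  by (simp add: K_def)

lemma K_zero: "0 \<in> K" and K_one: "1 \<in> K"
  by (simp_all add: K_def W_zero)

lemma K_add: "s + t \<in> K" if "s \<in> K" "t \<in> K"
  using that W_add by (fastforce simp: K_def distrib_right)

lemma K_mult: "s * t \<in> K" if "s \<in> K" "t \<in> K"
  using that by (auto simp: K_def mult.assoc)

lemma Q_ge_2: "Q \<ge> 2"
proof -
  have "card {0, 1 :: 'a} \<le> Q"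
    unfolding Q_def using K_zero K_one by (intro card_mono) auto
  then show ?thesis by simp
qed

lemma Q_gt_0 [simp]: "Q > 0"
  using Q_ge_2 by simp

text \<open>Two consequences are used: \<open>Q\<close> is zero in the field, and raising to a power
  of \<open>Q\<close> is additive.\<close>

lemma Q_prime_power: "\<exists>r>0. Q = CHAR('a) ^ r"
proof -
  obtain r where "card K = CHAR('a) ^ r"
    using card_additive_subgroup[OF K_zero K_add] by blast
  moreover have "r \<noteq> 0"
  proof
    assume "r = 0"
    then show False
      using calculation Q_ge_2 by (simp add: Q_def)
  qed
  ultimately show ?thesis
    by (auto simp: Q_def)
qed

lemma of_nat_Q: "of_nat Q = (0 :: 'a)"
  using Q_prime_power by (auto simp: of_nat_eq_0_iff_char_dvd)

lemma of_nat_Q_mpoly: "of_nat Q = (0 :: ('a, 'n) mpoly)"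
  using arg_cong[OF of_nat_Q, of "mconst :: 'a \<Rightarrow> ('a, 'n) mpoly"] unfolding mconst.hom_of_nat by simp

lemma frobenius_mpoly: "(x + y :: ('a, 'n) mpoly) ^ (Q ^ n) = x ^ (Q ^ n) + y ^ (Q ^ n)"
proof -
  obtain r where "Q = CHAR(('a, 'n) mpoly) ^ r"
    using Q_prime_power by (auto simp: CHAR_mpoly)
  moreover have "prime CHAR(('a, 'n) mpoly)"
    unfolding CHAR_mpoly by (rule prime_CHAR_finite_field)
  ultimately show ?thesis
    by (intro freshmans_dream'[where n = "r * n"]) (simp_all flip: power_mult)
qed

lemma K_power_Q_minus_1: "t ^ (Q - 1) = 1" if "t \<in> K" "t \<noteq> 0"
proof -
  have "t ^ card (K - {0}) = 1"
    by (rule power_card_eq_1) (use that K_mult in auto)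
  then show ?thesis
    using K_zero by (simp add: Q_def)
qed

lemma K_power_Q: "t ^ Q = t" if "t \<in> K"
proof (cases "t = 0")
  case False
  have "t ^ Suc (Q - 1) = t"
    unfolding power_Suc using K_power_Q_minus_1[OF that False] by simp
  then show ?thesis
    using Q_ge_2 by simp
qed (use Q_ge_2 in simp)

lemma K_power_Q_power: "t ^ (Q ^ n) = t" if "t \<in> K"
  by (induction n) (use that in \<open>simp_all add: K_power_Q power_mult\<close>)

definition lin :: "('n \<Rightarrow> 'n \<Rightarrow> 'a) \<Rightarrow> 'n \<Rightarrow> ('a, 'n) mpoly" where
  "lin \<alpha> j = (\<Sum>i\<in>-{k}. mconst (\<alpha> j i) * mvar i)"

end

text \<open>The \<open>f j\<close> are homogenised additive polynomials of degree \<open>Q ^ m j\<close> in the variables other than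
  \<open>mvar k\<close>, and \<open>\<alpha>\<close> holds the coefficients of their linear parts, which alone determine the
  derivatives since the characteristic divides \<open>Q\<close>.\<close>

locale shear_stage = additive_shears k W
  for k :: "'n::finite" and W :: "('n \<Rightarrow> 'a::{field,finite}) set" +
  fixes f :: "'n \<Rightarrow> ('a, 'n) mpoly" and c :: "'n \<Rightarrow> ('n \<Rightarrow> 'a) \<Rightarrow> 'a"
    and m :: "'n \<Rightarrow> nat" and \<alpha> :: "'n \<Rightarrow> 'n \<Rightarrow> 'a"
  assumes fk: "f k = mvar k"
    and c_scale: "\<And>j w t. j \<noteq> k \<Longrightarrow> w \<in> W \<Longrightarrow> t \<in> K \<Longrightarrow> c j (\<lambda>i. t * w i) = t * c j w"
    and act: "\<And>j w x. j \<noteq> k \<Longrightarrow> w \<in> W \<Longrightarrow> x \<in> K \<Longrightarrow> x \<noteq> 0 \<Longrightarrow>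
      shear k w x (f j) = f j + mconst (c j w) * mvar k ^ (Q ^ m j)"
    and inj: "\<And>p. msubst f p = 0 \<Longrightarrow> p = 0"
    and gen: "\<And>p. (\<And>w. w \<in> W \<Longrightarrow> shear k w 1 p = p) \<Longrightarrow> p \<in> range (msubst f)"
    and deriv: "\<And>i j. i \<noteq> k \<Longrightarrow> j \<noteq> k \<Longrightarrow> mpderiv i (f j) = mconst (\<alpha> j i) * mvar k ^ (Q ^ m j - 1)"
    and deriv_k: "\<And>j. j \<noteq> k \<Longrightarrow> mpderiv k (f j) = (if m j = 0 then 0 else - lin \<alpha> j * mvar k ^ (Q ^ m j - 2))"
    and f_lin: "\<And>j. j \<noteq> k \<Longrightarrow> m j = 0 \<Longrightarrow> f j = lin \<alpha> j"
    and ker: "\<And>v i. (\<And>j. j \<noteq> k \<Longrightarrow> (\<Sum>i\<in>-{k}. \<alpha> j i * v i) = 0) \<Longrightarrow> i \<noteq> k \<Longrightarrow> v i = 0"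

lemma (in additive_shears) stage_initial: "shear_stage k W mvar (\<lambda>j w. w j) (\<lambda>_. 0) (\<lambda>j i. if i = j then 1 else 0)"
proof -
  have lin: "lin (\<lambda>j i. if i = j then 1 else 0) j = mvar j" if "j \<noteq> k" for j
  proof -
    have "lin (\<lambda>j i. if i = j then 1 else 0) j = (\<Sum>i\<in>-{k}. if i = j then mvar i else 0)"
      unfolding lin_def by (intro sum.cong) auto
    then show ?thesis
      using that by simp
  qed
  have sum: "(\<Sum>i\<in>-{k}. (if i = j then 1 else 0) * v i) = v j" if "j \<noteq> k" for j and v :: "'n \<Rightarrow> 'a"
  proof -
    have "(\<Sum>i\<in>-{k}. (if i = j then 1 else 0) * v i) = (\<Sum>i\<in>-{k}. if i = j then v i else 0)"
      by (intro sum.cong) auto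
    then show ?thesis
      using that by simp
  qed
  have id: "msubst mvar p = p" for p :: "('a, 'n) mpoly"
    by (rule msubst_id) simp
  have rng: "range (msubst mvar) = (UNIV :: ('a, 'n) mpoly set)"
    by (simp add: id)
  have "v i = 0" if "\<And>j. j \<noteq> k \<Longrightarrow> (\<Sum>i\<in>-{k}. (if i = j then 1 else 0) * v i) = 0" "i \<noteq> k"
    for v :: "'n \<Rightarrow> 'a" and i
    using that(1)[OF that(2)] sum[OF that(2), of v] by simp
  then show ?thesis
    by unfold_locales (simp_all add: lin shear_mvar id rng mpderiv_mvar)
qed

text \<open>A vector \<open>w0\<close> that still moves some \<open>f j\<close> is neutralised:
  \<open>f i\<close> becomes the product over its translates under the line \<open>K w0\<close>, and
  from every other \<open>f j\<close> a multiple of a power of \<open>f i\<close> is subtracted that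
  cancels its translation by \<open>w0\<close>. A vector that moved nothing before moves nothing
  afterwards, so the set of moving vectors loses at least \<open>w0\<close>.\<close>

lemma (in shear_stage) stage_step:
  assumes w0: "w0 \<in> W" and i0: "i0 \<noteq> k" "c i0 w0 \<noteq> 0"
  shows "\<exists>f' c' m' \<alpha>'. shear_stage k W f' c' m' \<alpha>' \<and>
    {w \<in> W. \<exists>j. j \<noteq> k \<and> c' j w \<noteq> 0} \<subset> {w \<in> W. \<exists>j. j \<noteq> k \<and> c j w \<noteq> 0}"
proof -
  \<comment> \<open>Minimality of \<open>m i\<close> allows the other translations to be cancelled:
    their degrees \<open>Q ^ m j\<close> are then multiples of \<open>Q ^ m i\<close> by the power
    \<open>a j\<close> of \<open>Q\<close>.\<close>
  obtain i where i: "i \<noteq> k" "c i w0 \<noteq> 0"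
    and i_min: "\<And>j. j \<noteq> k \<Longrightarrow> c j w0 \<noteq> 0 \<Longrightarrow> m i \<le> m j"
    using ex_has_least_nat[of "\<lambda>j. j \<noteq> k \<and> c j w0 \<noteq> 0" i0 m] i0 by auto
  define c0 where "c0 = c i w0"
  define N where "N = Q ^ m i"
  define a where "a j = Q ^ (m j - m i)" for j
  \<comment> \<open>Chosen so that \<open>\<beta> j * c0 ^ a j = c j w0\<close>. The difference in
    \<open>a j\<close> can be truncated only where \<open>c j w0 = 0\<close>, and there
    \<open>\<beta> j = 0\<close>.\<close>
  define \<beta> where "\<beta> j = (if c j w0 = 0 then 0 else c j w0 / c0 ^ a j)" for j
  define b where "b = c0 ^ (Q - 1)"
  define n where "n = N * (Q - 1)"
  define g where "g = step_polys k i Q b n \<beta> a"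
  define f' where "f' j = msubst f (g j)" for j
  define c' where "c' j w = (if j = i then c i w ^ Q - b * c i w else c j w - \<beta> j * c i w ^ a j)" for j w
  define m' where "m' = m(i := Suc (m i))"
  \<comment> \<open>For \<open>m j > m i\<close> the subtracted power of \<open>f i\<close> is a
    \<open>Q\<close>-th power and has derivative zero. For \<open>m j \<le> m i\<close> the exponent
    \<open>a j\<close> is 1, and \<open>\<beta> j \<noteq> 0\<close> only if
    \<open>m j = m i\<close>.\<close>
  define \<alpha>' where "\<alpha>' j l =
    (if j = i then - b * \<alpha> i l else if m j \<le> m i then \<alpha> j l - \<beta> j * \<alpha> i l else \<alpha> j l)" for j l
  have c0: "c0 \<noteq> 0"
    using i by (simp add: c0_def)
  have N: "N > 0"
    by (simp add: N_def)
  have n_N: "n + N = N * Q"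
    unfolding n_def using Q_ge_2 by (cases Q) auto
  have N_a: "N * a j = Q ^ m j" if "j \<noteq> k" "\<beta> j \<noteq> 0" for j
    using that i_min[of j] by (auto simp: \<beta>_def N_def a_def split: if_splits simp flip: power_add)
  have b_c0: "b * c0 = c0 ^ Q"
    using Q_ge_2 by (simp add: b_def flip: power_Suc2)
  have \<beta>_c0: "\<beta> j * c0 ^ a j = c j w0" for j
    using c0 by (simp add: \<beta>_def)
  have frob: "(x + mconst s * mvar k ^ l) ^ (Q ^ r) = x ^ (Q ^ r) + mconst (s ^ (Q ^ r)) * mvar k ^ (l * Q ^ r)"
    for x :: "('a, 'n) mpoly" and s l r
    by (simp add: frobenius_mpoly power_mult_distrib power_mult)
  note frob1 = frob[of _ _ _ 1, simplified]
  note frob_a = frob[of _ _ _ "m j - m i" for j, folded a_def]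

  have f'k: "f' k = mvar k"
    by (simp add: f'_def g_def step_polys_def fk)
  have f'i: "f' i = f i ^ Q - mconst b * mvar k ^ n * f i"
    using i by (simp add: f'_def g_def step_polys_def fk)
  have f'j: "f' j = f j - mconst (\<beta> j) * f i ^ a j" if "j \<noteq> i" "j \<noteq> k" for j
    using that by (simp add: f'_def g_def step_polys_def fk)
  have msubst_f': "msubst f' p = msubst f (msubst g p)" for p
    by (simp add: msubst_msubst f'_def[abs_def])

  have c'_scale: "c' j (\<lambda>i. t * w i) = t * c' j w" if "j \<noteq> k" "w \<in> W" "t \<in> K" for j w t
    using that i
    by (simp add: c'_def c_scale power_mult_distrib K_power_Q K_power_Q_power a_def algebra_simps)

  have act': "shear k w x (f' j) = f' j + mconst (c' j w) * mvar k ^ (Q ^ m' j)"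
    if j: "j \<noteq> k" and w: "w \<in> W" and x: "x \<in> K" "x \<noteq> 0" for j w x
  proof (cases "j = i")
    case True
    \<comment> \<open>The exponent \<open>n\<close> is a multiple of \<open>Q - 1\<close>, so
      scaling by a nonzero element of \<open>K\<close> fixes the new coefficient
      \<open>mvar k ^ n\<close>.\<close>
    have "x ^ n = 1"
      unfolding n_def mult.commute[of N] power_mult using K_power_Q_minus_1[OF x] by simp
    then have "shear k w x (f' i) = (f i + mconst (c i w) * mvar k ^ N) ^ Q
        - mconst b * mvar k ^ n * (f i + mconst (c i w) * mvar k ^ N)"
      using act[OF i(1) w x] by (simp add: f'i N_def power_mult_distrib flip: mconst.hom_power)
    also have "\<dots> = f i ^ Q + mconst (c i w ^ Q) * mvar k ^ (N * Q)
        - mconst b * mvar k ^ n * f i - mconst (b * c i w) * mvar k ^ (n + N)"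
      unfolding frob1 by (simp add: algebra_simps power_add)
    also have "\<dots> = f' i + mconst (c' i w) * mvar k ^ (N * Q)"
      unfolding n_N by (simp add: f'i c'_def algebra_simps)
    also have "N * Q = Q ^ m' i"
      by (simp add: N_def m'_def)
    finally show ?thesis
      using True by simp
  next
    case False
    have "shear k w x (f' j) = f j + mconst (c j w) * mvar k ^ (Q ^ m j)
        - mconst (\<beta> j) * (f i + mconst (c i w) * mvar k ^ N) ^ a j"
      using act[OF i(1) w x] act[OF j w x] False j by (simp add: f'j N_def)
    also have "\<dots> = f' j + mconst (c j w) * mvar k ^ (Q ^ m j)
        - mconst (\<beta> j * c i w ^ a j) * mvar k ^ (N * a j)"
      unfolding frob_a using False j by (simp add: f'j algebra_simps)
    also have "\<dots> = f' j + mconst (c' j w) * mvar k ^ (Q ^ m j)"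
      using False N_a[OF j] by (cases "\<beta> j = 0") (auto simp: c'_def algebra_simps)
    finally show ?thesis
      using False by (simp add: m'_def)
  qed

  have inj': "p = 0" if "msubst f' p = 0" for p
    using that inj step_polys_inj[OF i(1) Q_ge_2] unfolding msubst_f' g_def by blast

  have gen': "p \<in> range (msubst f')" if p: "\<And>w. w \<in> W \<Longrightarrow> shear k w 1 p = p" for p
  proof -
    obtain q where q: "p = msubst f q"
      using gen[OF p] by blast
    \<comment> \<open>\<open>T t\<close> is the shear along \<open>t * w0\<close>, written in
      variables that stand for the \<open>f j\<close>. Injectivity of \<open>msubst f\<close> turns
      invariance of \<open>p\<close> into invariance of \<open>q\<close>.\<close>
    define T where "T t = msubst (\<lambda>j. if j = k then mvar k else
      mvar j + mconst (t * c j w0) * mvar k ^ (Q ^ m j))" for t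
    have hom_T: "comm_ring_hom (T t)" for t
      unfolding T_def by (rule msubst.comm_ring_hom_axioms)
    have T_mvar: "T t (mvar j) = (if j = k then mvar k else
      mvar j + mconst (t * c j w0) * mvar k ^ (Q ^ m j))" for t j
      by (simp add: T_def)
    have "T t q = q" if t: "t \<in> K" for t
    proof -
      have "msubst f (T t q) = msubst (\<lambda>j. shear k (\<lambda>i. t * w0 i) 1 (f j)) q"
        unfolding T_def msubst_msubst
        by (rule arg_cong[where f = "\<lambda>P. msubst P q"])
           (auto simp: fun_eq_iff fk act[OF _ scale_W[OF t w0] K_one] c_scale[OF _ w0 t])
      also have "\<dots> = shear k (\<lambda>i. t * w0 i) 1 p"
        unfolding q shear_msubst ..
      also have "\<dots> = msubst f q"
        using p[OF scale_W[OF t w0]] q by simp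
      finally have "msubst f (T t q - q) = 0"
        by simp
      then show ?thesis
        using inj by fastforce
    qed
    moreover have "T t (g j) = g j" if t: "t \<in> K" for t j
    proof -
      interpret T: comm_ring_hom "T t" by (rule hom_T)
      have T_const: "T t (mconst r) = mconst r" for r
        by (simp add: T_def)
      consider "j = k" | "j = i" | "j \<noteq> k" "j \<noteq> i" by blast
      then show ?thesis
      proof cases
        case 1
        then show ?thesis by (simp add: g_def step_polys_def T_mvar)
      next
        case 2
        have "T t (g i) = (mvar i + mconst (t * c0) * mvar k ^ N) ^ Q
            - mconst b * mvar k ^ n * (mvar i + mconst (t * c0) * mvar k ^ N)"
          using i by (simp add: g_def step_polys_def T_mvar T_const c0_def N_def)
        also have "\<dots> = mvar i ^ Q + mconst ((t * c0) ^ Q) * mvar k ^ (N * Q)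
            - mconst b * mvar k ^ n * mvar i - mconst (t * (b * c0)) * mvar k ^ (n + N)"
          unfolding frob1 by (simp add: algebra_simps power_add)
        also have "\<dots> = g i"
          unfolding n_N b_c0 using i
          by (simp add: g_def step_polys_def power_mult_distrib K_power_Q[OF t])
        finally show ?thesis
          using 2 by simp
      next
        case 3
        have "T t (g j) = mvar j + mconst (t * c j w0) * mvar k ^ (Q ^ m j)
            - mconst (\<beta> j) * (mvar i + mconst (t * c0) * mvar k ^ N) ^ a j"
          using i 3 by (simp add: g_def step_polys_def T_mvar T_const c0_def N_def)
        also have "\<dots> = mvar j + mconst (t * c j w0) * mvar k ^ (Q ^ m j)
            - mconst (\<beta> j) * mvar i ^ a j - mconst (\<beta> j * (t * c0) ^ a j) * mvar k ^ (N * a j)"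
          unfolding frob_a by (simp add: algebra_simps)
        \<comment> \<open>The exponent \<open>a j\<close> is a power of \<open>Q\<close>, so
          \<open>t ^ a j = t\<close> for \<open>t\<close> in \<open>K\<close>.\<close>
        also have "\<beta> j * (t * c0) ^ a j = t * c j w0"
          using \<beta>_c0[of j] K_power_Q_power[OF t] by (simp add: power_mult_distrib a_def mult_ac)
        also have "mvar j + mconst (t * c j w0) * mvar k ^ (Q ^ m j)
            - mconst (\<beta> j) * mvar i ^ a j - mconst (t * c j w0) * mvar k ^ (N * a j) = g j"
        proof (cases "\<beta> j = 0")
          case True
          then have "c j w0 = 0"
            using \<beta>_c0[of j] by simp
          then show ?thesis
            using 3 by (simp add: g_def step_polys_def)
        next
          case False
          then show ?thesis
            using 3 N_a[of j] by (simp add: g_def step_polys_def)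
        qed
        finally show ?thesis .
      qed
    qed
    ultimately have "q \<in> range (msubst g)"
      unfolding g_def
      by (intro step_polys_invariants[where K = K and c = c0 and d = N and T = T] hom_T i(1) Q_ge_2 c0)
         (auto simp: Q_def T_mvar i c0_def N_def T_def)
    then show ?thesis
      using q by (auto simp: msubst_f')
  qed

  have a_eq: "a j = 1" if "m j \<le> m i" for j
    using that by (simp add: a_def)
  have deriv_power_0: "mpderiv l (p ^ (Q * r)) = 0" for l r and p :: "('a, 'n) mpoly"
    by (simp add: mpderiv_power of_nat_Q_mpoly)
  have deriv_a: "mpderiv l (p ^ a j) = 0" if gt: "\<not> m j \<le> m i" for l j and p :: "('a, 'n) mpoly"
  proof -
    obtain d where "m j - m i = Suc d"
      using gt by (cases "m j - m i") auto
    then show ?thesis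
      using deriv_power_0[of l p "Q ^ d"] by (simp add: a_def)
  qed
  have m_eq: "m j = m i" if "j \<noteq> k" "m j \<le> m i" "\<beta> j \<noteq> 0" for j
    using that i_min[of j] by (auto simp: \<beta>_def split: if_splits)

  have deriv': "mpderiv l (f' j) = mconst (\<alpha>' j l) * mvar k ^ (Q ^ m' j - 1)" if "l \<noteq> k" "j \<noteq> k" for l j
  proof (cases "j = i")
    case True
    have "mpderiv l (f' i) = - mconst b * mvar k ^ n * (mconst (\<alpha> i l) * mvar k ^ (N - 1))"
      using deriv_power_0[of l "f i" 1] deriv[OF \<open>l \<noteq> k\<close> i(1)] \<open>l \<noteq> k\<close>
      by (simp add: f'i mpderiv_mult mpderiv_power mpderiv_mvar mult.assoc N_def)
    also have "\<dots> = mconst (\<alpha>' i l) * mvar k ^ (n + (N - 1))"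
      by (simp add: \<alpha>'_def power_add mult_ac)
    also have "n + (N - 1) = N * Q - 1"
      using n_N N by linarith
    also have "N * Q = Q ^ m' i"
      by (simp add: N_def m'_def mult.commute)
    finally show ?thesis
      using True by simp
  next
    case False
    show ?thesis
    proof (cases "m j \<le> m i")
      case True
      then show ?thesis
        using False that deriv i m_eq[OF \<open>j \<noteq> k\<close> True] a_eq[OF True]
        by (cases "\<beta> j = 0") (auto simp: f'j \<alpha>'_def m'_def ring_distribs mult.assoc)
    next
      case gt: False
      then show ?thesis
        using False that deriv deriv_a[OF gt] by (auto simp: f'j \<alpha>'_def m'_def)
    qed
  qed

  have lin_i: "lin \<alpha>' i = - mconst b * lin \<alpha> i"
    by (simp add: lin_def \<alpha>'_def sum_distrib_left mult.assoc sum_negf)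
  have lin_le: "lin \<alpha>' j = lin \<alpha> j - mconst (\<beta> j) * lin \<alpha> i" if "j \<noteq> i" "m j \<le> m i" for j
    using that by (simp add: lin_def \<alpha>'_def sum_distrib_left algebra_simps sum_subtractf)
  have lin_gt: "lin \<alpha>' j = lin \<alpha> j" if "j \<noteq> i" "\<not> m j \<le> m i" for j
    using that by (simp add: lin_def \<alpha>'_def)

  have deriv'_k: "mpderiv k (f' j) = (if m' j = 0 then 0 else - lin \<alpha>' j * mvar k ^ (Q ^ m' j - 2))"
    if "j \<noteq> k" for j
  proof (cases "j = i")
    case True
    have d: "mpderiv k (f' i) = - mconst b * (of_nat n * mvar k ^ (n - 1) * f i + mvar k ^ n * mpderiv k (f i))"
      using deriv_power_0[of k "f i" 1]
      by (simp add: f'i mpderiv_mult mpderiv_power mpderiv_mvar algebra_simps)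
    have "mpderiv k (f' i) = mconst b * lin \<alpha> i * mvar k ^ (N * Q - 2)"
    \<comment> \<open>For \<open>m i = 0\<close> only the derivative of \<open>mvar k ^ n\<close>
      contributes, with \<open>n = Q - 1\<close> equal to -1 in the ring. For \<open>m i > 0\<close>
      the number \<open>n\<close> is divisible by \<open>Q\<close>, and only
      \<open>mpderiv k (f i)\<close> survives.\<close>
    proof (cases "m i = 0")
      case True
      then have "N = 1" "n = Q - 1"
        by (simp_all add: N_def n_def)
      moreover have "of_nat (Q - 1) = (- 1 :: ('a, 'n) mpoly)"
        using Q_ge_2 of_nat_Q_mpoly by (simp add: of_nat_diff)
      moreover have "Q - 1 - 1 = Q - 2" by simp
      ultimately show ?thesis
        using d True f_lin[OF i(1) True] deriv_k[OF i(1)] by (simp add: algebra_simps)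
    next
      case False
      then obtain d' where d': "N = Q * Q ^ d'"
        unfolding N_def by (metis not0_implies_Suc power_Suc)
      have "2 * 1 \<le> Q * Q ^ d'"
        by (rule mult_le_mono[OF Q_ge_2]) (simp add: Suc_leI)
      then have "N \<ge> 2"
        by (simp add: d')
      then have exp: "n + (N - 2) = N * Q - 2"
        using n_N by simp
      have "of_nat n = (0 :: ('a, 'n) mpoly)"
        unfolding n_def d' by (simp add: of_nat_Q_mpoly)
      then show ?thesis
        using d False deriv_k[OF i(1)] unfolding exp[symmetric] by (simp add: N_def power_add algebra_simps)
    qed
    then show ?thesis
      using True by (simp add: lin_i m'_def N_def mult.commute)
  next
    case False
    show ?thesis
    proof (cases "m j \<le> m i")
      case True
      then show ?thesis
        using False that deriv_k i m_eq[OF \<open>j \<noteq> k\<close> True] a_eq[OF True]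
        by (cases "\<beta> j = 0") (auto simp: f'j lin_le m'_def ring_distribs mult.assoc)
    next
      case gt: False
      then show ?thesis
        using False that deriv_k deriv_a[OF gt] by (auto simp: f'j lin_gt m'_def)
    qed
  qed

  have f'_lin: "f' j = lin \<alpha>' j" if "j \<noteq> k" "m' j = 0" for j
  proof -
    have "j \<noteq> i" "m j = 0"
      using that by (auto simp: m'_def split: if_splits)
    then show ?thesis
      using that f_lin i m_eq[of j] a_eq[of j] by (cases "\<beta> j = 0") (auto simp: f'j lin_le)
  qed

  \<comment> \<open>\<open>\<alpha>'\<close> arises from \<open>\<alpha>\<close> by row operations:
    row \<open>i\<close> is scaled by \<open>- b \<noteq> 0\<close>, and multiples of the old row
    \<open>i\<close> are subtracted from other rows.\<close>
  have ker': "v l = 0" if v: "\<And>j. j \<noteq> k \<Longrightarrow> (\<Sum>l\<in>-{k}. \<alpha>' j l * v l) = 0" and "l \<noteq> k" for v l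
  proof (rule ker)
    have "b \<noteq> 0"
      using c0 by (simp add: b_def)
    moreover have "(\<Sum>l\<in>-{k}. \<alpha>' i l * v l) = - b * (\<Sum>l\<in>-{k}. \<alpha> i l * v l)"
      by (simp add: \<alpha>'_def sum_distrib_left mult.assoc sum_negf)
    ultimately have vi: "(\<Sum>l\<in>-{k}. \<alpha> i l * v l) = 0"
      using v[OF i(1)] by simp
    fix j assume "j \<noteq> k"
    have "(\<Sum>l\<in>-{k}. \<alpha>' j l * v l) = (\<Sum>l\<in>-{k}. \<alpha> j l * v l)" if "j \<noteq> i"
    proof (cases "m j \<le> m i")
      case True
      then have "(\<Sum>l\<in>-{k}. \<alpha>' j l * v l) = (\<Sum>l\<in>-{k}. \<alpha> j l * v l) - \<beta> j * (\<Sum>l\<in>-{k}. \<alpha> i l * v l)"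
        using that by (simp add: \<alpha>'_def sum_distrib_left algebra_simps sum_subtractf)
      then show ?thesis
        using vi by simp
    next
      case False
      then show ?thesis
        using that by (simp add: \<alpha>'_def)
    qed
    then show "(\<Sum>l\<in>-{k}. \<alpha> j l * v l) = 0"
      using v[OF \<open>j \<noteq> k\<close>] vi by metis
  qed (rule \<open>l \<noteq> k\<close>)

  have "shear_stage k W f' c' m' \<alpha>'"
    by unfold_locales (fact f'k c'_scale act' inj' gen' deriv' deriv'_k f'_lin ker')+
  moreover have "{w \<in> W. \<exists>j. j \<noteq> k \<and> c' j w \<noteq> 0} \<subset> {w \<in> W. \<exists>j. j \<noteq> k \<and> c j w \<noteq> 0}"
  proof (rule psubsetI)
    have "c' j w = 0" if "\<And>j. j \<noteq> k \<Longrightarrow> c j w = 0" "j \<noteq> k" for j w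
    proof -
      have "c i w = 0" "c j w = 0" "Q \<noteq> 0" "a j \<noteq> 0"
        using that i Q_ge_2 by (auto simp: a_def)
      then show ?thesis
        by (simp add: c'_def)
    qed
    then show "{w \<in> W. \<exists>j. j \<noteq> k \<and> c' j w \<noteq> 0} \<subseteq> {w \<in> W. \<exists>j. j \<noteq> k \<and> c j w \<noteq> 0}"
      by blast
    have "c' j w0 = 0" if "j \<noteq> k" for j
      using b_c0 \<beta>_c0[of j] by (simp add: c'_def flip: c0_def)
    then show "{w \<in> W. \<exists>j. j \<noteq> k \<and> c' j w \<noteq> 0} \<noteq> {w \<in> W. \<exists>j. j \<noteq> k \<and> c j w \<noteq> 0}"
      using w0 i by blast
  qed
  ultimately show ?thesis
    by blast
qed

text \<open>Induction on the number of vectors of \<open>W\<close> that still move some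
  \<open>f j\<close>, starting from the variables themselves.\<close>

lemma (in additive_shears) stage_final:
  "\<exists>f c m \<alpha>. shear_stage k W f c m \<alpha> \<and> (\<forall>w\<in>W. \<forall>j. j \<noteq> k \<longrightarrow> c j w = 0)"
proof -
  have "\<exists>f c m \<alpha>. shear_stage k W f c m \<alpha> \<and> (\<forall>w\<in>W. \<forall>j. j \<noteq> k \<longrightarrow> c j w = 0)" if "shear_stage k W f c m \<alpha>" for f c m \<alpha>
    using that
  proof (induction "card {w \<in> W. \<exists>j. j \<noteq> k \<and> c j w \<noteq> 0}" arbitrary: f c m \<alpha> rule: less_induct)
    case less
    show ?case
    proof (cases "\<forall>w\<in>W. \<forall>j. j \<noteq> k \<longrightarrow> c j w = 0")
      case True
      then show ?thesis
        using less.prems by blast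
    next
      case False
      then obtain w0 i0 where "w0 \<in> W" "i0 \<noteq> k" "c i0 w0 \<noteq> 0"
        by blast
      from shear_stage.stage_step[OF less.prems this] obtain f' c' m' \<alpha>' where st: "shear_stage k W f' c' m' \<alpha>'"
        and sub: "{w \<in> W. \<exists>j. j \<noteq> k \<and> c' j w \<noteq> 0} \<subset> {w \<in> W. \<exists>j. j \<noteq> k \<and> c j w \<noteq> 0}"
        by blast
      show ?thesis
        by (rule less.hyps[OF psubset_card_mono[OF _ sub] st]) simp
    qed
  qed
  then show ?thesis
    using stage_initial by blast
qed

section \<open>Linear substitutions\<close>

text \<open>Substitution by the rows of \<open>S\<close>, without the inverse that occurs in
  \<open>gact\<close>. It reverses products (\<open>lin_act_lin_act\<close>), and on a group it has
  the same invariants as \<open>gact\<close>.\<close>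

definition lin_act :: "'a::comm_ring_1 ^ 'n ^ 'n \<Rightarrow> ('a, 'n::finite) mpoly \<Rightarrow> ('a, 'n) mpoly" where
  "lin_act S = msubst (\<lambda>i. linform (S $ i))"

definition lin_act1 :: "'a::comm_ring_1 ^ 'n ^ 'n \<Rightarrow> ('a, 'n::finite) oneform \<Rightarrow> ('a, 'n) oneform" where
  "lin_act1 S h = (\<lambda>j. \<Sum>i\<in>UNIV. lin_act S (h i) * mconst (S $ i $ j))"

interpretation lin_act: comm_ring_hom "lin_act S"
  unfolding lin_act_def by (rule msubst.comm_ring_hom_axioms)

lemma lin_act_mconst [simp]: "lin_act S (mconst a) = mconst a"
  by (simp add: lin_act_def)

lemma mpderiv_linform: "mpderiv j (linform v) = mconst (v $ j)"
proof -
  have "mpderiv j (linform v) = (\<Sum>i\<in>UNIV. if j = i then mconst (v $ i) else 0)"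
    unfolding linform_def by (simp add: mpderiv_mvar if_distrib cong: if_cong)
  then show ?thesis
    by simp
qed

text \<open>By the chain rule. It yields that invariants have invariant differentials.\<close>

lemma dform_lin_act: "dform (lin_act S p) = lin_act1 S (dform p)"
  by (simp add: fun_eq_iff dform_def lin_act1_def lin_act_def mpderiv_msubst mpderiv_linform)

lemma lin_act1_smult: "lin_act1 S (\<lambda>i. p * h i) = (\<lambda>i. lin_act S p * lin_act1 S h i)"
  by (simp add: fun_eq_iff lin_act1_def sum_distrib_left mult.assoc)

lemma lin_act1_sum: "lin_act1 S (\<lambda>i. \<Sum>j\<in>A. h j i) = (\<lambda>i. \<Sum>j\<in>A. lin_act1 S (h j) i)"
proof
  fix i
  show "lin_act1 S (\<lambda>i. \<Sum>j\<in>A. h j i) i = (\<Sum>j\<in>A. lin_act1 S (h j) i)"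
    unfolding lin_act1_def lin_act.hom_sum sum_distrib_right by (rule sum.swap)
qed

definition shear_mat :: "'n \<Rightarrow> ('n \<Rightarrow> 'a) \<Rightarrow> 'a \<Rightarrow> 'a::comm_ring_1 ^ 'n ^ 'n::finite" where
  "shear_mat k w x = (\<chi> i j. if i = k then (if j = k then x else 0)
     else (if j = i then 1 else 0) + (if j = k then w i else 0))"

lemma shear_mat_nth: "shear_mat k w x $ i $ j = (if i = k then (if j = k then x else 0)
    else (if j = i then 1 else 0) + (if j = k then w i else 0))"
  by (simp add: shear_mat_def)

lemma sum_split_index:
  fixes g :: "'n::finite \<Rightarrow> 'b::comm_monoid_add"
  shows "(\<Sum>i\<in>UNIV. g i) = g k + (\<Sum>i\<in>-{k}. g i)"
  using sum.remove[of UNIV k g] by (simp add: Compl_eq_Diff_UNIV)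

lemma linform_shear_mat:
  "linform (shear_mat k w x $ i) = (if i = k then mconst x * mvar k else mvar i + mconst (w i) * mvar k)"
proof (cases "i = k")
  case True
  have "linform (shear_mat k w x $ k) = (\<Sum>j\<in>UNIV. if j = k then mconst x * mvar j else 0)"
    unfolding linform_def by (intro sum.cong) (auto simp: shear_mat_nth)
  then show ?thesis
    using True by simp
next
  case False
  have "linform (shear_mat k w x $ i) =
    (\<Sum>j\<in>UNIV. (if j = i then mvar j else 0) + (if j = k then mconst (w i) * mvar j else 0))"
    unfolding linform_def using False by (intro sum.cong) (auto simp: shear_mat_nth)
  then show ?thesis
    using False by (simp add: sum.distrib)
qed

lemma lin_act_shear_mat: "lin_act (shear_mat k w x) = shear k w x"
  by (simp add: lin_act_def shear_def linform_shear_mat)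

lemma lin_act1_shear_mat:
  "lin_act1 (shear_mat k w x) h j =
    (if j = k then mconst x * shear k w x (h k) + (\<Sum>i\<in>-{k}. mconst (w i) * shear k w x (h i))
     else shear k w x (h j))"
proof (cases "j = k")
  case True
  then show ?thesis
    by (simp add: lin_act1_def lin_act_shear_mat sum_split_index[of _ k] shear_mat_nth mult.commute)
next
  case False
  have "lin_act1 (shear_mat k w x) h j = (\<Sum>i\<in>UNIV. if i = j then shear k w x (h i) else 0)"
    unfolding lin_act1_def lin_act_shear_mat using False by (intro sum.cong) (auto simp: shear_mat_nth)
  then show ?thesis
    using False by simp
qed

lemma shear_shear_scale: "shear k w x (shear k (\<lambda>_. 0) y p) = shear k w (x * y) p"
  unfolding shear_def msubst_msubst
  by (rule arg_cong[where f = "\<lambda>P. msubst P p"]) (auto simp: fun_eq_iff mult_ac)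

section \<open>Semi-invariants of a scaling\<close>

lemma msubst_single_fixed:
  assumes "\<And>i. i \<in> Poly_Mapping.keys \<nu> \<Longrightarrow> P i = mvar i"
  shows "msubst P (Poly_Mapping.single \<nu> a) = Poly_Mapping.single \<nu> a"
  using assms by (simp add: single_eq_mconst_mvar)

lemma single_split_var:
  fixes a :: "'a::comm_ring_1"
  obtains \<nu> where "k \<notin> Poly_Mapping.keys \<nu>"
    "Poly_Mapping.single \<mu> a = Poly_Mapping.single \<nu> a * mvar k ^ Poly_Mapping.lookup \<mu> k"
proof
  let ?\<nu> = "\<mu> - Poly_Mapping.single k (Poly_Mapping.lookup \<mu> k)"
  show "k \<notin> Poly_Mapping.keys ?\<nu>"
    by (simp add: in_keys_iff lookup_minus)
  have "\<mu> = ?\<nu> + Poly_Mapping.single k (Poly_Mapping.lookup \<mu> k)"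
    by (rule poly_mapping_eqI) (simp add: lookup_add lookup_minus lookup_single when_def)
  then show "Poly_Mapping.single \<mu> a = Poly_Mapping.single ?\<nu> a * mvar k ^ Poly_Mapping.lookup \<mu> k"
    by (simp add: mvar_power mult_single)
qed

lemma shear_scale_single:
  "shear k (\<lambda>_. 0) x (Poly_Mapping.single \<mu> a) =
    mconst (x ^ Poly_Mapping.lookup \<mu> k) * Poly_Mapping.single \<mu> a"
proof -
  obtain \<nu> where \<nu>: "k \<notin> Poly_Mapping.keys \<nu>"
    "Poly_Mapping.single \<mu> a = Poly_Mapping.single \<nu> a * mvar k ^ Poly_Mapping.lookup \<mu> k"
    by (rule single_split_var)
  have "shear k (\<lambda>_. 0) x (Poly_Mapping.single \<nu> a) = Poly_Mapping.single \<nu> a"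
    unfolding shear_def by (rule msubst_single_fixed) (use \<nu> in auto)
  then show ?thesis
    by (simp add: \<nu>(2) power_mult_distrib mult_ac)
qed

text \<open>Scaling one variable is diagonal in the basis of monomials, so semi-invariance can be
  tested coefficient by coefficient.\<close>

lemma lookup_shear_scale:
  "Poly_Mapping.lookup (shear k (\<lambda>_. 0) x p) \<mu> = x ^ Poly_Mapping.lookup \<mu> k * Poly_Mapping.lookup p \<mu>"
proof (induction p rule: mpoly_single_induct)
  case (single \<nu> a)
  then show ?case
    by (cases "\<mu> = \<nu>") (auto simp: shear_scale_single lookup_single simp del: mconst.hom_power)
qed (simp_all add: lookup_add distrib_left)

text \<open>A monomial with exponent \<open>n\<close> in variable \<open>k\<close> occurs only if
  \<open>z ^ n = z ^ b\<close>, that is, if \<open>n\<close> and \<open>b\<close> agree modulo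
  \<open>e\<close>. Since \<open>b < e\<close>, this forces \<open>n = b + e * s\<close> for some
  natural \<open>s\<close>.\<close>

lemma scale_semi_invariant:
  fixes q :: "('a::field, 'n) mpoly"
  assumes e: "\<And>n. z ^ n = 1 \<longleftrightarrow> e dvd n" and "b < e"
    and q: "shear k (\<lambda>_. 0) z q = mconst (z ^ b) * q"
  shows "\<exists>r. q = mvar k ^ b * msubst (mvar(k := mvar k ^ e)) r"
proof -
  have "z \<noteq> 0"
    using e[of e] \<open>b < e\<close> by (metis dvd_refl gr_implies_not0 power_0_left zero_neq_one)
  have monomial: "\<exists>r. Poly_Mapping.single \<mu> (Poly_Mapping.lookup q \<mu>) = mvar k ^ b * msubst (mvar(k := mvar k ^ e)) r"
    if \<mu>: "\<mu> \<in> Poly_Mapping.keys q" for \<mu>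
  proof -
    let ?n = "Poly_Mapping.lookup \<mu> k"
    have "z ^ ?n * Poly_Mapping.lookup q \<mu> = z ^ b * Poly_Mapping.lookup q \<mu>"
      using arg_cong[OF q, of "\<lambda>p. Poly_Mapping.lookup p \<mu>"] by (simp add: lookup_shear_scale del: mconst.hom_power)
    then have zn: "z ^ ?n = z ^ b"
      using \<mu> by (simp add: in_keys_iff)
    have "b \<le> ?n"
    proof (rule ccontr)
      assume "\<not> b \<le> ?n"
      then have "z ^ ?n * z ^ (b - ?n) = z ^ b"
        by (simp flip: power_add)
      then have "z ^ (b - ?n) = 1"
        using zn \<open>z \<noteq> 0\<close> by simp
      then have "e dvd b - ?n"
        by (simp add: e)
      then show False
        using \<open>\<not> b \<le> ?n\<close> \<open>b < e\<close> by (auto dest: dvd_imp_le)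
    qed
    then have "z ^ b * z ^ (?n - b) = z ^ ?n"
      by (simp flip: power_add)
    then have "z ^ (?n - b) = 1"
      using zn \<open>z \<noteq> 0\<close> by simp
    then obtain s where "?n - b = e * s"
      by (auto simp: e)
    with \<open>b \<le> ?n\<close> have n: "?n = b + e * s"
      by simp
    obtain \<nu> where \<nu>: "k \<notin> Poly_Mapping.keys \<nu>" "Poly_Mapping.single \<mu> (Poly_Mapping.lookup q \<mu>) =
        Poly_Mapping.single \<nu> (Poly_Mapping.lookup q \<mu>) * mvar k ^ ?n"
      by (rule single_split_var)
    have "msubst (mvar(k := mvar k ^ e)) (Poly_Mapping.single \<nu> (Poly_Mapping.lookup q \<mu>)) =
        Poly_Mapping.single \<nu> (Poly_Mapping.lookup q \<mu>)"
      by (rule msubst_single_fixed) (use \<nu> in auto)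
    then have "Poly_Mapping.single \<mu> (Poly_Mapping.lookup q \<mu>) = mvar k ^ b *
        msubst (mvar(k := mvar k ^ e)) (Poly_Mapping.single \<nu> (Poly_Mapping.lookup q \<mu>) * mvar k ^ s)"
      unfolding \<nu>(2) n by (simp add: power_add power_mult mult_ac)
    then show ?thesis
      by blast
  qed
  then obtain r where r: "\<And>\<mu>. \<mu> \<in> Poly_Mapping.keys q \<Longrightarrow>
      Poly_Mapping.single \<mu> (Poly_Mapping.lookup q \<mu>) = mvar k ^ b * msubst (mvar(k := mvar k ^ e)) (r \<mu>)"
    by metis
  have "q = (\<Sum>\<mu>\<in>Poly_Mapping.keys q. mvar k ^ b * msubst (mvar(k := mvar k ^ e)) (r \<mu>))"
    by (subst poly_mapping_sum_singles) (rule sum.cong[OF refl r])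
  also have "\<dots> = mvar k ^ b * msubst (mvar(k := mvar k ^ e)) (\<Sum>\<mu>\<in>Poly_Mapping.keys q. r \<mu>)"
    by (simp add: sum_distrib_left)
  finally show ?thesis
    by blast
qed

text \<open>This gives divisibility by \<open>mvar k\<close> for polynomials that vanish at
  \<open>mvar k = 0\<close>; stated for differences, it passes through sums and products by
  induction.\<close>

lemma diff_msubst_zero: "\<exists>q. p - msubst (mvar(k := 0)) p = mvar k * q"
proof (induction p rule: mpoly_induct)
  case (const a)
  show ?case by (rule exI[of _ 0]) simp
next
  case (var i)
  show ?case
    by (rule exI[of _ "if i = k then 1 else 0"]) simp
next
  case (add p q)
  then obtain p' q' where "p - msubst (mvar(k := 0)) p = mvar k * p'" "q - msubst (mvar(k := 0)) q = mvar k * q'"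
    by blast
  then have "p + q - msubst (mvar(k := 0)) (p + q) = mvar k * (p' + q')"
    unfolding distrib_left msubst.hom_add by (simp only: add_diff_add)
  then show ?case
    by blast
next
  case (mult p q)
  then obtain p' q' where pq: "p - msubst (mvar(k := 0)) p = mvar k * p'" "q - msubst (mvar(k := 0)) q = mvar k * q'"
    by blast
  have "p * q - msubst (mvar(k := 0)) (p * q) =
      (p - msubst (mvar(k := 0)) p) * q + msubst (mvar(k := 0)) p * (q - msubst (mvar(k := 0)) q)"
    by (simp add: algebra_simps)
  also have "\<dots> = mvar k * (p' * q + msubst (mvar(k := 0)) p * q')"
    unfolding pq by (simp add: algebra_simps)
  finally show ?case
    by blast
qed

section \<open>Invariant forms of a group of shears and scalings\<close>

locale final_stage = shear_stage k W f c m \<alpha>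
  for k :: "'n::finite" and W :: "('n \<Rightarrow> 'a::{field,finite}) set" and f c m \<alpha> +
  fixes z :: 'a and e :: nat
  assumes c_zero: "w \<in> W \<Longrightarrow> j \<noteq> k \<Longrightarrow> c j w = 0"
    and z_K: "z \<in> K" and e_pos: "e > 0" and z_order: "z ^ n = 1 \<longleftrightarrow> e dvd n"
begin

lemma z_nonzero: "z \<noteq> 0"
  using z_order[of e] e_pos by (auto simp: power_0_left)

lemma z_power_K: "z ^ n \<in> K"
  by (induction n) (auto simp: K_one K_mult z_K)

definition F :: "'n \<Rightarrow> ('a, 'n) mpoly" where
  "F = f(k := mvar k ^ e)"

text \<open>For \<open>m j \<noteq> 0\<close> this solves
  \<open>Q ^ m j - 2 = e * a j + (e - 1)\<close>. For \<open>m j = 0\<close> truncated subtraction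
  gives 0: there \<open>dform (F j)\<close> is not divided.\<close>

definition a :: "'n \<Rightarrow> nat" where
  "a j = (Q ^ m j - 1) div e - 1"

text \<open>For \<open>m j \<noteq> 0\<close> this is
  \<open>l^(e - 1) (l \<lambda>(dz) - \<lambda>(z) dl)\<close>, the quotient of
  \<open>dform (F j)\<close> in closed form, so that no division of polynomials is needed.\<close>

definition \<omega> :: "'n \<Rightarrow> ('a, 'n) oneform" where
  "\<omega> j = (if j = k \<or> m j = 0 then dform (F j)
     else (\<lambda>i. if i = k then - (mvar k ^ (e - 1) * lin \<alpha> j) else mvar k ^ e * mconst (\<alpha> j i)))"

definition invar :: "('a, 'n) mpoly \<Rightarrow> bool" where
  "invar p \<longleftrightarrow> (\<forall>w\<in>W. \<forall>n. shear k w (z ^ n) p = p)"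

definition invar1 :: "('a, 'n) oneform \<Rightarrow> bool" where
  "invar1 h \<longleftrightarrow> (\<forall>w\<in>W. \<forall>n. lin_act1 (shear_mat k w (z ^ n)) h = h)"

lemma invarI:
  assumes "\<And>w. w \<in> W \<Longrightarrow> shear k w 1 p = p" "shear k (\<lambda>_. 0) z p = p"
  shows "invar p"
proof -
  have "shear k w (z ^ n) p = p" if "w \<in> W" for w n
  proof (induction n)
    case (Suc n)
    have "shear k w (z ^ Suc n) p = shear k w (z ^ n) (shear k (\<lambda>_. 0) z p)"
      unfolding shear_shear_scale by (simp add: mult.commute)
    then show ?case
      using Suc assms(2) by simp
  qed (use assms that in simp)
  then show ?thesis
    by (simp add: invar_def)
qed

lemma invar_shear_1: "invar p \<Longrightarrow> w \<in> W \<Longrightarrow> shear k w 1 p = p"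
  unfolding invar_def by (metis power_0)

lemma invar_scale: "invar p \<Longrightarrow> shear k (\<lambda>_. 0) z p = p"
  unfolding invar_def using W_zero by (metis power_one_right)

text \<open>Because \<open>z\<close> lies in \<open>K\<close>, it satisfies
  \<open>z ^ (Q ^ n) = z\<close>.\<close>

lemma e_dvd: "e dvd Q ^ n - 1"
proof -
  have "z * z ^ (Q ^ n - 1) = z ^ (Q ^ n)"
    by (simp flip: power_Suc)
  also have "\<dots> = z * 1"
    by (simp add: K_power_Q_power z_K)
  finally show ?thesis
    using z_nonzero unfolding z_order[symmetric] by simp
qed

text \<open>\<open>e\<close> divides \<open>Q - 1\<close>, which is -1 in the field. Hence the
  factor \<open>e\<close> in the differential of \<open>mvar k ^ e\<close> can be inverted.\<close>

lemma of_nat_e: "of_nat e \<noteq> (0 :: 'a)"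
proof
  assume "of_nat e = (0 :: 'a)"
  moreover obtain s where "Q - 1 = e * s"
    using e_dvd[of 1] by auto
  ultimately have "of_nat (Q - 1) = (0 :: 'a)"
    by simp
  then show False
    using Q_ge_2 of_nat_Q by (simp add: of_nat_diff)
qed

lemma e_a:
  assumes "m j \<noteq> 0"
  shows "e * a j + e = Q ^ m j - 1" "e * a j + (e - 1) = Q ^ m j - 2"
proof -
  obtain d where d: "m j = Suc d"
    using assms by (cases "m j") auto
  have "2 * 1 \<le> Q * Q ^ d"
    by (rule mult_le_mono[OF Q_ge_2]) (simp add: Suc_leI)
  then have ge: "Q ^ m j \<ge> 2"
    by (simp add: d)
  obtain s where s: "Q ^ m j - 1 = e * s"
    using e_dvd by (auto elim: dvdE)
  then have "s > 0"
    using ge by (cases s) auto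
  then have "e * a j + e = e * s"
    unfolding a_def s using e_pos by (cases s) auto
  then show "e * a j + e = Q ^ m j - 1"
    by (simp only: s)
  then show "e * a j + (e - 1) = Q ^ m j - 2"
    using e_pos by simp
qed

lemma dform_F: "dform (F j) i = (mvar k ^ e) ^ a j * \<omega> j i" if "j \<noteq> k"
proof (cases "m j = 0")
  case True
  then show ?thesis
    by (simp add: \<omega>_def a_def)
next
  case False
  note e_a = e_a[OF False, symmetric]
  have d: "dform (F j) i = mpderiv i (f j)"
    using that by (simp add: dform_def F_def)
  show ?thesis
    unfolding d using that False e_a
    by (cases "i = k") (simp_all add: \<omega>_def deriv deriv_k power_add power_mult mult_ac)
qed

section \<open>Basic invariants of the shears together with the scaling\<close>

lemma msubst_F: "msubst F p = msubst f (msubst (mvar(k := mvar k ^ e)) p)"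
  unfolding msubst_msubst
  by (rule arg_cong[where f = "\<lambda>P. msubst P p"]) (auto simp: F_def fk fun_eq_iff)

lemma msubst_F_eq_0: "p = 0" if "msubst F p = 0"
proof -
  have "msubst (mvar(k := mvar k ^ e)) p = 0"
    using that unfolding msubst_F by (rule inj)
  moreover have "as_upoly k (mvar k ^ e :: ('a, 'n) mpoly) = Polynomial.monom 1 e"
    by (simp add: as_upoly_mvar monom_altdef)
  then have "Polynomial.degree (as_upoly k (mvar k ^ e :: ('a, 'n) mpoly)) > 0"
    using e_pos by (simp add: degree_monom_eq)
  ultimately show ?thesis
    by (rule msubst_upd_eq_0[rotated])
qed

lemma invar_F: "invar (F j)"
proof (cases "j = k")
  case True
  have "z ^ (n * e) = 1" for n
    by (simp add: z_order)
  then show ?thesis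
    using True by (simp add: invar_def F_def power_mult_distrib flip: power_mult mconst.hom_power)
next
  case False
  then show ?thesis
    using act[OF False _ z_power_K] z_nonzero c_zero[OF _ False] by (simp add: invar_def F_def)
qed

text \<open>Shear invariance makes \<open>p\<close> a polynomial \<open>q\<close> in the
  \<open>f j\<close>. The scaling fixes all of them except \<open>f k\<close>, so by injectivity of
  \<open>msubst f\<close> it acts on \<open>q\<close> as the scaling of variable \<open>k\<close>,
  and \<open>q\<close> involves that variable only through its \<open>e\<close>-th power.\<close>

lemma invar_iff: "invar p \<longleftrightarrow> p \<in> range (msubst F)"
proof
  assume p: "invar p"
  obtain q where q: "p = msubst f q"
    using gen[OF invar_shear_1[OF p]] by blast
  have f: "shear k (\<lambda>_. 0) z (f j) = (if j = k then mconst z * mvar k else f j)" for j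
    using act[OF _ W_zero z_K z_nonzero] c_zero[OF W_zero] by (simp add: fk)
  have "msubst f (shear k (\<lambda>_. 0) z q) = msubst (\<lambda>j. if j = k then mconst z * mvar k else f j) q"
    unfolding shear_def msubst_msubst
    by (rule arg_cong[where f = "\<lambda>P. msubst P q"]) (auto simp: fk fun_eq_iff)
  also have "\<dots> = msubst (\<lambda>j. shear k (\<lambda>_. 0) z (f j)) q"
    unfolding f ..
  also have "\<dots> = msubst f q"
    using invar_scale[OF p] unfolding q shear_msubst .
  finally have "msubst f (shear k (\<lambda>_. 0) z q - q) = 0"
    by simp
  then have "shear k (\<lambda>_. 0) z q - q = 0"
    by (rule inj)
  then have "shear k (\<lambda>_. 0) z q = mconst (z ^ 0) * q"
    by simp
  from scale_semi_invariant[OF z_order e_pos this]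
  obtain r where "q = mvar k ^ 0 * msubst (mvar(k := mvar k ^ e)) r"
    by blast
  then have "p = msubst F r"
    unfolding q msubst_F by simp
  then show "p \<in> range (msubst F)"
    by blast
next
  assume "p \<in> range (msubst F)"
  then obtain q where q: "p = msubst F q"
    by blast
  show "invar p"
    using invar_F unfolding q invar_def shear_msubst by simp
qed

text \<open>Scaling multiplies \<open>p\<close> by the inverse of \<open>z\<close>, which is
  \<open>z ^ (e - 1)\<close>; this is the weight that the coefficient of \<open>dl\<close> needs to
  balance that of \<open>dl\<close>. Cancelling \<open>mvar k ^ (e - 1)\<close> leaves an
  invariant.\<close>

lemma semi_invariant:
  assumes p: "\<And>w. w \<in> W \<Longrightarrow> shear k w 1 p = p" "mconst z * shear k (\<lambda>_. 0) z p = p"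
  shows "\<exists>r. invar r \<and> p = mvar k ^ (e - 1) * r"
proof -
  have "z * z ^ (e - 1) = 1"
    using e_pos z_order[of e] by (simp flip: power_Suc)
  then have z: "mconst (z ^ (e - 1)) * mconst z = (1 :: ('a, 'n) mpoly)"
    unfolding mconst.hom_mult[symmetric] mult.commute[of _ z] by simp
  have "shear k (\<lambda>_. 0) z p = (mconst (z ^ (e - 1)) * mconst z) * shear k (\<lambda>_. 0) z p"
    unfolding z by simp
  also have "\<dots> = mconst (z ^ (e - 1)) * p"
    unfolding mult.assoc p(2) ..
  finally have scale: "shear k (\<lambda>_. 0) z p = mconst (z ^ (e - 1)) * p" .
  have "e - 1 < e"
    using e_pos by simp
  from scale_semi_invariant[OF z_order this scale] obtain r where r: "p = mvar k ^ (e - 1) * r"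
    by blast
  have "shear k w 1 r = r" if "w \<in> W" for w
  proof -
    have "mvar k ^ (e - 1) * shear k w 1 r = mvar k ^ (e - 1) * r"
      using p(1)[OF that] unfolding r by simp
    then show ?thesis
      unfolding mpoly_mult_left_cancel[OF mvar_power_neq_0] .
  qed
  moreover have "shear k (\<lambda>_. 0) z r = r"
  proof -
    have "mconst z * mconst (z ^ (e - 1)) * mvar k ^ (e - 1) * shear k (\<lambda>_. 0) z r = mvar k ^ (e - 1) * r"
      using p(2) unfolding r by (simp add: power_mult_distrib mult_ac)
    then have "mvar k ^ (e - 1) * shear k (\<lambda>_. 0) z r = mvar k ^ (e - 1) * r"
      unfolding mult.commute[of "mconst z"] z by simp
    then show ?thesis
      unfolding mpoly_mult_left_cancel[OF mvar_power_neq_0] .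
  qed
  ultimately have "invar r"
    by (rule invarI)
  with r show ?thesis
    by blast
qed

section \<open>Invariant forms\<close>

lemma invar1_dform: "invar1 (dform p)" if "invar p"
  using that by (simp add: invar1_def invar_def lin_act_shear_mat flip: dform_lin_act)

text \<open>Multiplied by the invariant \<open>(mvar k ^ e) ^ a j\<close>, the form
  \<open>\<omega> j\<close> is the differential of an invariant, and the factor cancels in a
  domain.\<close>

lemma invar1_\<omega>: "invar1 (\<omega> j)"
proof (cases "j = k")
  case True
  then show ?thesis
    using invar1_dform[OF invar_F] by (simp add: \<omega>_def)
next
  case False
  have "lin_act1 (shear_mat k w (z ^ n)) (\<omega> j) i = \<omega> j i" if "w \<in> W" for w n i
  proof -
    have "(mvar k ^ e) ^ a j * lin_act1 (shear_mat k w (z ^ n)) (\<omega> j) i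
        = lin_act1 (shear_mat k w (z ^ n)) (\<lambda>i. (mvar k ^ e) ^ a j * \<omega> j i) i"
    proof -
      have "shear k w (z ^ n) (F k) = F k"
        using invar_F[of k] that unfolding invar_def by blast
      then have "shear k w (z ^ n) (mvar k ^ e) = mvar k ^ e"
        unfolding F_def fun_upd_same .
      then show ?thesis
        unfolding lin_act1_smult lin_act_shear_mat shear.hom_power[of _ _ _ _ "a j"] by simp
    qed
    also have "\<dots> = lin_act1 (shear_mat k w (z ^ n)) (dform (F j)) i"
      by (simp flip: dform_F[OF False])
    also have "\<dots> = dform (F j) i"
      using invar1_dform[OF invar_F[of j]] that by (simp add: invar1_def)
    also have "\<dots> = (mvar k ^ e) ^ a j * \<omega> j i"
      by (rule dform_F[OF False])
    finally show ?thesis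
      by (simp only: mpoly_mult_left_cancel[OF mvar_power_neq_0] flip: power_mult)
  qed
  then show ?thesis
    by (simp add: invar1_def fun_eq_iff)
qed

lemma \<alpha>_inverse:
  "\<exists>A. (\<forall>j j'. j \<noteq> k \<longrightarrow> j' \<noteq> k \<longrightarrow> (\<Sum>i\<in>-{k}. A j' i * \<alpha> i j) = (if j' = j then 1 else 0)) \<and>
    (\<forall>i i'. i \<noteq> k \<longrightarrow> i' \<noteq> k \<longrightarrow> (\<Sum>j\<in>-{k}. \<alpha> i j * A j i') = (if i = i' then 1 else 0))"
proof -
  \<comment> \<open>Row and column \<open>k\<close> are filled as in the identity, which turns
    \<open>\<alpha>\<close> into a block of a square matrix that is injective by
    \<open>ker\<close>.\<close>
  define B :: "'a ^ 'n ^ 'n" where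
    "B = (\<chi> i j. if i = k \<or> j = k then (if i = j then 1 else 0) else \<alpha> i j)"
  have B: "B $ i $ j = (if i = k \<or> j = k then (if i = j then 1 else 0) else \<alpha> i j)" for i j
    by (simp add: B_def)
  have "v = 0" if v: "B *v v = 0" for v
  proof -
    have Bv: "(\<Sum>j\<in>UNIV. B $ i $ j * v $ j) = 0" for i
      using arg_cong[OF v, of "\<lambda>u. u $ i"] by (simp add: matrix_vector_mult_def)
    have "v $ k = 0"
      using Bv[of k] unfolding sum_split_index[of _ k] by (simp add: B)
    moreover have "v $ i = 0" if "i \<noteq> k" for i
    proof (rule ker[OF _ that])
      fix j assume j: "j \<noteq> k"
      have "(\<Sum>i\<in>-{k}. B $ j $ i * v $ i) = 0"
        using Bv[of j] j unfolding sum_split_index[of _ k] by (simp add: B)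
      also have "(\<Sum>i\<in>-{k}. B $ j $ i * v $ i) = (\<Sum>i\<in>-{k}. \<alpha> j i * v $ i)"
        by (intro sum.cong) (use j in \<open>auto simp: B\<close>)
      finally show "(\<Sum>i\<in>-{k}. \<alpha> j i * v $ i) = 0" .
    qed
    ultimately show ?thesis
      by (metis vec_eq_iff zero_index)
  qed
  then have "\<exists>A. A ** B = mat 1"
    unfolding matrix_left_invertible_ker by simp
  then obtain A :: "'a ^ 'n ^ 'n" where AB: "A ** B = mat 1"
    by blast
  have BA: "B ** A = mat 1"
    by (rule matrix_left_right_inverse1[OF AB])
  show ?thesis
  proof (intro exI[of _ "\<lambda>i j. A $ i $ j"] conjI allI impI)
    fix j j' assume jj: "j \<noteq> k" "j' \<noteq> k"
    have "(\<Sum>i\<in>-{k}. A $ j' $ i * \<alpha> i j) = (\<Sum>i\<in>-{k}. A $ j' $ i * B $ i $ j)"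
      by (intro sum.cong) (use jj in \<open>auto simp: B\<close>)
    also have "\<dots> = (A ** B) $ j' $ j"
      using jj by (simp add: matrix_matrix_mult_def sum_split_index[of _ k] B)
    finally show "(\<Sum>i\<in>-{k}. A $ j' $ i * \<alpha> i j) = (if j' = j then 1 else 0)"
      unfolding AB by (simp add: mat_def)
  next
    fix i i' assume ii: "i \<noteq> k" "i' \<noteq> k"
    have "(\<Sum>j\<in>-{k}. \<alpha> i j * A $ j $ i') = (\<Sum>j\<in>-{k}. B $ i $ j * A $ j $ i')"
      by (intro sum.cong) (use ii in \<open>auto simp: B\<close>)
    also have "\<dots> = (B ** A) $ i $ i'"
      using ii by (simp add: matrix_matrix_mult_def sum_split_index[of _ k] B)
    finally show "(\<Sum>j\<in>-{k}. \<alpha> i j * A $ j $ i') = (if i = i' then 1 else 0)"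
      unfolding BA by (simp add: mat_def)
  qed
qed

lemma \<alpha>_left_kernel:
  assumes b: "\<And>j. j \<noteq> k \<Longrightarrow> (\<Sum>i\<in>-{k}. b i * \<alpha> i j) = 0" and "i \<noteq> k"
  shows "b i = 0"
proof -
  obtain A where A: "\<And>i i'. i \<noteq> k \<Longrightarrow> i' \<noteq> k \<Longrightarrow> (\<Sum>j\<in>-{k}. \<alpha> i j * A j i') = (if i = i' then 1 else 0)"
    using \<alpha>_inverse by blast
  have "0 = (\<Sum>j\<in>-{k}. (\<Sum>i'\<in>-{k}. b i' * \<alpha> i' j) * A j i)"
    using b by simp
  also have "\<dots> = (\<Sum>i'\<in>-{k}. b i' * (\<Sum>j\<in>-{k}. \<alpha> i' j * A j i))"
    unfolding sum_distrib_left sum_distrib_right mult.assoc by (rule sum.swap)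
  also have "\<dots> = (\<Sum>i'\<in>-{k}. if i' = i then b i' else 0)"
    by (intro sum.cong) (use A[OF _ \<open>i \<noteq> k\<close>] in auto)
  also have "\<dots> = b i"
    using \<open>i \<noteq> k\<close> by simp
  finally show ?thesis by simp
qed

text \<open>The linear part of \<open>f i\<close> as a functional on \<open>W\<close>; it measures
  how a shear moves \<open>lin \<alpha> i\<close> (\<open>shear_lin\<close>).\<close>

definition lin_coeff :: "'n \<Rightarrow> ('n \<Rightarrow> 'a) \<Rightarrow> 'a" where
  "lin_coeff i w = (\<Sum>j\<in>-{k}. \<alpha> i j * w j)"

lemma shear_lin: "shear k w x (lin \<alpha> i) = lin \<alpha> i + mconst (lin_coeff i w) * mvar k"
proof -
  have "shear k w x (lin \<alpha> i) = (\<Sum>j\<in>-{k}. mconst (\<alpha> i j) * mvar j + mconst (\<alpha> i j * w j) * mvar k)"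
    unfolding lin_def shear.hom_sum by (intro sum.cong) (auto simp: shear_mvar algebra_simps)
  then show ?thesis
    by (simp add: lin_def lin_coeff_def sum.distrib sum_distrib_right)
qed

text \<open>In this case \<open>lin \<alpha> i\<close> is \<open>f i\<close> itself, which the
  shears fix.\<close>

lemma lin_coeff_0: "lin_coeff i w = 0" if "i \<noteq> k" "m i = 0" "w \<in> W"
proof -
  have "shear k w 1 (lin \<alpha> i) = lin \<alpha> i"
    using act[OF that(1,3) K_one] c_zero[OF that(3,1)] f_lin[OF that(1,2)] by simp
  then have "mvar k * mconst (lin_coeff i w) = (mvar k * 0 :: ('a, 'n) mpoly)"
    unfolding shear_lin by (simp add: mult.commute)
  then have "mconst (lin_coeff i w) = (0 :: ('a, 'n) mpoly)"
    unfolding mpoly_mult_left_cancel[OF mvar_neq_0] .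
  then show ?thesis
    unfolding mconst_eq_0_iff .
qed

lemma mpderiv_lin: "mpderiv j (lin \<alpha> i) = mconst (\<alpha> i j)" if "j \<noteq> k"
proof -
  have "mpderiv j (lin \<alpha> i) = (\<Sum>l\<in>-{k}. if l = j then mconst (\<alpha> i l) else 0)"
    unfolding lin_def mpderiv_sum by (intro sum.cong) (auto simp: mpderiv_mvar)
  then show ?thesis
    using that by simp
qed

text \<open>An invariant linear form is a polynomial in the \<open>f j\<close>; comparing differentials at the origin
  shows that it involves only the linear ones among them.\<close>

lemma lin_coeff_independent:
  assumes b: "\<And>w. w \<in> W \<Longrightarrow> (\<Sum>i\<in>-{k}. b i * lin_coeff i w) = 0" and "i \<noteq> k" "m i \<noteq> 0"
  shows "b i = 0"
proof -
  define u where "u = (\<Sum>i\<in>-{k}. mconst (b i) * lin \<alpha> i)"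
  have "shear k w 1 u = u" if "w \<in> W" for w
  proof -
    have "shear k w 1 u = u + (\<Sum>i\<in>-{k}. mconst (b i) * (mconst (lin_coeff i w) * mvar k))"
      by (simp add: u_def shear_lin distrib_left sum.distrib)
    also have "(\<Sum>i\<in>-{k}. mconst (b i) * (mconst (lin_coeff i w) * mvar k)) =
        mconst (\<Sum>i\<in>-{k}. b i * lin_coeff i w) * mvar k"
      by (simp add: sum_distrib_right mult.assoc)
    finally show ?thesis
      using b[OF that] by simp
  qed
  then obtain q where q: "u = msubst f q"
    using gen by blast
  define \<epsilon> where "\<epsilon> = meval (\<lambda>x::'a. x) (\<lambda>_::'n. 0)"
  have id: "comm_ring_hom (\<lambda>x::'a. x)"
    by (rule comm_ring_hom.intro) auto
  interpret \<epsilon>: comm_ring_hom \<epsilon>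
    unfolding \<epsilon>_def by (rule comm_ring_hom.comm_ring_hom_meval[OF id])
  have \<epsilon>_simps: "\<epsilon> (mconst r) = r" "\<epsilon> (mvar j) = 0" for r j
    by (simp_all add: \<epsilon>_def comm_ring_hom.meval_mconst[OF id] comm_ring_hom.meval_mvar[OF id])
  \<comment> \<open>For \<open>m l \<noteq> 0\<close> the factor
    \<open>mvar k ^ (Q ^ m l - 1)\<close> makes the derivatives of \<open>f l\<close> in the
    variables other than \<open>mvar k\<close> vanish at the origin, so only the linear
    \<open>f l\<close> contribute.\<close>
  define \<gamma> where "\<gamma> l = (if m l = 0 then \<epsilon> (msubst f (mpderiv l q)) else 0)" for l
  have "(\<Sum>i\<in>-{k}. (b i - \<gamma> i) * \<alpha> i j) = 0" if j: "j \<noteq> k" for j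
  proof -
    have "(\<Sum>i\<in>-{k}. b i * \<alpha> i j) = \<epsilon> (mpderiv j u)"
      using j by (simp add: u_def mpderiv_lin \<epsilon>_simps)
    also have "mpderiv j u = (\<Sum>l\<in>-{k}. msubst f (mpderiv l q) * mpderiv j (f l))"
      using j by (simp add: q mpderiv_msubst sum_split_index[of _ k] fk mpderiv_mvar)
    also have "\<epsilon> \<dots> = (\<Sum>l\<in>-{k}. \<gamma> l * \<alpha> l j)"
      unfolding \<epsilon>.hom_sum
    proof (intro sum.cong refl)
      fix l assume "l \<in> -{k}"
      moreover have "Q ^ m l - 1 \<noteq> 0" if "m l \<noteq> 0"
        using e_a(1)[OF that] e_pos by linarith
      ultimately show "\<epsilon> (msubst f (mpderiv l q) * mpderiv j (f l)) = \<gamma> l * \<alpha> l j"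
        using j by (auto simp: deriv \<epsilon>_simps \<gamma>_def power_0_left)
    qed
    finally show ?thesis
      by (simp add: left_diff_distrib sum_subtractf)
  qed
  then have "b i - \<gamma> i = 0"
    by (rule \<alpha>_left_kernel[OF _ \<open>i \<noteq> k\<close>])
  then show ?thesis
    using \<open>m i \<noteq> 0\<close> by (simp add: \<gamma>_def)
qed

lemma invar1_span:
  assumes "invar1 h"
  shows "\<exists>C. (\<forall>j. invar (C j)) \<and> h = (\<lambda>i. \<Sum>j\<in>UNIV. C j * \<omega> j i)"
proof -
  have h: "lin_act1 (shear_mat k w (z ^ n)) h j = h j" if "w \<in> W" for w n j
    using assms that by (simp add: invar1_def)
  have h_inv: "invar (h j)" if "j \<noteq> k" for j
    unfolding invar_def using h[of _ _ j] that by (simp add: lin_act1_shear_mat)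
  \<comment> \<open>Only the \<open>dl\<close> coefficient mixes with the others: a shear turns
    \<open>dz_i\<close> into \<open>dz_i + w_i dl\<close>.\<close>
  have h_k: "mconst (z ^ n) * shear k w (z ^ n) (h k) + (\<Sum>i\<in>-{k}. mconst (w i) * h i) = h k"
    if "w \<in> W" for w n
  proof -
    have "(\<Sum>i\<in>-{k}. mconst (w i) * shear k w (z ^ n) (h i)) = (\<Sum>i\<in>-{k}. mconst (w i) * h i)"
      by (intro sum.cong) (use h_inv that in \<open>auto simp: invar_def\<close>)
    then show ?thesis
      using h[OF that, of n k] by (simp add: lin_act1_shear_mat)
  qed
  obtain A where A: "\<And>j j'. j \<noteq> k \<Longrightarrow> j' \<noteq> k \<Longrightarrow> (\<Sum>i\<in>-{k}. A j' i * \<alpha> i j) = (if j' = j then 1 else 0)"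
    using \<alpha>_inverse by blast
  \<comment> \<open>Change of basis by the inverse matrix \<open>A\<close>: \<open>h\<close> is the
    sum of the \<open>y i\<close> times the differentials of the \<open>lin \<alpha> i\<close>, plus
    \<open>h k\<close> times \<open>dl\<close>.\<close>
  define y where "y i = (\<Sum>j\<in>-{k}. mconst (A j i) * h j)" for i
  have y_inv: "invar (y i)" for i
    unfolding invar_def y_def shear.hom_sum using h_inv by (auto simp: invar_def intro!: sum.cong)
  have h_y: "h j = (\<Sum>i\<in>-{k}. mconst (\<alpha> i j) * y i)" if j: "j \<noteq> k" for j
  proof -
    have "(\<Sum>i\<in>-{k}. mconst (\<alpha> i j) * y i) =
        (\<Sum>i\<in>-{k}. \<Sum>j'\<in>-{k}. mconst (A j' i * \<alpha> i j) * h j')"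
      unfolding y_def sum_distrib_left by (simp add: mult_ac)
    also have "\<dots> = (\<Sum>j'\<in>-{k}. \<Sum>i\<in>-{k}. mconst (A j' i * \<alpha> i j) * h j')"
      by (rule sum.swap)
    also have "\<dots> = (\<Sum>j'\<in>-{k}. mconst (\<Sum>i\<in>-{k}. A j' i * \<alpha> i j) * h j')"
      unfolding mconst.hom_sum sum_distrib_right ..
    also have "\<dots> = (\<Sum>j'\<in>-{k}. if j' = j then h j' else 0)"
      by (intro sum.cong) (use A[OF j] in auto)
    finally show ?thesis
      using j by simp
  qed
  have w_h: "(\<Sum>j\<in>-{k}. mconst (w j) * h j) = (\<Sum>i\<in>-{k}. mconst (lin_coeff i w) * y i)" for w
  proof -
    have "(\<Sum>j\<in>-{k}. mconst (w j) * h j) = (\<Sum>j\<in>-{k}. \<Sum>i\<in>-{k}. mconst (\<alpha> i j * w j) * y i)"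
      by (intro sum.cong refl) (simp add: h_y sum_distrib_left mult_ac)
    also have "\<dots> = (\<Sum>i\<in>-{k}. \<Sum>j\<in>-{k}. mconst (\<alpha> i j * w j) * y i)"
      by (rule sum.swap)
    finally show ?thesis
      unfolding lin_coeff_def mconst.hom_sum sum_distrib_right .
  qed

  have "\<exists>y'. y i = mvar k * y'" if i: "i \<noteq> k" "m i \<noteq> 0" for i
  proof -
    \<comment> \<open>Modulo \<open>mvar k\<close> shears act as the identity, so \<open>h_k\<close>
      at \<open>n = 0\<close> becomes a relation between the residues of the \<open>y i\<close> with
      constant coefficients. It holds for every monomial separately, where
      \<open>lin_coeff_independent\<close> applies.\<close>
    define \<pi> where "\<pi> = msubst (mvar(k := 0 :: ('a, 'n) mpoly))"
    interpret \<pi>: comm_ring_hom \<pi>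
      unfolding \<pi>_def by (rule msubst.comm_ring_hom_axioms)
    have \<pi>_const: "\<pi> (mconst r) = mconst r" for r
      by (simp add: \<pi>_def)
    have \<pi>_shear: "\<pi> (shear k w x p) = \<pi> p" for w x p
      unfolding \<pi>_def shear_def msubst_msubst
      by (rule arg_cong[where f = "\<lambda>P. msubst P p"]) (auto simp: fun_eq_iff)
    have sum_0: "(\<Sum>i\<in>-{k}. mconst (lin_coeff i w) * \<pi> (y i)) = 0" if "w \<in> W" for w
      using arg_cong[OF h_k[OF that, of 0], of \<pi>] by (simp add: w_h \<pi>_shear \<pi>_const)
    have "Poly_Mapping.lookup (\<pi> (y i)) \<mu> = 0" for \<mu>
    proof (rule lin_coeff_independent[OF _ i])
      fix w assume "w \<in> W"
      show "(\<Sum>i\<in>-{k}. Poly_Mapping.lookup (\<pi> (y i)) \<mu> * lin_coeff i w) = 0"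
        using arg_cong[OF sum_0[OF \<open>w \<in> W\<close>], of "\<lambda>p. Poly_Mapping.lookup p \<mu>"]
        by (simp add: lookup_sum mult.commute[of "Poly_Mapping.lookup _ _"])
    qed
    then have "\<pi> (y i) = 0"
      by (intro poly_mapping_eqI) simp
    then show ?thesis
      using diff_msubst_zero[of "y i" k] by (simp add: \<pi>_def)
  qed
  then obtain y' where y': "\<And>i. i \<noteq> k \<Longrightarrow> m i \<noteq> 0 \<Longrightarrow> y i = mvar k * y' i"
    by metis

  let ?I = "{i. i \<noteq> k \<and> m i \<noteq> 0}"
  have y'_1: "shear k w 1 (y' i) = y' i" if "i \<in> ?I" "w \<in> W" for i w
  proof -
    have "mvar k * shear k w 1 (y' i) = mvar k * y' i"
      using invar_shear_1[OF y_inv[of i] that(2)] y'[of i] that(1) by simp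
    then show ?thesis
      unfolding mpoly_mult_left_cancel[OF mvar_neq_0] .
  qed
  have y'_z: "mconst z * shear k (\<lambda>_. 0) z (y' i) = y' i" if "i \<in> ?I" for i
  proof -
    have "mvar k * (mconst z * shear k (\<lambda>_. 0) z (y' i)) = mvar k * y' i"
      using invar_scale[OF y_inv[of i]] y'[of i] that by (simp add: mult_ac)
    then show ?thesis
      unfolding mpoly_mult_left_cancel[OF mvar_neq_0] .
  qed
  \<comment> \<open>The coefficient of \<open>dl\<close> that is left after subtracting the forms
    \<open>l \<lambda>(dz) - \<lambda>(z) dl\<close> with coefficients \<open>y' i\<close>.\<close>
  define h' where "h' = h k + (\<Sum>i\<in>?I. y' i * lin \<alpha> i)"
  have sum_I: "(\<Sum>i\<in>-{k}. mconst (lin_coeff i w) * y i) = (\<Sum>i\<in>?I. y' i * (mconst (lin_coeff i w) * mvar k))"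
    if "w \<in> W" for w
  proof (rule sum.mono_neutral_cong_right)
    show "\<forall>i\<in>-{k} - ?I. mconst (lin_coeff i w) * y i = 0"
    proof
      fix i assume "i \<in> -{k} - ?I"
      then have "i \<noteq> k" "m i = 0"
        by auto
      then show "mconst (lin_coeff i w) * y i = 0"
        using lin_coeff_0[OF _ _ that] by simp
    qed
    show "mconst (lin_coeff i w) * y i = y' i * (mconst (lin_coeff i w) * mvar k)" if "i \<in> ?I" for i
      using y'[of i] that by (simp add: mult_ac)
  qed auto
  have "shear k w 1 h' = h'" if "w \<in> W" for w
  proof -
    have "shear k w 1 h' = shear k w 1 (h k) + (\<Sum>i\<in>?I. y' i * (lin \<alpha> i + mconst (lin_coeff i w) * mvar k))"
      using y'_1[OF _ that] by (simp add: h'_def shear_lin)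
    also have "\<dots> = shear k w 1 (h k) + (\<Sum>i\<in>?I. y' i * (mconst (lin_coeff i w) * mvar k)) + (\<Sum>i\<in>?I. y' i * lin \<alpha> i)"
      by (simp add: distrib_left sum.distrib add_ac)
    also have "\<dots> = h'"
      using h_k[OF that, of 0] by (simp add: h'_def w_h sum_I[OF that])
    finally show ?thesis .
  qed
  moreover have "mconst z * shear k (\<lambda>_. 0) z h' = h'"
  proof -
    have "mconst z * shear k (\<lambda>_. 0) z h' = mconst z * shear k (\<lambda>_. 0) z (h k)
        + (\<Sum>i\<in>?I. (mconst z * shear k (\<lambda>_. 0) z (y' i)) * lin \<alpha> i)"
      by (simp add: h'_def shear_lin lin_coeff_def distrib_left sum_distrib_left mult.assoc)
    also have "\<dots> = h k + (\<Sum>i\<in>?I. y' i * lin \<alpha> i)"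
      using h_k[OF W_zero, of 1] y'_z by simp
    finally show ?thesis
      by (simp add: h'_def)
  qed
  ultimately obtain r' where r': "invar r'" "h' = mvar k ^ (e - 1) * r'"
    using semi_invariant[of h'] by blast
  have "\<exists>r. invar r \<and> y' i = mvar k ^ (e - 1) * r" if "i \<in> ?I" for i
    by (rule semi_invariant[OF y'_1[OF that] y'_z[OF that]])
  then have "\<forall>i\<in>?I. \<exists>r. invar r \<and> y' i = mvar k ^ (e - 1) * r"
    by blast
  from bchoice[OF this] obtain r where r: "\<And>i. i \<in> ?I \<Longrightarrow> invar (r i)"
    "\<And>i. i \<in> ?I \<Longrightarrow> y' i = mvar k ^ (e - 1) * r i"
    by blast

  \<comment> \<open>The constant at \<open>k\<close> compensates the factor \<open>e\<close> in the
    differential \<open>e l^(e - 1) dl\<close> of \<open>F k\<close>.\<close>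
  define C where "C j = (if j = k then mconst (inverse (of_nat e)) * r' else if m j = 0 then y j else r j)" for j
  have "invar (C j)" for j
    using r'(1) y_inv r(1)[of j] by (auto simp: C_def invar_def)
  moreover have "h i = (\<Sum>j\<in>UNIV. C j * \<omega> j i)" for i
  proof (cases "i = k")
    case True
    have Ck: "C k * \<omega> k k = h'"
    proof -
      have "\<omega> k k = of_nat e * mvar k ^ (e - 1)"
        by (simp add: \<omega>_def dform_def F_def mpderiv_power mpderiv_mvar)
      then have "C k * \<omega> k k = (mconst (inverse (of_nat e)) * of_nat e) * h'"
        by (simp add: C_def r'(2) mult_ac)
      also have "mconst (inverse (of_nat e)) * of_nat e = mconst (inverse (of_nat e) * of_nat e :: 'a)"
        by simp
      finally show ?thesis
        using of_nat_e by simp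
    qed
    have "(\<Sum>j\<in>-{k}. C j * \<omega> j k) = (\<Sum>j\<in>?I. - (y' j * lin \<alpha> j))"
    proof (rule sum.mono_neutral_cong_right)
      show "\<forall>j\<in>-{k} - ?I. C j * \<omega> j k = 0"
        by (auto simp: \<omega>_def dform_def F_def deriv_k)
      show "C j * \<omega> j k = - (y' j * lin \<alpha> j)" if "j \<in> ?I" for j
        using that r(2)[OF that] by (simp add: C_def \<omega>_def mult_ac)
    qed auto
    then show ?thesis
      using True by (simp add: sum_split_index[of _ k] Ck h'_def sum_negf)
  next
    case False
    have "C k * \<omega> k i = 0"
      using False by (simp add: \<omega>_def dform_def F_def mpderiv_power mpderiv_mvar)
    moreover have "C j * \<omega> j i = mconst (\<alpha> j i) * y j" if "j \<noteq> k" for j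
    proof (cases "m j = 0")
      case True
      then show ?thesis
        using that False by (simp add: C_def \<omega>_def dform_def F_def deriv mult.commute)
    next
      case m: False
      have "mvar k ^ e = mvar k * (mvar k ^ (e - 1) :: ('a, 'n) mpoly)"
        using e_pos by (simp flip: power_Suc)
      then show ?thesis
        using that False m y'[OF that m] r(2)[of j] by (simp add: C_def \<omega>_def mult_ac)
    qed
    ultimately show ?thesis
      using False by (simp add: sum_split_index[of _ k] h_y)
  qed
  ultimately show ?thesis
    by (intro exI[of _ C]) (auto simp: fun_eq_iff)
qed

lemma invar1_iff: "invar1 h \<longleftrightarrow> (\<exists>C. (\<forall>j. invar (C j)) \<and> h = (\<lambda>i. \<Sum>j\<in>UNIV. C j * \<omega> j i))"
proof
  assume "\<exists>C. (\<forall>j. invar (C j)) \<and> h = (\<lambda>i. \<Sum>j\<in>UNIV. C j * \<omega> j i)"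
  then obtain C where C: "\<And>j. invar (C j)" "h = (\<lambda>i. \<Sum>j\<in>UNIV. C j * \<omega> j i)"
    by blast
  show "invar1 h"
    unfolding invar1_def
  proof (intro ballI allI)
    fix w n assume "w \<in> W"
    then have "shear k w (z ^ n) (C j) = C j" "lin_act1 (shear_mat k w (z ^ n)) (\<omega> j) = \<omega> j" for j
      using C(1) invar1_\<omega> by (auto simp: invar_def invar1_def)
    then show "lin_act1 (shear_mat k w (z ^ n)) h = h"
      unfolding C(2) lin_act1_sum lin_act1_smult lin_act_shear_mat by simp
  qed
qed (rule invar1_span)

end

section \<open>Matrices fixing a hyperplane pointwise\<close>

definition dot :: "'a::comm_ring_1 ^ 'n \<Rightarrow> 'a ^ 'n::finite \<Rightarrow> 'a" where
  "dot c u = (\<Sum>j\<in>UNIV. c $ j * u $ j)"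

text \<open>The matrix of \<open>v \<mapsto> v + c(v) u\<close>, the general linear map that fixes
  the kernel of \<open>c\<close> pointwise. Its determinant is \<open>1 + dot c u\<close>.\<close>

definition hfix :: "'a::comm_ring_1 ^ 'n \<Rightarrow> 'a ^ 'n \<Rightarrow> 'a ^ 'n ^ 'n::finite" where
  "hfix c u = (\<chi> i j. (if i = j then 1 else 0) + u $ i * c $ j)"

lemma hfix_nth: "hfix c u $ i $ j = (if i = j then 1 else 0) + u $ i * c $ j"
  by (simp add: hfix_def)

lemma dot_add: "dot c (u + v) = dot c u + dot c v"
  by (simp add: dot_def distrib_left sum.distrib)

lemma dot_smult: "dot c (x *s u) = x * dot c u"
  by (simp add: dot_def sum_distrib_left mult_ac)

lemma dot_0 [simp]: "dot c 0 = 0"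
  by (simp add: dot_def)

lemma sum_delta_mult:
  fixes g :: "'n::finite \<Rightarrow> 'a::comm_ring_1"
  shows "(\<Sum>l\<in>UNIV. (if i = l then 1 else 0) * g l) = g i"
    and "(\<Sum>l\<in>UNIV. g l * (if l = i then 1 else 0)) = g i"
  by (simp_all add: if_distrib[of "\<lambda>x. x * _"] if_distrib[of "\<lambda>x. _ * x"] cong: if_cong)

lemma hfix_0: "hfix c 0 = mat 1"
  by (simp add: hfix_def mat_def)

lemma hfix_mult: "hfix c u ** hfix c v = hfix c (v + (1 + dot c v) *s u)"
proof -
  have "(hfix c u ** hfix c v) $ i $ j = hfix c (v + (1 + dot c v) *s u) $ i $ j" for i j
  proof -
    have "(hfix c u ** hfix c v) $ i $ j =
        (\<Sum>l\<in>UNIV. (if i = l then 1 else 0) * hfix c v $ l $ j)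
        + (\<Sum>l\<in>UNIV. u $ i * c $ l * (if l = j then 1 else 0)) + (\<Sum>l\<in>UNIV. u $ i * c $ l * (v $ l * c $ j))"
      by (simp add: matrix_matrix_mult_def hfix_nth distrib_right distrib_left sum.distrib)
    also have "(\<Sum>l\<in>UNIV. u $ i * c $ l * (v $ l * c $ j)) = u $ i * dot c v * c $ j"
      by (simp add: dot_def sum_distrib_left sum_distrib_right mult_ac)
    finally show ?thesis
      unfolding sum_delta_mult by (simp add: hfix_nth algebra_simps)
  qed
  then show ?thesis
    by (simp add: vec_eq_iff)
qed

lemma hfix_mult_vec: "hfix c u *v v = v + dot c v *s u"
proof -
  have "(hfix c u *v v) $ i = v $ i + dot c v * u $ i" for i
  proof -
    have "(hfix c u *v v) $ i = (\<Sum>l\<in>UNIV. (if i = l then 1 else 0) * v $ l) + (\<Sum>l\<in>UNIV. u $ i * c $ l * v $ l)"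
      by (simp add: matrix_vector_mult_def hfix_nth distrib_right sum.distrib)
    then show ?thesis
      unfolding sum_delta_mult by (simp add: dot_def sum_distrib_left mult_ac)
  qed
  then show ?thesis
    by (simp add: vec_eq_iff)
qed

lemma nonzero_coord:
  fixes c :: "'a::zero ^ 'n"
  assumes "c \<noteq> 0"
  obtains k where "c $ k \<noteq> 0"
  using assms by (auto simp: vec_eq_iff)

lemma hfix_inject:
  fixes c :: "'a::field ^ 'n::finite"
  assumes "c \<noteq> 0" "hfix c u = hfix c v"
  shows "u = v"
proof -
  obtain k where k: "c $ k \<noteq> 0"
    using nonzero_coord[OF assms(1)] .
  have "u $ i * c $ k = v $ i * c $ k" for i
    using arg_cong[OF assms(2), of "\<lambda>A. A $ i $ k"] by (simp add: hfix_nth)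
  then show ?thesis
    using k by (simp add: vec_eq_iff)
qed

text \<open>The vectors \<open>c_k e_j - c_j e_k\<close> lie in the hyperplane; since
  \<open>g\<close> fixes them, its column \<open>k\<close> determines all other columns.\<close>

lemma fixes_hyperplane_imp_hfix:
  fixes c :: "'a::field ^ 'n::finite"
  assumes "c \<noteq> 0" and fix_H: "\<And>v. dot c v = 0 \<Longrightarrow> g *v v = v"
  shows "\<exists>u. g = hfix c u"
proof -
  obtain k where k: "c $ k \<noteq> 0"
    using nonzero_coord[OF assms(1)] .
  define \<delta> where "\<delta> i j = (if i = j then 1 else 0 :: 'a)" for i j :: 'n
  have \<delta>_sum: "(\<Sum>l\<in>UNIV. f l * \<delta> l j) = f j" for f j
    unfolding \<delta>_def by (rule sum_delta_mult)
  define u where "u = (\<chi> i. (g $ i $ k - \<delta> i k) / c $ k)"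
  have "g $ i $ j = \<delta> i j + u $ i * c $ j" for i j
  proof -
    define v where "v = (\<chi> l. c $ k * \<delta> l j - c $ j * \<delta> l k)"
    have lin: "(\<Sum>l\<in>UNIV. f l * v $ l) = c $ k * f j - c $ j * f k" for f
    proof -
      have "(\<Sum>l\<in>UNIV. f l * v $ l) = c $ k * (\<Sum>l\<in>UNIV. f l * \<delta> l j) - c $ j * (\<Sum>l\<in>UNIV. f l * \<delta> l k)"
        by (simp add: v_def right_diff_distrib sum_subtractf sum_distrib_left mult_ac)
      then show ?thesis
        by (simp add: \<delta>_sum)
    qed
    have "dot c v = 0"
      by (simp add: dot_def lin)
    then have "(g *v v) $ i = v $ i"
      using fix_H by simp
    then have "c $ k * g $ i $ j - c $ j * g $ i $ k = c $ k * \<delta> i j - c $ j * \<delta> i k"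
      by (simp add: matrix_vector_mult_def lin) (simp add: v_def)
    then have "g $ i $ j = \<delta> i j + (g $ i $ k - \<delta> i k) / c $ k * c $ j"
      using k by (simp add: field_simps)
    then show ?thesis
      by (simp add: u_def)
  qed
  then have "g = hfix c u"
    by (simp add: vec_eq_iff hfix_nth \<delta>_def)
  then show ?thesis ..
qed

text \<open>The vector \<open>u\<close> is sent to \<open>(1 + dot c u) u\<close>. If this were
  zero, then \<open>u = 0\<close> by injectivity, but then the factor is 1.\<close>

lemma invertible_hfix_imp:
  fixes c :: "'a::field ^ 'n::finite"
  assumes "c \<noteq> 0" "invertible (hfix c u)"
  shows "1 + dot c u \<noteq> 0"
proof
  assume 0: "1 + dot c u = 0"
  have "hfix c u *v u = (1 + dot c u) *s u"
    by (simp add: hfix_mult_vec vector_sadd_rdistrib)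
  then have "hfix c u *v u = 0"
    using 0 by simp
  moreover have "\<exists>B. B ** hfix c u = mat 1"
    using assms(2) by (auto simp: invertible_def)
  then have "\<forall>x. hfix c u *v x = 0 \<longrightarrow> x = 0"
    unfolding matrix_left_invertible_ker .
  ultimately have "u = 0"
    by blast
  then show False
    using 0 by simp
qed

lemma matpow_hfix:
  fixes c :: "'a::field ^ 'n::finite"
  shows "matpow (hfix c u) n = hfix c ((\<Sum>i<n. (1 + dot c u) ^ i) *s u)"
proof (induction n)
  case 0
  then show ?case
    by (simp add: matpow_def hfix_0)
next
  case (Suc n)
  define s where "s = (\<Sum>i<n. (1 + dot c u) ^ i)"
  have "matpow (hfix c u) (Suc n) = hfix c u ** hfix c (s *s u)"
    using Suc by (simp add: matpow_def s_def)
  also have "\<dots> = hfix c ((s + (1 + s * dot c u)) *s u)"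
    by (simp add: hfix_mult dot_smult vector_sadd_rdistrib)
  also have "1 + s * dot c u = (1 + dot c u) ^ n"
    using power_diff_1_eq[of "1 + dot c u" n] unfolding diff_eq_eq by (simp add: s_def add.commute mult.commute)
  finally show ?case
    by (simp add: s_def)
qed

text \<open>The geometric sum in \<open>matpow_hfix\<close>, multiplied by
  \<open>dot c u \<noteq> 0\<close>, becomes \<open>(1 + dot c u) ^ n - 1\<close>.\<close>

lemma matpow_hfix_eq_1_iff:
  fixes c :: "'a::field ^ 'n::finite"
  assumes "c \<noteq> 0" "dot c u \<noteq> 0"
  shows "matpow (hfix c u) n = mat 1 \<longleftrightarrow> (1 + dot c u) ^ n = 1"
proof -
  define s where "s = (\<Sum>i<n. (1 + dot c u) ^ i)"
  have "u \<noteq> 0"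
    using assms by auto
  have "matpow (hfix c u) n = mat 1 \<longleftrightarrow> hfix c (s *s u) = hfix c 0"
    by (simp add: matpow_hfix s_def hfix_0)
  also have "\<dots> \<longleftrightarrow> s *s u = 0"
    by (auto dest: hfix_inject[OF assms(1)])
  also have "\<dots> \<longleftrightarrow> s = 0"
    using \<open>u \<noteq> 0\<close> by (auto simp: vec_eq_iff)
  also have "\<dots> \<longleftrightarrow> (1 + dot c u - 1) * s = 0"
    using assms(2) by simp
  also have "\<dots> \<longleftrightarrow> (1 + dot c u) ^ n - 1 = 0"
    unfolding s_def power_diff_1_eq ..
  also have "\<dots> \<longleftrightarrow> (1 + dot c u) ^ n = 1"
    by simp
  finally show ?thesis .
qed

lemma not_is_hyperplane_UNIV: "\<not> is_hyperplane (UNIV :: ('a::field ^ 'n::finite) set)"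
proof
  assume "is_hyperplane (UNIV :: ('a ^ 'n) set)"
  then obtain c :: "'a ^ 'n" where c: "c \<noteq> 0" "\<And>v. dot c v = 0"
    by (auto simp: is_hyperplane_def dot_def)
  obtain k where k: "c $ k \<noteq> 0"
    using nonzero_coord[OF c(1)] .
  have "dot c (\<chi> l. if l = k then 1 else 0) = (\<Sum>l\<in>UNIV. c $ l * (if l = k then 1 else 0))"
    by (simp add: dot_def)
  also have "\<dots> = c $ k"
    by (rule sum_delta_mult)
  finally show False
    using c(2) k by simp
qed

lemma hfix_is_reflection:
  fixes c :: "'a::{field,finite} ^ 'n::finite"
  assumes "c \<noteq> 0" "invertible (hfix c u)" "dot c u \<noteq> 0"
  shows "is_reflection (hfix c u)"
proof -
  have "\<exists>n>0. (1 + dot c u) ^ n = 1"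
    using finite_field_power_eq_1[OF invertible_hfix_imp[OF assms(1,2)]] .
  moreover have "{v. hfix c u *v v = v} = {v. dot c v = 0}"
    using assms by (auto simp: hfix_mult_vec)
  ultimately show ?thesis
    using assms by (auto simp: is_reflection_def matpow_hfix_eq_1_iff is_hyperplane_def dot_def)
qed

section \<open>Diagonalizable reflections\<close>

lemma matrix_inv_mult:
  fixes A :: "'a::field ^ 'n ^ 'n"
  assumes "invertible A"
  shows "A ** matrix_inv A = mat 1" "matrix_inv A ** A = mat 1"
  using assms someI_ex[of "\<lambda>A'. A ** A' = mat 1 \<and> A' ** A = mat 1"]
  unfolding invertible_def matrix_inv_def by blast+

lemma invertible_if_ker:
  fixes A :: "'a::field ^ 'n ^ 'n"
  assumes "\<And>v. A *v v = 0 \<Longrightarrow> v = 0"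
  shows "invertible A"
  unfolding invertible_left_inverse matrix_left_invertible_ker using assms by simp

lemma matrix_mult_column: "column j (A ** B) = A *v column j B"
  by (simp add: vec_eq_iff column_def matrix_matrix_mult_def matrix_vector_mult_def)

lemma column_mult_diagonal:
  fixes P D :: "'a::comm_ring_1 ^ 'n ^ 'n::finite"
  assumes "\<forall>i j. i \<noteq> j \<longrightarrow> D $ i $ j = 0"
  shows "column j (P ** D) = D $ j $ j *s column j P"
proof -
  have "(\<Sum>l\<in>UNIV. P $ i $ l * D $ l $ j) = (\<Sum>l\<in>UNIV. if l = j then P $ i $ l * D $ j $ j else 0)" for i
    by (intro sum.cong) (auto simp: assms)
  then show ?thesis
    by (simp add: vec_eq_iff column_def matrix_matrix_mult_def mult.commute)
qed

text \<open>An eigenbasis consists of \<open>u\<close>, with eigenvalue \<open>1 + dot c u\<close>,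
  and the vectors \<open>e_j - (c_j / c_k) e_k\<close> of the hyperplane.\<close>

lemma hfix_diagonalizable:
  fixes c :: "'a::field ^ 'n::finite"
  assumes "c \<noteq> 0" "dot c u \<noteq> 0"
  shows "mat_diagonalizable (hfix c u)"
proof -
  obtain k where k: "c $ k \<noteq> 0"
    using nonzero_coord[OF assms(1)] .
  define p where "p j = (if j = k then u else (\<chi> i. (if i = j then 1 else 0) - (if i = k then c $ j / c $ k else 0)))" for j
  define P :: "'a ^ 'n ^ 'n" where "P = (\<chi> i j. p j $ i)"
  define D :: "'a ^ 'n ^ 'n" where "D = (\<chi> i j. if i = j then (if j = k then 1 + dot c u else 1) else 0)"
  have D: "\<forall>i j. i \<noteq> j \<longrightarrow> D $ i $ j = 0"
    by (simp add: D_def)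
  have colP: "column j P = p j" for j
    by (simp add: column_def P_def vec_eq_iff)
  have dot_p: "dot c (p j) = 0" if "j \<noteq> k" for j
  proof -
    have "c $ l * p j $ l = c $ l * (if l = j then 1 else 0) - c $ j / c $ k * (c $ l * (if l = k then 1 else 0))" for l
      using that by (auto simp: p_def algebra_simps)
    then show ?thesis
      unfolding dot_def by (simp only: sum_subtractf sum_delta_mult sum_distrib_left[symmetric]) (use k in simp)
  qed
  have "column j (hfix c u ** P) = column j (P ** D)" for j
    unfolding matrix_mult_column[of j "hfix c u"] column_mult_diagonal[OF D] colP hfix_mult_vec
    using dot_p[of j] by (auto simp: D_def p_def vec_eq_iff algebra_simps)
  then have gP: "hfix c u ** P = P ** D"
    by (simp add: vec_eq_iff column_def)
  have "v = 0" if v: "P *v v = 0" for v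
  proof -
    \<comment> \<open>The form \<open>c\<close> vanishes on all columns of \<open>P\<close> except
      \<open>u\<close> and thus isolates \<open>v $ k\<close>.\<close>
    have "0 = dot c (P *v v)"
      using v by simp
    also have "\<dots> = (\<Sum>i\<in>UNIV. \<Sum>j\<in>UNIV. c $ i * (p j $ i * v $ j))"
      by (simp add: dot_def matrix_vector_mult_def P_def sum_distrib_left)
    also have "\<dots> = (\<Sum>j\<in>UNIV. dot c (p j) * v $ j)"
      by (subst sum.swap) (simp add: dot_def sum_distrib_right mult.assoc)
    also have "\<dots> = dot c u * v $ k"
      using dot_p by (simp add: sum_split_index[of _ k] p_def)
    finally have vk: "v $ k = 0"
      using assms(2) by simp
    have "v $ i = 0" if "i \<noteq> k" for i
    proof -
      have "0 = (P *v v) $ i"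
        using v by simp
      also have "\<dots> = (\<Sum>j\<in>-{k}. p j $ i * v $ j)"
        using vk by (simp add: matrix_vector_mult_def P_def sum_split_index[of _ k])
      also have "\<dots> = (\<Sum>j\<in>-{k}. if j = i then v $ j else 0)"
        by (intro sum.cong) (use that in \<open>auto simp: p_def\<close>)
      finally show ?thesis
        using that by simp
    qed
    with vk show ?thesis
      by (metis vec_eq_iff zero_index)
  qed
  then have P: "invertible P"
    by (rule invertible_if_ker)
  have "hfix c u = hfix c u ** (P ** matrix_inv P)"
    using P by (simp add: matrix_inv_mult)
  also have "\<dots> = P ** D ** matrix_inv P"
    by (simp add: matrix_mul_assoc gP)
  finally show ?thesis
    unfolding mat_diagonalizable_def using P D by blast
qed

text \<open>If \<open>dot c u = 0\<close>, applying \<open>c\<close> to an eigenvector outside the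
  hyperplane shows that its eigenvalue is 1, hence \<open>u = 0\<close>, which is no reflection. So
  all columns of \<open>P\<close> would lie in the hyperplane, against invertibility.\<close>

lemma diagonalizable_reflection_imp:
  fixes c :: "'a::field ^ 'n::finite"
  assumes "c \<noteq> 0" "is_reflection (hfix c u)" "mat_diagonalizable (hfix c u)"
  shows "dot c u \<noteq> 0"
proof
  assume cu: "dot c u = 0"
  obtain P D :: "'a ^ 'n ^ 'n" where P: "invertible P" and D: "\<forall>i j. i \<noteq> j \<longrightarrow> D $ i $ j = 0"
    and g: "hfix c u = P ** D ** matrix_inv P"
    using assms(3) unfolding mat_diagonalizable_def by blast
  have gP: "hfix c u ** P = P ** D"
    unfolding g using matrix_inv_mult[OF P] by (simp add: matrix_mul_assoc[symmetric])
  have "u \<noteq> 0"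
  proof
    assume "u = 0"
    then have "{v. hfix c u *v v = v} = UNIV"
      by (simp add: hfix_mult_vec)
    then show False
      using assms(2) not_is_hyperplane_UNIV by (auto simp: is_reflection_def)
  qed
  have "dot c (column j P) = 0" for j
  proof (rule ccontr)
    assume nz: "dot c (column j P) \<noteq> 0"
    have eq: "column j P + dot c (column j P) *s u = D $ j $ j *s column j P"
      using arg_cong[OF gP, of "column j"]
      by (simp add: matrix_mult_column[of j "hfix c u"] column_mult_diagonal[OF D] hfix_mult_vec)
    have "dot c (column j P) = D $ j $ j * dot c (column j P)"
      using arg_cong[OF eq, of "dot c"] cu by (simp add: dot_add dot_smult)
    then have "D $ j $ j = 1"
      using nz by simp
    then have "dot c (column j P) *s u = 0"
      using eq by simp
    then show False
      using nz \<open>u \<noteq> 0\<close> by simp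
  qed
  then have cP: "(\<Sum>l\<in>UNIV. c $ l * P $ l $ j) = 0" for j
    by (simp add: dot_def column_def)
  obtain k where k: "c $ k \<noteq> 0"
    using nonzero_coord[OF assms(1)] .
  have "c $ k = (\<Sum>l\<in>UNIV. c $ l * (P ** matrix_inv P) $ l $ k)"
    unfolding matrix_inv_mult[OF P] mat_def by (simp add: sum_delta_mult)
  also have "\<dots> = (\<Sum>l\<in>UNIV. \<Sum>j\<in>UNIV. c $ l * (P $ l $ j * matrix_inv P $ j $ k))"
    by (simp add: matrix_matrix_mult_def sum_distrib_left)
  also have "\<dots> = (\<Sum>j\<in>UNIV. (\<Sum>l\<in>UNIV. c $ l * P $ l $ j) * matrix_inv P $ j $ k)"
    by (subst sum.swap) (simp add: sum_distrib_right mult.assoc)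
  also have "\<dots> = 0"
    by (simp add: cP)
  finally show False
    using k by simp
qed

section \<open>Change of coordinates\<close>

lemma lin_act_linform: "lin_act A (linform v) = linform (v v* A)"
proof -
  have "lin_act A (linform v) = (\<Sum>i\<in>UNIV. \<Sum>j\<in>UNIV. mconst (v $ i * A $ i $ j) * mvar j)"
    by (simp add: linform_def lin_act_def sum_distrib_left mult.assoc)
  also have "\<dots> = (\<Sum>j\<in>UNIV. \<Sum>i\<in>UNIV. mconst (v $ i * A $ i $ j) * mvar j)"
    by (rule sum.swap)
  also have "\<dots> = linform (v v* A)"
    by (simp add: linform_def vector_matrix_mult_def sum_distrib_left sum_distrib_right mult_ac)
  finally show ?thesis .
qed

lemma lin_act_lin_act: "lin_act A (lin_act B p) = lin_act (B ** A) p"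
proof -
  have "lin_act A (linform (B $ i)) = linform ((B ** A) $ i)" for i
    unfolding lin_act_linform
    by (rule arg_cong[where f = linform]) (simp add: vec_eq_iff vector_matrix_mult_def matrix_matrix_mult_def mult.commute)
  then show ?thesis
    unfolding lin_act_def[of B] lin_act_def[of "B ** A"]
    by (subst hom_msubst[OF lin_act.comm_ring_hom_axioms]) auto
qed

lemma lin_act1_lin_act1: "lin_act1 A (lin_act1 B h) = lin_act1 (B ** A) h"
proof
  fix j
  have "lin_act1 A (lin_act1 B h) j =
      (\<Sum>i\<in>UNIV. \<Sum>l\<in>UNIV. lin_act (B ** A) (h l) * mconst (B $ l $ i * A $ i $ j))"
    by (simp add: lin_act1_def lin_act_lin_act sum_distrib_right mult.assoc)
  also have "\<dots> = (\<Sum>l\<in>UNIV. \<Sum>i\<in>UNIV. lin_act (B ** A) (h l) * mconst (B $ l $ i * A $ i $ j))"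
    by (rule sum.swap)
  also have "\<dots> = lin_act1 (B ** A) h j"
    unfolding lin_act1_def matrix_matrix_mult_def by (simp add: sum_distrib_left)
  finally show "lin_act1 A (lin_act1 B h) j = lin_act1 (B ** A) h j" .
qed

lemma mat_1_nth: "mat 1 $ i $ j = (if i = j then 1 else 0)"
  by (simp add: mat_def)

lemma linform_mat_1: "linform (mat 1 $ i) = mvar i"
proof -
  have "linform (mat 1 $ i) = (\<Sum>j\<in>UNIV. if j = i then mvar j else 0)"
    unfolding linform_def by (intro sum.cong) (auto simp: mat_def)
  then show ?thesis
    by simp
qed

lemma lin_act_mat_1 [simp]: "lin_act (mat 1) p = p"
  unfolding lin_act_def by (rule msubst_id) (rule linform_mat_1)

lemma lin_act1_mat_1 [simp]: "lin_act1 (mat 1) h = h"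
proof
  fix j
  have "lin_act1 (mat 1) h j = (\<Sum>i\<in>UNIV. if i = j then h i else 0)"
    unfolding lin_act1_def by (intro sum.cong) (auto simp: mat_1_nth)
  then show "lin_act1 (mat 1) h j = h j"
    by simp
qed

lemma gact_eq_lin_act: "gact g = lin_act (matrix_inv g)"
  by (simp add: fun_eq_iff gact_def lin_act_def)

lemma gact1_eq_lin_act1: "gact1 g = lin_act1 (matrix_inv g)"
  by (simp add: fun_eq_iff gact1_def lin_act1_def gact_eq_lin_act)

lemma invariants_eq:
  assumes "is_matrix_group G"
  shows "invariants G = {p. \<forall>g\<in>G. lin_act g p = p}"
proof -
  have "lin_act g p = p" if g: "g \<in> G" and p: "\<forall>g\<in>G. lin_act (matrix_inv g) p = p" for g p
  proof -
    have "lin_act g p = lin_act g (lin_act (matrix_inv g) p)"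
      using g p by simp
    also have "\<dots> = p"
      using assms g by (simp add: lin_act_lin_act is_matrix_group_def matrix_inv_mult)
    finally show ?thesis .
  qed
  then show ?thesis
    using assms by (auto simp: invariants_def gact_eq_lin_act is_matrix_group_def)
qed

lemma invariant_forms_eq:
  assumes "is_matrix_group G"
  shows "invariant_forms G = {h. \<forall>g\<in>G. lin_act1 g h = h}"
proof -
  have "lin_act1 g h = h" if g: "g \<in> G" and h: "\<forall>g\<in>G. lin_act1 (matrix_inv g) h = h" for g h
  proof -
    have "lin_act1 g h = lin_act1 g (lin_act1 (matrix_inv g) h)"
      using g h by simp
    also have "\<dots> = h"
      using assms g by (simp add: lin_act1_lin_act1 is_matrix_group_def matrix_inv_mult)
    finally show ?thesis .
  qed
  then show ?thesis
    using assms by (auto simp: invariant_forms_def gact1_eq_lin_act1 is_matrix_group_def)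
qed

section \<open>Groups fixing a hyperplane pointwise\<close>

locale hyperplane_group =
  fixes G :: "('a::{field,finite} ^ 'n::finite ^ 'n) set" and c :: "'a ^ 'n"
  assumes G: "is_matrix_group G" and c: "c \<noteq> 0"
    and fix_H: "\<And>g v. g \<in> G \<Longrightarrow> dot c v = 0 \<Longrightarrow> g *v v = v"
begin

lemma one_G: "hfix c 0 \<in> G"
  using G by (simp add: hfix_0 is_matrix_group_def)

lemma invertible_G: "g \<in> G \<Longrightarrow> invertible g"
  using G by (simp add: is_matrix_group_def)

lemma mult_G: "g \<in> G \<Longrightarrow> h \<in> G \<Longrightarrow> g ** h \<in> G"
  using G by (simp add: is_matrix_group_def)

lemma inv_G: "g \<in> G \<Longrightarrow> matrix_inv g \<in> G"
  using G by (simp add: is_matrix_group_def)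

lemma G_hfix: "g \<in> G \<Longrightarrow> \<exists>u. g = hfix c u"
  using fixes_hyperplane_imp_hfix[OF c] fix_H by blast

lemma matpow_G: "g \<in> G \<Longrightarrow> matpow g n \<in> G"
  using G by (induction n) (auto simp: matpow_def is_matrix_group_def)

text \<open>The determinants of the elements of \<open>G\<close>, a finite multiplicative group of
  field elements and hence cyclic.\<close>

definition X :: "'a set" where
  "X = {1 + dot c u | u. hfix c u \<in> G}"

lemma X_generator: "\<exists>z. z \<in> X \<and> X = range (\<lambda>m::nat. z ^ m)"
proof (rule mult_subgroup_cyclic)
  show "0 \<notin> X"
    using invertible_hfix_imp[OF c] invertible_G by (fastforce simp: X_def)
  show "1 \<in> X"
    unfolding X_def using one_G by force
  fix x y assume "x \<in> X" "y \<in> X"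
  then obtain u v where uv: "x = 1 + dot c u" "hfix c u \<in> G" "y = 1 + dot c v" "hfix c v \<in> G"
    by (auto simp: X_def)
  have "hfix c (v + (1 + dot c v) *s u) \<in> G"
    using mult_G[OF uv(2,4)] by (simp add: hfix_mult)
  moreover have "1 + dot c (v + (1 + dot c v) *s u) = x * y"
    by (simp add: uv dot_add dot_smult algebra_simps)
  ultimately show "x * y \<in> X"
    unfolding X_def by force
qed blast

definition z :: 'a where
  "z = (SOME z. z \<in> X \<and> X = range (\<lambda>m::nat. z ^ m))"

lemma z_X: "z \<in> X" and X_eq: "X = range (\<lambda>m::nat. z ^ m)"
  using someI_ex[OF X_generator] unfolding z_def[symmetric] by blast+

definition e :: nat where
  "e = (LEAST k. 0 < k \<and> z ^ k = 1)"

lemma e_pos: "e > 0" and z_order: "z ^ n = 1 \<longleftrightarrow> e dvd n"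
proof -
  obtain u where "z = 1 + dot c u" "hfix c u \<in> G"
    using z_X by (auto simp: X_def)
  then have "z \<noteq> 0"
    using invertible_hfix_imp[OF c invertible_G] by simp
  then obtain l where l: "l > 0" "z ^ l = 1"
    using finite_field_power_eq_1 by blast
  show "e > 0" "z ^ n = 1 \<longleftrightarrow> e dvd n"
    unfolding e_def using power_eq_1_iff_dvd_Least[OF l] by blast+
qed

lemma diagonalizable_reflection_iff:
  assumes "hfix c u \<in> G"
  shows "is_reflection (hfix c u) \<and> mat_diagonalizable (hfix c u) \<longleftrightarrow> dot c u \<noteq> 0"
  using diagonalizable_reflection_imp[OF c] hfix_is_reflection[OF c invertible_G[OF assms]]
    hfix_diagonalizable[OF c] by blast

lemma mat_order_hfix: "mat_order (hfix c u) = (LEAST k. 0 < k \<and> (1 + dot c u) ^ k = 1)" if "dot c u \<noteq> 0"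
  unfolding mat_order_def matpow_hfix_eq_1_iff[OF c that] ..

text \<open>Diagonalizable reflections in \<open>G\<close> are the \<open>hfix c u\<close> with
  \<open>dot c u \<noteq> 0\<close>, of the same order as \<open>1 + dot c u\<close>. That scalar is
  a power of \<open>z\<close>, so the maximal order \<open>e\<close> is attained at determinant
  \<open>z\<close>; for \<open>z = 1\<close> there are none and both sides are 1.\<close>

lemma eH_eq: "eH G = e"
proof (cases "z = 1")
  case True
  then have "e = 1"
    using z_order[of 1] by simp
  have "dot c u = 0" if u: "hfix c u \<in> G" for u
  proof -
    have "1 + dot c u \<in> X"
      using u by (auto simp: X_def)
    then show ?thesis
      using True X_eq by auto
  qed
  then have "\<not> (is_reflection g \<and> mat_diagonalizable g)" if "g \<in> G" for g
    using G_hfix[OF that] that diagonalizable_reflection_iff by blast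
  then show ?thesis
    using \<open>e = 1\<close> by (auto simp: eH_def)
next
  case False
  obtain u where u: "z = 1 + dot c u" "hfix c u \<in> G"
    using z_X by (auto simp: X_def)
  then have nz: "dot c u \<noteq> 0"
    using False by auto
  have refl: "is_reflection (hfix c u) \<and> mat_diagonalizable (hfix c u)"
    using diagonalizable_reflection_iff[OF u(2)] nz by blast
  have "Max {mat_order g | g. g \<in> G \<and> is_reflection g \<and> mat_diagonalizable g} = e"
  proof (rule Max_eqI)
    show "finite {mat_order g | g. g \<in> G \<and> is_reflection g \<and> mat_diagonalizable g}"
      by simp
    have "mat_order (hfix c u) = e"
      using mat_order_hfix[OF nz] u(1) by (simp add: e_def)
    then show "e \<in> {mat_order g | g. g \<in> G \<and> is_reflection g \<and> mat_diagonalizable g}"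
      unfolding mem_Collect_eq using u(2) refl by (intro exI[of _ "hfix c u"]) simp
    fix y assume "y \<in> {mat_order g | g. g \<in> G \<and> is_reflection g \<and> mat_diagonalizable g}"
    then obtain g where g: "y = mat_order g" "g \<in> G" "is_reflection g \<and> mat_diagonalizable g"
      by blast
    obtain v where v: "g = hfix c v"
      using G_hfix[OF g(2)] by blast
    have nzv: "dot c v \<noteq> 0"
      using diagonalizable_reflection_iff[of v] g v by blast
    have "1 + dot c v \<in> X"
      using g(2) v by (auto simp: X_def)
    then obtain l where "1 + dot c v = z ^ l"
      unfolding X_eq by blast
    then have "(1 + dot c v) ^ e = 1"
      using z_order[of "l * e"] by (simp add: power_mult)
    then show "y \<le> e"
      unfolding g(1) v mat_order_hfix[OF nzv] using e_pos by (intro Least_le) auto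
  qed
  then show ?thesis
    using refl u(2) by (auto simp: eH_def)
qed

section \<open>Splitting the group into transvections and a diagonalizable cyclic part\<close>

lemma generator_element: "\<exists>s. hfix c s \<in> G \<and> 1 + dot c s = z \<and> (z = 1 \<longrightarrow> s = 0)"
proof (cases "z = 1")
  case True
  then show ?thesis
    using one_G by (intro exI[of _ 0]) simp
next
  case False
  then show ?thesis
    using z_X by (auto simp: X_def)
qed

text \<open>For \<open>z = 1\<close> the choice \<open>s = 0\<close> selects the identity instead of
  an arbitrary transvection.\<close>

definition s :: "'a ^ 'n" where
  "s = (SOME s. hfix c s \<in> G \<and> 1 + dot c s = z \<and> (z = 1 \<longrightarrow> s = 0))"

lemma s: "hfix c s \<in> G" "1 + dot c s = z" "z = 1 \<Longrightarrow> s = 0"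
  using someI_ex[OF generator_element] unfolding s_def[symmetric] by blast+

text \<open>Adding the multiples \<open>\<mu> $ i\<close> of the form \<open>c\<close> to the coordinates makes the generator of the
  diagonalizable part act by a scaling of \<open>c\<close> alone.  If \<open>z = 1\<close>, then \<open>\<mu> = 0\<close> because of
  \<open>inverse 0 = 0\<close>.\<close>

definition \<mu> :: "'a ^ 'n" where
  "\<mu> = inverse (1 - z) *s s"

text \<open>For \<open>z \<noteq> 1\<close> one has \<open>dot c \<mu> = - 1\<close>; for
  \<open>z = 1\<close> both sides vanish because \<open>x = 1\<close>.\<close>

lemma dot_\<mu>: "(1 - x) * dot c \<mu> = x - 1" if "z = 1 \<Longrightarrow> x = 1"
proof (cases "z = 1")
  case False
  have "dot c s = z - 1"
    using s(2)[symmetric] by simp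
  then have "dot c \<mu> = inverse (1 - z) * (z - 1)"
    unfolding \<mu>_def dot_smult by simp
  also have "\<dots> = - 1"
    using False by (simp add: field_simps)
  finally show ?thesis
    by simp
qed (use that in simp)

lemma matpow_s: "matpow (hfix c s) n = hfix c ((1 - z ^ n) *s \<mu>)"
proof (cases "z = 1")
  case True
  then show ?thesis
    using s(3) by (simp add: matpow_hfix \<mu>_def)
next
  case False
  have "(\<Sum>i<n. z ^ i) = (1 - z ^ n) * inverse (1 - z)"
    using power_diff_1_eq[of z n] False by (simp add: field_simps)
  then show ?thesis
    by (simp add: matpow_hfix s(2) \<mu>_def)
qed

lemma hfix_scaled_\<mu>: "hfix c ((1 - z ^ n) *s \<mu>) \<in> G"
  using matpow_G[OF s(1)] unfolding matpow_s .

text \<open>The kernel of the determinant: transvections and the identity, whose products add their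
  vectors.\<close>

definition W :: "('n \<Rightarrow> 'a) set" where
  "W = {($) u | u. hfix c u \<in> G \<and> dot c u = 0}"

lemma additive_shears_W: "additive_shears W"
proof
  show "(\<lambda>_. 0) \<in> W"
    unfolding W_def using one_G by (force simp: fun_eq_iff)
  fix w w' assume "w \<in> W" "w' \<in> W"
  then obtain u v where uv: "w = ($) u" "hfix c u \<in> G" "dot c u = 0" "w' = ($) v" "hfix c v \<in> G" "dot c v = 0"
    by (auto simp: W_def)
  have "hfix c (v + u) \<in> G"
    using mult_G[OF uv(2,5)] uv(6) by (simp add: hfix_mult)
  moreover have "dot c (v + u) = 0"
    using uv by (simp add: dot_add)
  moreover have "(\<lambda>j. w j + w' j) = ($) (v + u)"
    by (simp add: uv fun_eq_iff)
  ultimately show "(\<lambda>j. w j + w' j) \<in> W"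
    unfolding W_def by blast
qed

text \<open>Conjugation by \<open>hfix c s\<close> maps transvections in \<open>G\<close> to
  transvections in \<open>G\<close> and multiplies their vectors by \<open>z\<close>. This puts
  \<open>z\<close> into the multiplier field of \<open>W\<close>.\<close>

lemma z_scales_W: "(\<lambda>j. z * w j) \<in> W" if "w \<in> W"
proof -
  obtain u where u: "w = ($) u" "hfix c u \<in> G" "dot c u = 0"
    using \<open>w \<in> W\<close> by (auto simp: W_def)
  have "hfix c u ** hfix c s = hfix c s ** hfix c (z *s u)"
    using u(3) s(2) by (simp add: hfix_mult dot_smult add.commute)
  then have "matrix_inv (hfix c s) ** (hfix c u ** hfix c s) = hfix c (z *s u)"
    using matrix_inv_mult[OF invertible_G[OF s(1)]] by (simp add: matrix_mul_assoc)
  then have "hfix c (z *s u) \<in> G"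
    using mult_G[OF inv_G[OF s(1)] mult_G[OF u(2) s(1)]] by simp
  moreover have "dot c (z *s u) = 0"
    using u by (simp add: dot_smult)
  moreover have "(\<lambda>j. z * w j) = ($) (z *s u)"
    by (simp add: u fun_eq_iff)
  ultimately show ?thesis
    unfolding W_def by blast
qed

lemma z_power_scales_W: "(\<lambda>j. z ^ n * w j) \<in> W" if "w \<in> W"
proof (induction n)
  case (Suc n)
  then show ?case
    using z_scales_W[OF Suc] by (simp add: mult.assoc)
qed (use that in simp)

text \<open>Dividing by the power of \<open>hfix c s\<close> with the same determinant leaves a
  transvection with vector \<open>v\<close>. The correction by \<open>\<mu>\<close> removes the
  contribution of that power, and what remains is \<open>z ^ n\<close> times
  \<open>v\<close>.\<close>

lemma G_to_shear:
  assumes u: "hfix c u \<in> G"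
  shows "\<exists>n. 1 + dot c u = z ^ n \<and> (\<lambda>i. u $ i + dot c u * \<mu> $ i) \<in> W"
proof -
  have "1 + dot c u \<in> X"
    using u by (auto simp: X_def)
  then obtain n where n: "1 + dot c u = z ^ n"
    unfolding X_eq by blast
  have du: "dot c u = z ^ n - 1"
    using n[symmetric] by simp
  define t where "t = (1 - z ^ n) *s \<mu>"
  have t: "hfix c t \<in> G"
    unfolding t_def by (rule hfix_scaled_\<mu>)
  have dot_t: "dot c t = z ^ n - 1"
    unfolding t_def dot_smult by (rule dot_\<mu>) simp
  have "hfix c u ** matrix_inv (hfix c t) \<in> G"
    by (intro mult_G inv_G t u)
  then obtain v where v: "hfix c u ** matrix_inv (hfix c t) = hfix c v" "hfix c v \<in> G"
    using G_hfix by metis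
  have "hfix c u = hfix c u ** (matrix_inv (hfix c t) ** hfix c t)"
    using matrix_inv_mult[OF invertible_G[OF t]] by simp
  also have "\<dots> = hfix c v ** hfix c t"
    by (simp add: matrix_mul_assoc v(1))
  also have "\<dots> = hfix c (t + z ^ n *s v)"
    by (simp add: hfix_mult dot_t)
  finally have u_eq: "u = t + z ^ n *s v"
    by (rule hfix_inject[OF c])
  have "dot c u = z ^ n - 1 + z ^ n * dot c v"
    using arg_cong[OF u_eq, of "dot c"] by (simp only: dot_add dot_t dot_smult)
  then have "z ^ n * dot c v = 0"
    using du by simp
  moreover have "z ^ n \<noteq> 0"
    using n invertible_hfix_imp[OF c invertible_G[OF u]] by simp
  ultimately have "($) v \<in> W"
    unfolding W_def using v(2) by auto
  then have "(\<lambda>j. z ^ n * v $ j) \<in> W"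
    by (rule z_power_scales_W)
  moreover have "u $ i + dot c u * \<mu> $ i = z ^ n * v $ i" for i
    unfolding du using arg_cong[OF u_eq, of "\<lambda>u. u $ i"] by (simp add: t_def algebra_simps)
  ultimately show ?thesis
    using n by auto
qed

lemma shear_to_G:
  assumes "w \<in> W"
  shows "\<exists>u. hfix c u \<in> G \<and> 1 + dot c u = z ^ n \<and> (\<lambda>i. u $ i + dot c u * \<mu> $ i) = w"
proof -
  obtain v where v: "w = ($) v" "hfix c v \<in> G" "dot c v = 0"
    using assms by (auto simp: W_def)
  define u where "u = v + (1 - z ^ n) *s \<mu>"
  have "hfix c u \<in> G"
    unfolding u_def using mult_G[OF hfix_scaled_\<mu> v(2)] v(3) by (simp add: hfix_mult)
  moreover have du: "dot c u = z ^ n - 1"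
    unfolding u_def dot_add dot_smult v(3) using dot_\<mu>[of "z ^ n"] by simp
  moreover have "(\<lambda>i. u $ i + dot c u * \<mu> $ i) = w"
    unfolding du by (simp add: u_def v(1) fun_eq_iff algebra_simps)
  ultimately show ?thesis
    by (intro exI[of _ u]) simp
qed

text \<open>The rows are the new coordinate forms: \<open>c\<close> itself at \<open>k\<close>, and
  \<open>z_i + \<mu>_i c\<close> elsewhere.\<close>

definition coord_mat :: "'n \<Rightarrow> 'a ^ 'n ^ 'n" where
  "coord_mat k = (\<chi> i j. if i = k then c $ j else (if i = j then 1 else 0) + \<mu> $ i * c $ j)"

lemma coord_mat_nth:
  "coord_mat k $ i $ j = (if i = k then c $ j else (if i = j then 1 else 0) + \<mu> $ i * c $ j)"
  by (simp add: coord_mat_def)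

lemma invertible_coord_mat:
  assumes "c $ k \<noteq> 0"
  shows "invertible (coord_mat k)"
proof (rule invertible_if_ker)
  fix v assume v: "coord_mat k *v v = 0"
  have Mv: "(\<Sum>j\<in>UNIV. coord_mat k $ i $ j * v $ j) = 0" for i
    using arg_cong[OF v, of "\<lambda>u. u $ i"] by (simp add: matrix_vector_mult_def)
  have dv: "dot c v = 0"
    using Mv[of k] by (simp add: coord_mat_nth dot_def)
  have vi: "v $ i = 0" if "i \<noteq> k" for i
  proof -
    have "0 = (\<Sum>j\<in>UNIV. (if i = j then 1 else 0) * v $ j) + \<mu> $ i * dot c v"
      using Mv[of i] that by (simp add: coord_mat_nth dot_def distrib_right sum.distrib sum_distrib_left mult.assoc)
    then show ?thesis
      unfolding sum_delta_mult dv by simp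
  qed
  have "c $ k * v $ k = 0"
    using dv vi by (simp add: dot_def sum_split_index[of _ k])
  then show "v = 0"
    using assms vi by (metis mult_eq_0_iff vec_eq_iff zero_index)
qed

lemma coord_mat_hfix:
  "coord_mat k ** hfix c u =
    shear_mat k (\<lambda>i. u $ i + dot c u * \<mu> $ i) (1 + dot c u) ** coord_mat k"
proof -
  have row: "(\<Sum>l\<in>UNIV. c $ l * hfix c u $ l $ j) = (1 + dot c u) * c $ j" for j
  proof -
    have "(\<Sum>l\<in>UNIV. c $ l * hfix c u $ l $ j) = (\<Sum>l\<in>UNIV. c $ l * (if l = j then 1 else 0)) + (\<Sum>l\<in>UNIV. c $ l * u $ l * c $ j)"
      by (simp add: hfix_nth distrib_left sum.distrib mult.assoc)
    then show ?thesis
      unfolding sum_delta_mult by (simp add: dot_def sum_distrib_right distrib_right)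
  qed
  have "(coord_mat k ** hfix c u) $ i $ j =
      (shear_mat k (\<lambda>i. u $ i + dot c u * \<mu> $ i) (1 + dot c u) ** coord_mat k) $ i $ j" for i j
  proof (cases "i = k")
    case True
    have "(shear_mat k w x ** coord_mat k) $ k $ j = x * c $ j" for w x
    proof -
      have "shear_mat k w x $ k $ l * coord_mat k $ l $ j = (if l = k then x * c $ j else 0)" for l
        by (simp add: shear_mat_nth coord_mat_nth)
      then show ?thesis
        by (simp add: matrix_matrix_mult_def)
    qed
    moreover have "(coord_mat k ** hfix c u) $ k $ j = (1 + dot c u) * c $ j"
      by (simp add: matrix_matrix_mult_def coord_mat_nth row)
    ultimately show ?thesis
      using True by simp
  next
    case False
    have "(shear_mat k w x ** coord_mat k) $ i $ j = coord_mat k $ i $ j + w i * c $ j" for w x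
    proof -
      have "(shear_mat k w x ** coord_mat k) $ i $ j =
          (\<Sum>l\<in>UNIV. (if l = i then coord_mat k $ i $ j else 0) + (if l = k then w i * c $ j else 0))"
        unfolding matrix_matrix_mult_def using False
        by (auto intro!: sum.cong simp: shear_mat_nth coord_mat_nth[of k k])
      then show ?thesis
        by (simp add: sum.distrib)
    qed
    moreover have "(coord_mat k ** hfix c u) $ i $ j = hfix c u $ i $ j + \<mu> $ i * ((1 + dot c u) * c $ j)"
    proof -
      have "(coord_mat k ** hfix c u) $ i $ j = (\<Sum>l\<in>UNIV. (if i = l then 1 else 0) * hfix c u $ l $ j)
          + \<mu> $ i * (\<Sum>l\<in>UNIV. c $ l * hfix c u $ l $ j)"
        using False by (simp add: matrix_matrix_mult_def coord_mat_nth distrib_right sum.distrib sum_distrib_left mult.assoc)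
      then show ?thesis
        unfolding sum_delta_mult row .
    qed
    ultimately show ?thesis
      using False by (simp add: coord_mat_nth hfix_nth algebra_simps)
  qed
  then show ?thesis
    by (simp add: vec_eq_iff)
qed

lemma conj_G_to_shear:
  assumes "g \<in> G"
  shows "\<exists>w\<in>W. \<exists>n. coord_mat k ** g = shear_mat k w (z ^ n) ** coord_mat k"
proof -
  obtain u where u: "g = hfix c u"
    using G_hfix[OF assms] by blast
  obtain n where "1 + dot c u = z ^ n" "(\<lambda>i. u $ i + dot c u * \<mu> $ i) \<in> W"
    using G_to_shear assms u by blast
  then show ?thesis
    using coord_mat_hfix[of k u] unfolding u by auto
qed

lemma conj_shear_to_G:
  assumes "w \<in> W"
  shows "\<exists>g\<in>G. coord_mat k ** g = shear_mat k w (z ^ n) ** coord_mat k"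
proof -
  obtain u where "hfix c u \<in> G" "1 + dot c u = z ^ n" "(\<lambda>i. u $ i + dot c u * \<mu> $ i) = w"
    using shear_to_G[OF assms] by blast
  then show ?thesis
    using coord_mat_hfix[of k u] by auto
qed

end

theorem theorem6p1:
  fixes G :: "('a::{field,finite} ^ 'n::finite ^ 'n) set"
    and H :: "('a ^ 'n) set"
    and c :: "'a ^ 'n"
  assumes "odd CHAR('a)"
    and "is_matrix_group G" and "finite G"
    and "is_hyperplane H"
    and "\<forall>g\<in>G. \<forall>v\<in>H. g *v v = v"
    and "defines_hyperplane c H"
  shows "\<exists>(f :: 'n \<Rightarrow> ('a, 'n) mpoly) (k :: 'n) (a :: 'n \<Rightarrow> nat) (w :: 'n \<Rightarrow> ('a, 'n) oneform).
           basic_invariants G f \<and>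
           (\<forall>i. i \<noteq> k \<longrightarrow> (\<forall>j. dform (f i) j = (linform c ^ eH G) ^ a i * w i j)) \<and>
           w k = dform (f k) \<and>
           inv_module_span G w = invariant_forms G"
proof -
  interpret hyperplane_group G c
    using assms by unfold_locales (auto simp: defines_hyperplane_def dot_def)
  obtain k where k: "c $ k \<noteq> 0"
    using nonzero_coord[OF c] .
  interpret S: additive_shears k W
    by (rule additive_shears_W)
  obtain f0 d m \<alpha> where st: "shear_stage k W f0 d m \<alpha>" and d: "\<forall>w\<in>W. \<forall>j. j \<noteq> k \<longrightarrow> d j w = 0"
    using S.stage_final by blast
  interpret shear_stage k W f0 d m \<alpha>
    by (rule st)
  interpret final_stage k W f0 d m \<alpha> z e
    using d e_pos z_order z_scales_W by unfold_locales (auto simp: S.K_def)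
  \<comment> \<open>\<open>M\<close> conjugates \<open>G\<close> into the shears combined with
    powers of the scaling. Substitution by \<open>M\<close> transports invariants and invariant
    forms to \<open>G\<close> and sends \<open>mvar k\<close> to \<open>linform c\<close>.\<close>
  define M where "M = coord_mat k"
  define N where "N = matrix_inv M"
  have MN: "M ** N = mat 1" "N ** M = mat 1"
    unfolding N_def M_def by (rule matrix_inv_mult[OF invertible_coord_mat[OF k]])+
  have M_N: "lin_act M (lin_act N p) = p" and N_M: "lin_act N (lin_act M p) = p" for p
    by (simp_all add: lin_act_lin_act MN)
  have M_N1: "lin_act1 M (lin_act1 N h) = h" and N_M1: "lin_act1 N (lin_act1 M h) = h" for h
    by (simp_all add: lin_act1_lin_act1 MN)
  have inj_M: "lin_act M p = lin_act M q \<longleftrightarrow> p = q" for p q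
    by (metis N_M)
  have inj_M1: "lin_act1 M h = lin_act1 M h' \<longleftrightarrow> h = h'" for h h'
    by (metis N_M1)
  have inv_M: "lin_act M p \<in> invariants G \<longleftrightarrow> invar p" for p
  proof -
    have *: "lin_act g (lin_act M p) = lin_act M p \<longleftrightarrow> shear k w x p = p"
      if "M ** g = shear_mat k w x ** M" for g w x
      unfolding lin_act_lin_act that
      by (simp add: inj_M lin_act_shear_mat flip: lin_act_lin_act)
    show ?thesis
      unfolding invariants_eq[OF G] invar_def mem_Collect_eq
      using conj_G_to_shear[of _ k] conj_shear_to_G[of _ k] * unfolding M_def by metis
  qed
  have inv1_M: "lin_act1 M h \<in> invariant_forms G \<longleftrightarrow> invar1 h" for h
  proof -
    have *: "lin_act1 g (lin_act1 M h) = lin_act1 M h \<longleftrightarrow> lin_act1 (shear_mat k w x) h = h"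
      if "M ** g = shear_mat k w x ** M" for g w x
      unfolding lin_act1_lin_act1 that
      by (simp add: inj_M1 flip: lin_act1_lin_act1)
    show ?thesis
      unfolding invariant_forms_eq[OF G] invar1_def mem_Collect_eq
      using conj_G_to_shear[of _ k] conj_shear_to_G[of _ k] * unfolding M_def by metis
  qed
  define f where "f j = lin_act M (F j)" for j
  define w where "w j = lin_act1 M (\<omega> j)" for j
  have msubst_f: "msubst f p = lin_act M (msubst F p)" for p
    unfolding f_def[abs_def] by (rule hom_msubst[OF lin_act.comm_ring_hom_axioms, symmetric]) simp
  have "basic_invariants G f"
    unfolding basic_invariants_def
  proof (intro conjI allI impI Set.set_eqI)
    fix h
    have "h \<in> invariants G \<longleftrightarrow> lin_act N h \<in> range (msubst F)"
      using inv_M[of "lin_act N h"] by (simp add: M_N invar_iff)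
    also have "\<dots> \<longleftrightarrow> h \<in> range (msubst f)"
      unfolding image_iff msubst_f by (metis M_N N_M)
    finally show "h \<in> invariants G \<longleftrightarrow> h \<in> range (msubst f)" .
  next
    fix p assume "msubst f p = 0"
    then have "lin_act M (msubst F p) = lin_act M 0"
      by (simp add: msubst_f)
    then show "p = 0"
      unfolding inj_M by (rule msubst_F_eq_0)
  qed
  moreover have "dform (f i) j = (linform c ^ eH G) ^ a i * w i j" if "i \<noteq> k" for i j
  proof -
    have "M $ k = c"
      by (simp add: M_def coord_mat_def vec_eq_iff)
    then have "lin_act M (mvar k) = linform c"
      by (simp add: lin_act_def)
    moreover have "dform (F i) = (\<lambda>j. (mvar k ^ e) ^ a i * \<omega> i j)"
      using dform_F[OF that] by blast
    ultimately show ?thesis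
      by (simp add: f_def w_def dform_lin_act lin_act1_smult eH_eq)
  qed
  moreover have "w k = dform (f k)"
    by (simp add: w_def f_def dform_lin_act \<omega>_def)
  moreover have "inv_module_span G w = invariant_forms G"
  proof (rule Set.set_eqI)
    fix h
    have span: "(\<lambda>j. \<Sum>l\<in>UNIV. C l * w l j) = lin_act1 M (\<lambda>j. \<Sum>l\<in>UNIV. lin_act N (C l) * \<omega> l j)" for C
      by (simp add: lin_act1_sum lin_act1_smult M_N w_def)
    have inv_N: "p \<in> invariants G \<longleftrightarrow> invar (lin_act N p)" for p
      using inv_M[of "lin_act N p"] by (simp add: M_N)
    have "h \<in> invariant_forms G \<longleftrightarrow> invar1 (lin_act1 N h)"
      using inv1_M[of "lin_act1 N h"] by (simp add: M_N1)
    also have "\<dots> \<longleftrightarrow> (\<exists>C. (\<forall>l. invar (C l)) \<and> lin_act1 N h = (\<lambda>j. \<Sum>l\<in>UNIV. C l * \<omega> l j))"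
      by (rule invar1_iff)
    also have "\<dots> \<longleftrightarrow> (\<exists>C. (\<forall>l. C l \<in> invariants G) \<and> h = (\<lambda>j. \<Sum>l\<in>UNIV. C l * w l j))"
    proof
      assume "\<exists>C. (\<forall>l. invar (C l)) \<and> lin_act1 N h = (\<lambda>j. \<Sum>l\<in>UNIV. C l * \<omega> l j)"
      then obtain C where C: "\<And>l. invar (C l)" "lin_act1 N h = (\<lambda>j. \<Sum>l\<in>UNIV. C l * \<omega> l j)"
        by blast
      have "h = (\<lambda>j. \<Sum>l\<in>UNIV. lin_act M (C l) * w l j)"
        using arg_cong[OF C(2), of "lin_act1 M"] by (simp add: span M_N1 N_M)
      then show "\<exists>C. (\<forall>l. C l \<in> invariants G) \<and> h = (\<lambda>j. \<Sum>l\<in>UNIV. C l * w l j)"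
        using C(1) inv_M by (intro exI[of _ "\<lambda>l. lin_act M (C l)"]) simp
    next
      assume "\<exists>C. (\<forall>l. C l \<in> invariants G) \<and> h = (\<lambda>j. \<Sum>l\<in>UNIV. C l * w l j)"
      then obtain C where C: "\<And>l. C l \<in> invariants G" "h = (\<lambda>j. \<Sum>l\<in>UNIV. C l * w l j)"
        by blast
      have "lin_act1 N h = (\<lambda>j. \<Sum>l\<in>UNIV. lin_act N (C l) * \<omega> l j)"
        unfolding C(2) span N_M1 ..
      then show "\<exists>C. (\<forall>l. invar (C l)) \<and> lin_act1 N h = (\<lambda>j. \<Sum>l\<in>UNIV. C l * \<omega> l j)"
        using C(1) inv_N by (intro exI[of _ "\<lambda>l. lin_act N (C l)"]) simp
    qed
    finally show "h \<in> inv_module_span G w \<longleftrightarrow> h \<in> invariant_forms G"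
      unfolding inv_module_span_def by blast
  qed
  ultimately show ?thesis
    by blast
qed

end
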